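(* Let $(M,g)=(B\times_f F,\ g_B+f^2g_F)$ be a warped product manifold with $m_1=\dim B$, let $(\overline{M},\overline{g})=(\overline{M}(c),\phi,\xi,\eta,\overline{g})$ be a Sasakian space form of constant $\phi$-sectional curvature $c$, and let $\psi:(M,g)\to(\overline{M},\overline{g})$ be an isometric immersion. Assume that $(M,g)$ is a totally geodesic $\phi$-totally real submanifold of $(\overline{M},\overline{g})$ (i.e., $\phi(TM)\subset TM^{\perp}$) with $\xi\in\Gamma(TM^{\perp})$. Then $$m_1\frac{c+3}{4}\ \le\ \frac{\triangle f}{f}\ \le\ m_1\frac{c+3}{4}.$$
   Context: $(B,g_B)$ and $(F,g_F)$ are Riemannian manifolds (of positive dimension), $f:B\to\mathbb{R}^+$ is a smooth positive function (the warping function), and $B\times_f F$ is the product $B\times F$ with the metric $g=g_B+f^2g_F$; $f$ is also regarded as a function on $M$ via the projection to $B$. The Laplacian is $\triangle f=\sum_i\big((\nabla_{v_i}v_i)f-v_i^2f\big)$ for a local orthonormal frame $\{v_i\}$ of $TM$, where $\nabla$ is the Levi-Civita connection of $M$ (note the sign). Totally geodesic means that the second fundamental form of the immersion vanishes identically; $TM^\perp$ is the normal bundle, and $\xi\in\Gamma(TM^\perp)$ means $\xi$ is normal to $M$ along $M$. A Sasakian manifold is an almost contact metric manifold $(\overline{M},\phi,\xi,\eta,\overline{g})$ (so $\phi^2=-\mathrm{id}+\eta\otimes\xi$, $\eta(\xi)=1$, $\overline{g}(\phi X,\phi Y)=\overline{g}(X,Y)-\eta(X)\eta(Y)$) with $(\overline{\nabla}_X\phi)Y=\overline{g}(X,Y)\xi-\eta(Y)X$.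 It is a Sasakian space form of constant $\phi$-sectional curvature $c$ when all planes spanned by $X,\phi X$ with $X\perp\xi$ have sectional curvature $c$; its curvature tensor is $$\overline{R}(X,Y)Z=\tfrac{c+3}{4}\big(\overline{g}(Y,Z)X-\overline{g}(X,Z)Y\big)+\tfrac{c-1}{4}\big(\eta(X)\eta(Z)Y-\eta(Y)\eta(Z)X+\eta(Y)\overline{g}(X,Z)\xi-\eta(X)\overline{g}(Y,Z)\xi+\overline{g}(\phi Y,Z)\phi X-\overline{g}(\phi X,Z)\phi Y-2\overline{g}(\phi X,Y)\phi Z\big).$$
   Formalization: The Laplacian of f is taken on the base B, with frame and Levi-Civita connection of B; with the Laplacian of the whole warped product M the claim fails, e.g. for the sphere minus two poles as (0,π)×_sin S^(n-1) in the Sasakian sphere S^(2n+1). *)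

theory Defs
  imports "HOL-Analysis.Analysis" "HOL-Library.Function_Algebras"
begin

text \<open>
  A manifold is a whole type \<open>'p\<close> (Hausdorff and second countable by its type class) with a
  smooth atlas modelled on a Euclidean space \<open>'e\<close>; its dimension is \<open>DIM('e) \<ge> 1\<close>. The atlas
  need not be maximal: all notions below depend only on the smooth structure it generates.
\<close>

primrec Ck_on :: "nat \<Rightarrow> 'a::euclidean_space set \<Rightarrow> ('a \<Rightarrow> 'b::real_normed_vector) \<Rightarrow> bool" where
  "Ck_on 0 S f \<longleftrightarrow> continuous_on S f"
| "Ck_on (Suc k) S f \<longleftrightarrow>
     (\<forall>x\<in>S. f differentiable (at x)) \<and> (\<forall>v. Ck_on k S (\<lambda>x. frechet_derivative f (at x) v))"

text \<open>Only used for open \<open>S\<close>.\<close>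

definition smooth_on :: "'a::euclidean_space set \<Rightarrow> ('a \<Rightarrow> 'b::real_normed_vector) \<Rightarrow> bool" where
  "smooth_on S f \<longleftrightarrow> (\<forall>k. Ck_on k S f)"

type_synonym ('p, 'e) chart = "'p set \<times> ('p \<Rightarrow> 'e)"
type_synonym ('p, 'e) atlas = "('p, 'e) chart set"

definition is_chart :: "('p::topological_space, 'e::euclidean_space) chart \<Rightarrow> bool" where
  "is_chart = (\<lambda>(U, x). open U \<and> open (x ` U) \<and> homeomorphism U (x ` U) x (inv_into U x))"

definition smooth_atlas ::
  "('p::{t2_space, second_countable_topology}, 'e::euclidean_space) atlas \<Rightarrow> bool" where
  "smooth_atlas A \<longleftrightarrow>
     (\<forall>c\<in>A. is_chart c) \<and> (\<Union>(U, x)\<in>A. U) = UNIV \<and>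
     (\<forall>(U, x)\<in>A. \<forall>(V, y)\<in>A. smooth_on (x ` (U \<inter> V)) (y \<circ> inv_into U x))"

definition manifold_dim :: "('p, 'e::euclidean_space) atlas \<Rightarrow> nat" where
  "manifold_dim A = DIM('e)"

definition product_atlas :: "('p, 'e) atlas \<Rightarrow> ('q, 'f) atlas \<Rightarrow> ('p \<times> 'q, 'e \<times> 'f) atlas" where
  "product_atlas A B = {(U \<times> V, map_prod x y) |U x V y. (U, x) \<in> A \<and> (V, y) \<in> B}"

definition smooth_map ::
  "('p::topological_space, 'e::euclidean_space) atlas \<Rightarrow>
   ('q::topological_space, 'f::euclidean_space) atlas \<Rightarrow> ('p \<Rightarrow> 'q) \<Rightarrow> bool" where
  "smooth_map A B \<psi> \<longleftrightarrow> continuous_on UNIV \<psi> \<and>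
     (\<forall>(U, x)\<in>A. \<forall>(V, y)\<in>B. smooth_on (x ` (U \<inter> \<psi> -` V)) (y \<circ> \<psi> \<circ> inv_into U x))"

definition smooth_fun_on ::
  "('p, 'e::euclidean_space) atlas \<Rightarrow> 'p set \<Rightarrow> ('p \<Rightarrow> real) \<Rightarrow> bool" where
  "smooth_fun_on A W h \<longleftrightarrow> (\<forall>(U, x)\<in>A. smooth_on (x ` (U \<inter> W)) (h \<circ> inv_into U x))"

definition smooth_at ::
  "('p::topological_space, 'e::euclidean_space) atlas \<Rightarrow> 'p \<Rightarrow> ('p \<Rightarrow> real) \<Rightarrow> bool" where
  "smooth_at A p h \<longleftrightarrow> (\<exists>W. open W \<and> p \<in> W \<and> smooth_fun_on A W h)"


section \<open>Tangent vectors and vector fields\<close>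

text \<open>
  Tangent vectors are directional derivative operators on the functions that are smooth near the
  point. HOL functions are total, so they are given the value \<open>0\<close> on all other functions; this
  makes equality of tangent vectors equality of operators. Linear structure is pointwise.
\<close>

type_synonym 'p tvec = "('p \<Rightarrow> real) \<Rightarrow> real"
type_synonym 'p vfield = "'p \<Rightarrow> 'p tvec"

instantiation "fun" :: (type, real_vector) real_vector
begin

definition scaleR_fun :: "real \<Rightarrow> ('a \<Rightarrow> 'b) \<Rightarrow> 'a \<Rightarrow> 'b" where
  "scaleR_fun a f = (\<lambda>x. a *\<^sub>R f x)"

instance
  by standard (simp_all add: scaleR_fun_def fun_eq_iff plus_fun_def scaleR_add_right scaleR_add_left)

end

definition coord_vec ::
  "('p::topological_space, 'e::euclidean_space) atlas \<Rightarrow> ('p, 'e) chart \<Rightarrow> 'p \<Rightarrow> 'e \<Rightarrow> 'p tvec" where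
  "coord_vec A = (\<lambda>(U, x) p e h.
     if smooth_at A p h then frechet_derivative (h \<circ> inv_into U x) (at (x p)) e else 0)"

definition tangent_space ::
  "('p::topological_space, 'e::euclidean_space) atlas \<Rightarrow> 'p \<Rightarrow> 'p tvec set" where
  "tangent_space A p = {coord_vec A (U, x) p e |U x e. (U, x) \<in> A \<and> p \<in> U}"

definition pushforward ::
  "('q::topological_space, 'f::euclidean_space) atlas \<Rightarrow> ('p \<Rightarrow> 'q) \<Rightarrow> 'p \<Rightarrow> 'p tvec \<Rightarrow> 'q tvec" where
  "pushforward B \<psi> p v = (\<lambda>h. if smooth_at B (\<psi> p) h then v (h \<circ> \<psi>) else 0)"

text \<open>
  Vector fields are local: \<open>X\<close> is a smooth field on the open set \<open>W\<close>, with arbitrary values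
  outside \<open>W\<close>.
\<close>

definition smooth_vfield_on ::
  "('p::topological_space, 'e::euclidean_space) atlas \<Rightarrow> 'p set \<Rightarrow> 'p vfield \<Rightarrow> bool" where
  "smooth_vfield_on A W X \<longleftrightarrow> (\<forall>p\<in>W. X p \<in> tangent_space A p) \<and>
     (\<forall>V h. open V \<and> V \<subseteq> W \<and> smooth_fun_on A V h \<longrightarrow> smooth_fun_on A V (\<lambda>p. X p h))"

definition lie_bracket ::
  "('p::topological_space, 'e::euclidean_space) atlas \<Rightarrow> 'p vfield \<Rightarrow> 'p vfield \<Rightarrow> 'p vfield" where
  "lie_bracket A X Y = (\<lambda>p h.
     if smooth_at A p h then X p (\<lambda>q. Y q h) - Y p (\<lambda>q. X q h) else 0)"

definition linear_on_set :: "'a::real_vector set \<Rightarrow> ('a \<Rightarrow> 'b::real_vector) \<Rightarrow> bool" where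
  "linear_on_set S T \<longleftrightarrow>
     (\<forall>u\<in>S. \<forall>v\<in>S. T (u + v) = T u + T v) \<and> (\<forall>u\<in>S. \<forall>a. T (a *\<^sub>R u) = a *\<^sub>R T u)"


section \<open>Riemannian metrics, connections, curvature\<close>

type_synonym 'p metric = "'p \<Rightarrow> 'p tvec \<Rightarrow> 'p tvec \<Rightarrow> real"

definition riemannian_metric ::
  "('p::topological_space, 'e::euclidean_space) atlas \<Rightarrow> 'p metric \<Rightarrow> bool" where
  "riemannian_metric A g \<longleftrightarrow>
     (\<forall>p. \<forall>u\<in>tangent_space A p.
        linear_on_set (tangent_space A p) (g p u) \<and>
        (\<forall>v\<in>tangent_space A p. g p u v = g p v u) \<and>
        (u \<noteq> 0 \<longrightarrow> g p u u > 0)) \<and>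
     (\<forall>W X Y. open W \<and> smooth_vfield_on A W X \<and> smooth_vfield_on A W Y \<longrightarrow>
        smooth_fun_on A W (\<lambda>p. g p (X p) (Y p)))"

text \<open>\<open>D X Y p\<close> is \<open>(\<nabla>\<^sub>X Y)(p)\<close>. Since \<open>h\<close> may be the indicator function of a
  neighbourhood of \<open>p\<close>, the axioms also say that \<open>D X Y p\<close> depends only on \<open>X\<close> and \<open>Y\<close>
  near \<open>p\<close>.\<close>

type_synonym 'p connection = "'p vfield \<Rightarrow> 'p vfield \<Rightarrow> 'p vfield"

definition affine_connection ::
  "('p::topological_space, 'e::euclidean_space) atlas \<Rightarrow> 'p connection \<Rightarrow> bool" where
  "affine_connection A D \<longleftrightarrow>
     (\<forall>W X Y Z h. open W \<and> smooth_vfield_on A W X \<and> smooth_vfield_on A W Y \<and>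
        smooth_vfield_on A W Z \<and> smooth_fun_on A W h \<longrightarrow>
        smooth_vfield_on A W (D X Y) \<and>
        (\<forall>p\<in>W. D (\<lambda>q. X q + Y q) Z p = D X Z p + D Y Z p \<and>
               D (\<lambda>q. h q *\<^sub>R X q) Y p = h p *\<^sub>R D X Y p \<and>
               D X (\<lambda>q. Y q + Z q) p = D X Y p + D X Z p \<and>
               D X (\<lambda>q. h q *\<^sub>R Y q) p = X p h *\<^sub>R Y p + h p *\<^sub>R D X Y p))"

definition levi_civita ::
  "('p::topological_space, 'e::euclidean_space) atlas \<Rightarrow> 'p metric \<Rightarrow> 'p connection \<Rightarrow> bool" where
  "levi_civita A g D \<longleftrightarrow> affine_connection A D \<and>
     (\<forall>W X Y Z. open W \<and> smooth_vfield_on A W X \<and> smooth_vfield_on A W Y \<and>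
        smooth_vfield_on A W Z \<longrightarrow>
        (\<forall>p\<in>W. D X Y p - D Y X p = lie_bracket A X Y p \<and>
               X p (\<lambda>q. g q (Y q) (Z q)) = g p (D X Y p) (Z p) + g p (Y p) (D X Z p)))"

definition curvature ::
  "('p::topological_space, 'e::euclidean_space) atlas \<Rightarrow> 'p connection \<Rightarrow>
   'p vfield \<Rightarrow> 'p vfield \<Rightarrow> 'p vfield \<Rightarrow> 'p vfield" where
  "curvature A D X Y Z = (\<lambda>p.
     D X (D Y Z) p - D Y (D X Z) p - D (lie_bracket A X Y) Z p)"

definition sectional_curvature ::
  "('p::topological_space, 'e::euclidean_space) atlas \<Rightarrow> 'p metric \<Rightarrow> 'p connection \<Rightarrow>
   'p vfield \<Rightarrow> 'p vfield \<Rightarrow> 'p \<Rightarrow> real" where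
  "sectional_curvature A g D X Y p =
     g p (curvature A D X Y Y p) (X p) /
     (g p (X p) (X p) * g p (Y p) (Y p) - (g p (X p) (Y p))\<^sup>2)"

definition orthonormal_frame_on ::
  "('p::topological_space, 'e::euclidean_space) atlas \<Rightarrow> 'p metric \<Rightarrow> 'p set \<Rightarrow>
   (nat \<Rightarrow> 'p vfield) \<Rightarrow> bool" where
  "orthonormal_frame_on A g W v \<longleftrightarrow>
     (\<forall>i<manifold_dim A. smooth_vfield_on A W (v i)) \<and>
     (\<forall>i<manifold_dim A. \<forall>j<manifold_dim A. \<forall>p\<in>W. g p (v i p) (v j p) = (if i = j then 1 else 0))"

text \<open>
  The Laplacian, computed in a local orthonormal frame \<open>v\<close>; it is minus the trace of the Hessian.
  For a warping function \<open>f\<close> the quantity \<open>\<triangle>f / f\<close> is a sum of mixed sectional curvatures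
  when \<open>\<triangle>\<close> is the Laplacian of the base. The Laplacian of the total space has the additional
  term \<open>- dim F * |grad f|^2 / f\<close>, coming from the vertical part of the frame.
\<close>

definition laplacian ::
  "('p, 'e::euclidean_space) atlas \<Rightarrow> 'p connection \<Rightarrow> (nat \<Rightarrow> 'p vfield) \<Rightarrow>
   ('p \<Rightarrow> real) \<Rightarrow> 'p \<Rightarrow> real" where
  "laplacian A D v h p =
     (\<Sum>i<manifold_dim A. D (v i) (v i) p h - v i p (\<lambda>q. v i q h))"

definition warped_metric ::
  "('p::topological_space, 'e::euclidean_space) atlas \<Rightarrow> 'p metric \<Rightarrow>
   ('q::topological_space, 'f::euclidean_space) atlas \<Rightarrow> 'q metric \<Rightarrow>
   ('p \<Rightarrow> real) \<Rightarrow> ('p \<times> 'q) metric" where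
  "warped_metric A gA B gB f = (\<lambda>z u v.
     gA (fst z) (pushforward A fst z u) (pushforward A fst z v) +
     (f (fst z))\<^sup>2 * gB (snd z) (pushforward B snd z u) (pushforward B snd z v))"


section \<open>Isometric immersions\<close>

definition isometric_immersion ::
  "('p::topological_space, 'e::euclidean_space) atlas \<Rightarrow> 'p metric \<Rightarrow>
   ('q::topological_space, 'f::euclidean_space) atlas \<Rightarrow> 'q metric \<Rightarrow> ('p \<Rightarrow> 'q) \<Rightarrow> bool" where
  "isometric_immersion A g B g' \<psi> \<longleftrightarrow> smooth_map A B \<psi> \<and>
     (\<forall>p. inj_on (pushforward B \<psi> p) (tangent_space A p) \<and>
        (\<forall>u\<in>tangent_space A p. \<forall>v\<in>tangent_space A p.
           g' (\<psi> p) (pushforward B \<psi> p u) (pushforward B \<psi> p v) = g p u v))"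

definition normal_tangent_space ::
  "('p::topological_space, 'e::euclidean_space) atlas \<Rightarrow>
   ('q::topological_space, 'f::euclidean_space) atlas \<Rightarrow> 'q metric \<Rightarrow> ('p \<Rightarrow> 'q) \<Rightarrow>
   'p \<Rightarrow> 'q tvec set" where
  "normal_tangent_space A B g' \<psi> p =
     {w \<in> tangent_space B (\<psi> p). \<forall>u\<in>tangent_space A p. g' (\<psi> p) w (pushforward B \<psi> p u) = 0}"

text \<open>\<open>X'\<close> on \<open>W'\<close> is an extension of the field \<open>X\<close> on \<open>W\<close> to the ambient manifold.\<close>

definition extends_field ::
  "('q::topological_space, 'f::euclidean_space) atlas \<Rightarrow> ('p \<Rightarrow> 'q) \<Rightarrow>
   'p set \<Rightarrow> 'p vfield \<Rightarrow> 'q set \<Rightarrow> 'q vfield \<Rightarrow> bool" where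
  "extends_field B \<psi> W X W' X' \<longleftrightarrow> open W' \<and> \<psi> ` W \<subseteq> W' \<and> smooth_vfield_on B W' X' \<and>
     (\<forall>p\<in>W. X' (\<psi> p) = pushforward B \<psi> p (X p))"

text \<open>The Gauss formula: the second fundamental form of \<open>X\<close>, \<open>Y\<close> computed from ambient
  extensions \<open>X'\<close>, \<open>Y'\<close>.\<close>

definition second_fundamental_form ::
  "'p connection \<Rightarrow> ('q::topological_space, 'f::euclidean_space) atlas \<Rightarrow> 'q connection \<Rightarrow>
   ('p \<Rightarrow> 'q) \<Rightarrow> 'p vfield \<Rightarrow> 'p vfield \<Rightarrow> 'q vfield \<Rightarrow> 'q vfield \<Rightarrow> 'p \<Rightarrow> 'q tvec" where
  "second_fundamental_form D B D' \<psi> X Y X' Y' p =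
     D' X' Y' (\<psi> p) - pushforward B \<psi> p (D X Y p)"

definition totally_geodesic ::
  "('p::topological_space, 'e::euclidean_space) atlas \<Rightarrow> 'p connection \<Rightarrow>
   ('q::topological_space, 'f::euclidean_space) atlas \<Rightarrow> 'q connection \<Rightarrow> ('p \<Rightarrow> 'q) \<Rightarrow> bool" where
  "totally_geodesic A D B D' \<psi> \<longleftrightarrow>
     (\<forall>W X Y W' X' Y'. open W \<and> smooth_vfield_on A W X \<and> smooth_vfield_on A W Y \<and>
        extends_field B \<psi> W X W' X' \<and> extends_field B \<psi> W Y W' Y' \<longrightarrow>
        (\<forall>p\<in>W. second_fundamental_form D B D' \<psi> X Y X' Y' p = 0))"


section \<open>Sasakian space forms\<close>

definition almost_contact_metric ::
  "('p::topological_space, 'e::euclidean_space) atlas \<Rightarrow> ('p \<Rightarrow> 'p tvec \<Rightarrow> 'p tvec) \<Rightarrow>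
   'p vfield \<Rightarrow> ('p \<Rightarrow> 'p tvec \<Rightarrow> real) \<Rightarrow> 'p metric \<Rightarrow> bool" where
  "almost_contact_metric A \<phi> \<xi> \<eta> g \<longleftrightarrow>
     riemannian_metric A g \<and>
     smooth_vfield_on A UNIV \<xi> \<and>
     (\<forall>p. linear_on_set (tangent_space A p) (\<phi> p) \<and> linear_on_set (tangent_space A p) (\<eta> p)) \<and>
     (\<forall>W X. open W \<and> smooth_vfield_on A W X \<longrightarrow>
        smooth_vfield_on A W (\<lambda>p. \<phi> p (X p)) \<and> smooth_fun_on A W (\<lambda>p. \<eta> p (X p))) \<and>
     (\<forall>p. \<forall>u\<in>tangent_space A p. \<phi> p u \<in> tangent_space A p \<and>
        \<phi> p (\<phi> p u) = - u + \<eta> p u *\<^sub>R \<xi> p) \<and>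
     (\<forall>p. \<eta> p (\<xi> p) = 1) \<and>
     (\<forall>p. \<forall>u\<in>tangent_space A p. \<forall>v\<in>tangent_space A p.
        g p (\<phi> p u) (\<phi> p v) = g p u v - \<eta> p u * \<eta> p v)"

definition sasakian ::
  "('p::topological_space, 'e::euclidean_space) atlas \<Rightarrow> ('p \<Rightarrow> 'p tvec \<Rightarrow> 'p tvec) \<Rightarrow>
   'p vfield \<Rightarrow> ('p \<Rightarrow> 'p tvec \<Rightarrow> real) \<Rightarrow> 'p metric \<Rightarrow> 'p connection \<Rightarrow> bool" where
  "sasakian A \<phi> \<xi> \<eta> g D \<longleftrightarrow>
     almost_contact_metric A \<phi> \<xi> \<eta> g \<and> levi_civita A g D \<and>
     (\<forall>W X Y. open W \<and> smooth_vfield_on A W X \<and> smooth_vfield_on A W Y \<longrightarrow>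
        (\<forall>p\<in>W. D X (\<lambda>q. \<phi> q (Y q)) p - \<phi> p (D X Y p) =
               g p (X p) (Y p) *\<^sub>R \<xi> p - \<eta> p (Y p) *\<^sub>R X p))"

definition sasakian_space_form ::
  "('p::topological_space, 'e::euclidean_space) atlas \<Rightarrow> ('p \<Rightarrow> 'p tvec \<Rightarrow> 'p tvec) \<Rightarrow>
   'p vfield \<Rightarrow> ('p \<Rightarrow> 'p tvec \<Rightarrow> real) \<Rightarrow> 'p metric \<Rightarrow> 'p connection \<Rightarrow> real \<Rightarrow> bool" where
  "sasakian_space_form A \<phi> \<xi> \<eta> g D c \<longleftrightarrow>
     sasakian A \<phi> \<xi> \<eta> g D \<and>
     (\<forall>W X. open W \<and> smooth_vfield_on A W X \<longrightarrow>
        (\<forall>p\<in>W. X p \<noteq> 0 \<and> g p (X p) (\<xi> p) = 0 \<longrightarrow>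
           sectional_curvature A g D X (\<lambda>q. \<phi> q (X q)) p = c))"

definition phi_totally_real ::
  "('p::topological_space, 'e::euclidean_space) atlas \<Rightarrow>
   ('q::topological_space, 'f::euclidean_space) atlas \<Rightarrow> 'q metric \<Rightarrow>
   ('q \<Rightarrow> 'q tvec \<Rightarrow> 'q tvec) \<Rightarrow> ('p \<Rightarrow> 'q) \<Rightarrow> bool" where
  "phi_totally_real A B g' \<phi> \<psi> \<longleftrightarrow>
     (\<forall>p. \<forall>u\<in>tangent_space A p. \<phi> (\<psi> p) (pushforward B \<psi> p u) \<in> normal_tangent_space A B g' \<psi> p)"

end

theory Submission
  imports Defs
begin

text \<open>
  Let \<open>X\<close> be a unit field on \<open>B\<close> and \<open>V\<close> a field on \<open>F\<close>, both lifted to the warped product. There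
  \<open>\<nabla>\<^sub>X V = \<nabla>\<^sub>V X = (X f / f) V\<close>, \<open>\<nabla>\<^sub>X X\<close> is the lift of the corresponding field of \<open>B\<close>, and
  \<open>[X, V] = 0\<close>, so that \<open>R(X, V)X = ((X X f - (\<nabla>\<^sub>X X) f) / f) V\<close>: the summand of
  \<open>\<triangle>f / f\<close> belonging to \<open>X\<close> is the sectional curvature of the plane spanned by \<open>X\<close> and \<open>V\<close>.
  As the immersion is totally geodesic, this is also the sectional curvature of the image plane,
  which is orthogonal to \<open>\<xi>\<close> and totally real, hence equal to \<open>(c + 3) / 4\<close>.
\<close>

text \<open>The value (c + 3) / 4 has to be derived: \<open>sasakian_space_form\<close> prescribes
  only the curvature of planes spanned by X and \<phi> X. Differentiating \<phi> shows by how much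
  the curvature on fields orthogonal to \<xi> fails to be \<phi>-invariant. A correction quadratic
  in the fundamental 2-form turns it into a tensor with the symmetries of a Kaehler curvature tensor
  and constant holomorphic curvature c + 3; polarisation yields a quarter of this on totally real
  planes, where the correction vanishes. Fields are local and arbitrary off their open set. The
  algebra therefore takes place in a real vector space of fields on one open set, evaluated at a
  point, so that the curvature enters through its linearity over constants. The second fundamental
  form is defined by ambient extensions, and total geodesy says nothing until these are constructed;
  the smooth inverse function theorem serves this purpose. The vertical field comes from the
  positive dimension of the fibre. Each summand of the Laplacian is computed exactly, so both bounds
  express one equality.\<close>

section \<open>Smooth functions on open subsets of Euclidean spaces\<close>

lemma Ck_on_imp_continuous_on: "Ck_on k S f \<Longrightarrow> continuous_on S f"
proof (cases k)
  case (Suc j)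
  assume "Ck_on k S f"
  then show ?thesis
    using Suc by (intro continuous_at_imp_continuous_on ballI differentiable_imp_continuous_within) simp
qed simp

lemma Ck_on_Suc_imp: "Ck_on (Suc k) S f \<Longrightarrow> Ck_on k S f"
proof (induction k arbitrary: f)
  case 0 then show ?case using Ck_on_imp_continuous_on[OF 0] by simp
next
  case (Suc k)
  have "(\<forall>x\<in>S. f differentiable at x) \<and> (\<forall>v. Ck_on (Suc k) S (\<lambda>x. frechet_derivative f (at x) v))"
    using Suc.prems Ck_on.simps(2)[of "Suc k" S f] by blast
  then show ?case using Suc.IH Ck_on.simps(2)[of k S f] by blast
qed

text \<open>Derivatives are taken \<open>at x\<close> and not within the set, so shrinking the set
  does not change them.\<close>

lemma Ck_on_subset: "Ck_on k S f \<Longrightarrow> T \<subseteq> S \<Longrightarrow> Ck_on k T f"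
  by (induction k arbitrary: f) (auto intro: continuous_on_subset)

lemma differentiable_transform_open:
  assumes "f differentiable at x" "open S" "x \<in> S" "\<And>y. y \<in> S \<Longrightarrow> f y = g y"
  shows "g differentiable at x"
  using assms has_derivative_transform_within_open unfolding differentiable_def by blast

text \<open>Openness of \<open>S\<close> makes agreement on \<open>S\<close> an agreement near each
  point, which is all that a derivative sees.\<close>

lemma Ck_on_cong:
  assumes "open S" "\<And>x. x \<in> S \<Longrightarrow> f x = g x"
  shows "Ck_on k S f \<longleftrightarrow> Ck_on k S g"
  using assms(2)
proof (induction k arbitrary: f g)
  case 0 then show ?case by (auto intro: continuous_on_eq)
next
  case (Suc k)
  have d: "f differentiable at x \<longleftrightarrow> g differentiable at x" if "x \<in> S" for x
    using differentiable_transform_open[OF _ assms(1) that] Suc.prems by metis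
  show ?case
  proof (cases "\<forall>x\<in>S. f differentiable at x")
    case True
    have "frechet_derivative f (at x) = frechet_derivative g (at x)" if "x \<in> S" for x
      using frechet_derivative_transform_within_open[OF _ assms(1) that] True Suc.prems that by metis
    then have "Ck_on k S (\<lambda>x. frechet_derivative f (at x) v)
        \<longleftrightarrow> Ck_on k S (\<lambda>x. frechet_derivative g (at x) v)" for v
      by (intro Suc.IH) auto
    with d show ?thesis by auto
  qed (use d in auto)
qed

lemma Ck_on_local:
  assumes "\<And>x. x \<in> S \<Longrightarrow> \<exists>T. open T \<and> x \<in> T \<and> Ck_on k T f"
  shows "Ck_on k S f"
  using assms
proof (induction k arbitrary: f)
  case 0
  then show ?case
    by (auto intro!: continuous_at_imp_continuous_on simp: continuous_on_eq_continuous_at)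
       (metis continuous_on_eq_continuous_at)
next
  case (Suc k)
  have "\<forall>x\<in>S. f differentiable at x" using Suc.prems by auto
  moreover have "Ck_on k S (\<lambda>x. frechet_derivative f (at x) v)" for v
    using Suc.prems by (intro Suc.IH) force
  ultimately show ?case by simp
qed

text \<open>The introduction rule for the inductions on the order: an explicit formula for the
  derivative replaces \<open>frechet_derivative\<close>.\<close>

lemma Ck_on_Suc_has_derivative:
  assumes "open S" "\<And>x. x \<in> S \<Longrightarrow> (f has_derivative f' x) (at x)"
    "\<And>v. Ck_on k S (\<lambda>x. f' x v)"
  shows "Ck_on (Suc k) S f"
proof -
  have "frechet_derivative f (at x) = f' x" if "x \<in> S" for x
    using frechet_derivative_at[OF assms(2)[OF that]] by simp
  then have "Ck_on k S (\<lambda>x. frechet_derivative f (at x) v)" for v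
    using assms(3)[of v] Ck_on_cong[OF assms(1), of "\<lambda>x. f' x v" "\<lambda>x. frechet_derivative f (at x) v"]
    by simp
  with assms(2) show ?thesis by (auto simp: differentiable_def)
qed

lemma Ck_on_has_derivative:
  "Ck_on (Suc k) S f \<Longrightarrow> x \<in> S \<Longrightarrow> (f has_derivative frechet_derivative f (at x)) (at x)"
  by (simp add: frechet_derivative_works[symmetric])

lemma Ck_on_const: "Ck_on k S (\<lambda>x. c)"
  by (induction k arbitrary: c) auto

lemma Ck_on_add:
  assumes "open S"
  shows "Ck_on k S f \<Longrightarrow> Ck_on k S g \<Longrightarrow> Ck_on k S (\<lambda>x. f x + g x)"
proof (induction k arbitrary: f g)
  case (Suc k)
  show ?case
    by (rule Ck_on_Suc_has_derivative[OF assms has_derivative_add[OF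
          Ck_on_has_derivative[OF Suc.prems(1)] Ck_on_has_derivative[OF Suc.prems(2)]]])
      (use Suc in auto)
qed (auto intro: continuous_intros)

lemma Ck_on_linear:
  assumes "open S" "bounded_linear L"
  shows "Ck_on k S f \<Longrightarrow> Ck_on k S (\<lambda>x. L (f x))"
proof (induction k arbitrary: f)
  case 0 then show ?case using assms(2) by (auto intro: bounded_linear.continuous_on)
next
  case (Suc k)
  show ?case
    by (rule Ck_on_Suc_has_derivative[OF assms(1) bounded_linear.has_derivative[OF assms(2)
          Ck_on_has_derivative[OF Suc.prems]]])
      (use Suc in auto)
qed

lemma Ck_on_id: "open S \<Longrightarrow> Ck_on k S (\<lambda>x. x)"
  by (cases k) (auto simp: Ck_on_const)

text \<open>The product rule pairs each factor with the derivative of the other, so the factors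
  themselves are also used at the lower order.\<close>

lemma Ck_on_bilinear:
  assumes "open S" "bounded_bilinear P"
  shows "Ck_on k S f \<Longrightarrow> Ck_on k S g \<Longrightarrow> Ck_on k S (\<lambda>x. P (f x) (g x))"
proof (induction k arbitrary: f g)
  case 0 then show ?case using assms(2) by (auto intro: bounded_bilinear.continuous_on)
next
  case (Suc k)
  show ?case
    by (rule Ck_on_Suc_has_derivative[OF assms(1) bounded_bilinear.FDERIV[OF assms(2)
          Ck_on_has_derivative[OF Suc.prems(1)] Ck_on_has_derivative[OF Suc.prems(2)]]])
      (use Suc.prems Ck_on_Suc_imp[OF Suc.prems(1)] Ck_on_Suc_imp[OF Suc.prems(2)]
       in \<open>auto intro!: Suc.IH Ck_on_add assms(1)\<close>)
qed

lemma Ck_on_sum: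
  assumes "open S" "\<And>i. i \<in> I \<Longrightarrow> Ck_on k S (f i)"
  shows "Ck_on k S (\<lambda>x. \<Sum>i\<in>I. f i x)"
  using assms(2)
  by (induction I rule: infinite_finite_induct) (auto intro!: Ck_on_const Ck_on_add assms(1))

lemma linear_basis_expand:
  fixes L :: "'a::euclidean_space \<Rightarrow> 'b::real_vector"
  assumes "linear L"
  shows "L w = (\<Sum>b\<in>Basis. (w \<bullet> b) *\<^sub>R L b)"
proof -
  have "L w = L (\<Sum>b\<in>Basis. (w \<bullet> b) *\<^sub>R b)" by (simp add: euclidean_representation)
  then show ?thesis by (simp add: linear_sum[OF assms] linear_cmul[OF assms])
qed

text \<open>Both the map and its argument vary with \<open>x\<close>; expanding \<open>w x\<close>
  in the basis leaves a finite sum of products. Derivatives of compositions and pushforwards of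
  fields have this shape.\<close>

lemma Ck_on_linear_family:
  fixes w :: "'a::euclidean_space \<Rightarrow> 'c::euclidean_space"
  assumes "open S" "\<And>x. x \<in> S \<Longrightarrow> linear (A x)"
    "\<And>b. b \<in> Basis \<Longrightarrow> Ck_on k S (\<lambda>x. A x b)" "Ck_on k S w"
  shows "Ck_on k S (\<lambda>x. A x (w x))"
proof -
  have "Ck_on k S (\<lambda>x. \<Sum>b\<in>Basis. (w x \<bullet> b) *\<^sub>R A x b)"
    by (intro Ck_on_sum assms(1) Ck_on_bilinear[OF _ bounded_bilinear_scaleR] assms(3)
        Ck_on_linear[OF _ _ assms(4)] bounded_linear_inner_left)
  then show ?thesis
    by (subst Ck_on_cong[OF assms(1)]) (auto intro!: linear_basis_expand assms(2))
qed

text \<open>The induction generalises over \<open>g\<close> only. The chain rule gives a linear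
  family, the differential of \<open>g\<close> along \<open>f\<close>, applied to a derivative of
  \<open>f\<close>; the entries of the family are derivatives of \<open>g\<close> composed with the
  same \<open>f\<close>.\<close>

lemma Ck_on_compose:
  fixes f :: "'a::euclidean_space \<Rightarrow> 'c::euclidean_space"
  assumes "open S" "open T"
  shows "Ck_on k S f \<Longrightarrow> Ck_on k T g \<Longrightarrow> f ` S \<subseteq> T \<Longrightarrow> Ck_on k S (\<lambda>x. g (f x))"
proof (induction k arbitrary: g)
  case 0 then show ?case by (auto intro: continuous_on_compose2)
next
  case (Suc k)
  have fT: "f x \<in> T" if "x \<in> S" for x using that Suc.prems(3) by auto
  show ?case
  proof (rule Ck_on_Suc_has_derivative[OF assms(1)])
    fix x assume x: "x \<in> S"
    show "((\<lambda>x. g (f x)) has_derivative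
        (\<lambda>v. frechet_derivative g (at (f x)) (frechet_derivative f (at x) v))) (at x)"
      by (rule has_derivative_compose[OF Ck_on_has_derivative[OF Suc.prems(1) x]
          Ck_on_has_derivative[OF Suc.prems(2) fT[OF x]]])
  next
    fix v
    show "Ck_on k S (\<lambda>x. frechet_derivative g (at (f x)) (frechet_derivative f (at x) v))"
    proof (rule Ck_on_linear_family[OF assms(1)])
      show "linear (frechet_derivative g (at (f x)))" if "x \<in> S" for x
        using Suc.prems(2) fT[OF that] by (auto intro!: linear_frechet_derivative)
      show "Ck_on k S (\<lambda>x. frechet_derivative g (at (f x)) b)" for b
        using Suc.prems(2,3) by (intro Suc.IH[OF Ck_on_Suc_imp[OF Suc.prems(1)]]) auto
      show "Ck_on k S (\<lambda>x. frechet_derivative f (at x) v)" using Suc.prems(1) by simp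
    qed
  qed
qed

section \<open>Smooth maps and their closure properties\<close>

lemma smooth_onD: "smooth_on S f \<Longrightarrow> Ck_on k S f" by (simp add: smooth_on_def)

lemma smooth_on_differentiable: "smooth_on S f \<Longrightarrow> x \<in> S \<Longrightarrow> f differentiable (at x)"
  using smooth_onD[of S f "Suc 0"] by auto

lemma smooth_on_continuous: "smooth_on S f \<Longrightarrow> continuous_on S f"
  using smooth_onD[of S f 0] by auto

lemma smooth_on_has_derivative:
  "smooth_on S f \<Longrightarrow> x \<in> S \<Longrightarrow> (f has_derivative frechet_derivative f (at x)) (at x)"
  by (simp add: frechet_derivative_works[symmetric] smooth_on_differentiable)

lemma smooth_on_frechet: "smooth_on S f \<Longrightarrow> smooth_on S (\<lambda>x. frechet_derivative f (at x) v)"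
  unfolding smooth_on_def by (metis Ck_on.simps(2))

lemma smooth_on_subset: "smooth_on S f \<Longrightarrow> T \<subseteq> S \<Longrightarrow> smooth_on T f"
  using Ck_on_subset unfolding smooth_on_def by blast

lemma smooth_on_cong:
  "open S \<Longrightarrow> (\<And>x. x \<in> S \<Longrightarrow> f x = g x) \<Longrightarrow> smooth_on S f \<longleftrightarrow> smooth_on S g"
  using Ck_on_cong unfolding smooth_on_def by blast

lemma smooth_on_transform:
  "smooth_on S f \<Longrightarrow> open S \<Longrightarrow> (\<And>x. x \<in> S \<Longrightarrow> f x = g x) \<Longrightarrow> smooth_on S g"
  using smooth_on_cong[of S f g] by auto

lemma smooth_on_local:
  "(\<And>x. x \<in> S \<Longrightarrow> \<exists>T. open T \<and> x \<in> T \<and> smooth_on T f) \<Longrightarrow> smooth_on S f"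
  unfolding smooth_on_def by (meson Ck_on_local)

lemma smooth_on_const: "smooth_on S (\<lambda>x. c)"
  by (simp add: smooth_on_def Ck_on_const)

lemma smooth_on_id: "open S \<Longrightarrow> smooth_on S (\<lambda>x. x)"
  by (simp add: smooth_on_def Ck_on_id)

lemma smooth_on_linear: "open S \<Longrightarrow> bounded_linear L \<Longrightarrow> smooth_on S f \<Longrightarrow> smooth_on S (\<lambda>x. L (f x))"
  by (simp add: smooth_on_def Ck_on_linear)

lemma smooth_on_add: "open S \<Longrightarrow> smooth_on S f \<Longrightarrow> smooth_on S g \<Longrightarrow> smooth_on S (\<lambda>x. f x + g x)"
  by (simp add: smooth_on_def Ck_on_add)

lemma smooth_on_bilinear:
  "open S \<Longrightarrow> bounded_bilinear P \<Longrightarrow> smooth_on S f \<Longrightarrow> smooth_on S g \<Longrightarrow> smooth_on S (\<lambda>x. P (f x) (g x))"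
  by (simp add: smooth_on_def Ck_on_bilinear)

lemma smooth_on_sum:
  "open S \<Longrightarrow> (\<And>i. i \<in> I \<Longrightarrow> smooth_on S (f i)) \<Longrightarrow> smooth_on S (\<lambda>x. \<Sum>i\<in>I. f i x)"
  by (simp add: smooth_on_def Ck_on_sum)

lemma smooth_on_linear_family:
  fixes w :: "'a::euclidean_space \<Rightarrow> 'c::euclidean_space"
  assumes "open S" "\<And>x. x \<in> S \<Longrightarrow> linear (A x)"
    "\<And>b. b \<in> Basis \<Longrightarrow> smooth_on S (\<lambda>x. A x b)" "smooth_on S w"
  shows "smooth_on S (\<lambda>x. A x (w x))"
  using assms Ck_on_linear_family unfolding smooth_on_def by blast

lemma smooth_on_compose:
  fixes f :: "'a::euclidean_space \<Rightarrow> 'c::euclidean_space"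
  assumes "open S" "open T" "smooth_on S f" "smooth_on T g" "f ` S \<subseteq> T"
  shows "smooth_on S (\<lambda>x. g (f x))"
  using assms Ck_on_compose unfolding smooth_on_def by blast

lemma smooth_on_Pair:
  fixes f :: "'a::euclidean_space \<Rightarrow> 'b::real_normed_vector"
    and g :: "'a \<Rightarrow> 'c::real_normed_vector"
  assumes "open S" "smooth_on S f" "smooth_on S g"
  shows "smooth_on S (\<lambda>x. (f x, g x))"
proof -
  have "smooth_on S (\<lambda>x. (f x, 0) + (0, g x))"
    using assms
    by (intro smooth_on_add smooth_on_linear[of _ "\<lambda>u. (u, 0)"] smooth_on_linear[of _ "\<lambda>u. (0, u)"])
       (auto intro!: bounded_linear_intros)
  then show ?thesis by simp
qed

text \<open>Product rule for a factor \<open>n\<close> that is merely continuous; this suffices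
  because the other factor vanishes at \<open>x\<close>. It serves to differentiate an inverse whose
  differentiability is not yet known.\<close>

lemma has_derivative_scaleR_zero:
  fixes \<beta> :: "'a::real_normed_vector \<Rightarrow> real" and n :: "'a \<Rightarrow> 'b::real_normed_vector"
  assumes d: "(\<beta> has_derivative \<beta>') (at x)" and 0: "\<beta> x = 0" and n: "isCont n x"
  shows "((\<lambda>y. \<beta> y *\<^sub>R n y) has_derivative (\<lambda>u. \<beta>' u *\<^sub>R n x)) (at x)"
proof -
  interpret b: bounded_linear \<beta>' using d by (rule has_derivative_bounded_linear)
  obtain K where K: "\<And>u. norm (\<beta>' u) \<le> norm u * K" using b.bounded by blast
  have l1: "((\<lambda>y. (1 / norm (y - x)) *\<^sub>R (\<beta> y - \<beta>' (y - x))) \<longlongrightarrow> 0) (at x)"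
    using d 0 by (simp add: has_derivative_within)
  have l2: "((\<lambda>y. n y - n x) \<longlongrightarrow> 0) (at x)"
    using n by (simp add: isCont_def LIM_zero_iff)
  \<comment> \<open>The quotient involving \<open>\<beta>'\<close> is bounded, while
    \<open>n y - n x\<close> tends to zero.\<close>
  have l3: "((\<lambda>y. (\<beta>' (y - x) / norm (y - x)) *\<^sub>R (n y - n x)) \<longlongrightarrow> 0) (at x)"
  proof (rule Lim_null_comparison)
    show "((\<lambda>y. \<bar>K\<bar> * norm (n y - n x)) \<longlongrightarrow> 0) (at x)"
      using tendsto_mult_right_zero[OF tendsto_norm_zero[OF l2]] by blast
    show "\<forall>\<^sub>F y in at x. norm ((\<beta>' (y - x) / norm (y - x)) *\<^sub>R (n y - n x)) \<le> \<bar>K\<bar> * norm (n y - n x)"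
    proof (intro always_eventually allI)
      fix y
      have "\<bar>\<beta>' (y - x)\<bar> / norm (y - x) \<le> \<bar>K\<bar>"
        using K[of "y - x"] abs_ge_self[of K]
        by (cases "y = x") (auto simp: field_simps intro: order_trans mult_left_mono)
      then show "norm ((\<beta>' (y - x) / norm (y - x)) *\<^sub>R (n y - n x)) \<le> \<bar>K\<bar> * norm (n y - n x)"
        using mult_right_mono[of "\<bar>\<beta>' (y - x)\<bar> / norm (y - x)" "\<bar>K\<bar>" "norm (n y - n x)"] by simp
    qed
  qed
  have "((\<lambda>y. ((1 / norm (y - x)) *\<^sub>R (\<beta> y - \<beta>' (y - x))) *\<^sub>R n y
      + (\<beta>' (y - x) / norm (y - x)) *\<^sub>R (n y - n x)) \<longlongrightarrow> 0) (at x)"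
    using tendsto_add[OF tendsto_scaleR[OF l1 n[unfolded isCont_def]] l3] by simp
  moreover have "((1 / norm (y - x)) *\<^sub>R (\<beta> y - \<beta>' (y - x))) *\<^sub>R n y
      + (\<beta>' (y - x) / norm (y - x)) *\<^sub>R (n y - n x)
     = (1 / norm (y - x)) *\<^sub>R (\<beta> y *\<^sub>R n y - (\<beta> x *\<^sub>R n x + \<beta>' (y - x) *\<^sub>R n x))" for y
    using 0 by (simp add: algebra_simps divide_inverse)
  ultimately show ?thesis
    by (auto simp: has_derivative_within intro!: bounded_linear_intros b.bounded_linear_axioms)
qed


text \<open>With w = N x0 v one has N x v = w - N x (A x w - v). The argument of N x on the right
  vanishes at x0, so continuity of \<open>N\<close> already gives its differentiability there. The
  derivative is composed of \<open>N\<close> and the derivative of \<open>A\<close>, which makes an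
  induction on the order possible.\<close>

lemma smooth_on_inverse_family:
  fixes A N :: "'a::euclidean_space \<Rightarrow> 'c::euclidean_space \<Rightarrow> 'c"
  assumes S: "open S" and lA: "\<And>x. x \<in> S \<Longrightarrow> linear (A x)" and lN: "\<And>x. x \<in> S \<Longrightarrow> linear (N x)"
    and NA: "\<And>x w. x \<in> S \<Longrightarrow> N x (A x w) = w" and AN: "\<And>x w. x \<in> S \<Longrightarrow> A x (N x w) = w"
    and sm: "\<And>v. smooth_on S (\<lambda>x. A x v)"
  shows "smooth_on S (\<lambda>x. N x v)"
proof -
  \<comment> \<open>Let \<open>K\<close> bound the inverse at \<open>x0\<close>. Where
    \<open>A x\<close> differs from \<open>A x0\<close> by less than 1 / (2 K) in norm, half of the
    norm of w is absorbed and 2 K bounds the inverse at \<open>x\<close>.\<close>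
  have bound: "\<exists>K. \<forall>\<^sub>F x in at x0. x \<in> S \<and> (\<forall>u. norm (N x u) \<le> K * norm u)" if x0: "x0 \<in> S" for x0
  proof -
    obtain K where K: "K > 0" "\<And>w. norm (N x0 w) \<le> K * norm w"
      using linear_bounded_pos[OF lN[OF x0]] by blast
    \<comment> \<open>An upper bound for the operator norm of the difference of \<open>A x\<close>
      and \<open>A x0\<close>.\<close>
    define s where "s x = (\<Sum>b\<in>Basis. norm (A x b - A x0 b))" for x
    have "isCont (\<lambda>x. A x b) x0" for b
      using smooth_on_continuous[OF sm] S x0 continuous_on_eq_continuous_at by blast
    then have "((\<lambda>x. A x b - A x0 b) \<longlongrightarrow> 0) (at x0)" for b
      by (simp add: isCont_def LIM_zero)
    then have "(s \<longlongrightarrow> 0) (at x0)"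
      unfolding s_def by (intro tendsto_null_sum tendsto_norm_zero)
    then have ev: "\<forall>\<^sub>F x in at x0. s x < 1 / (2 * K)"
      using K(1) by (intro order_tendstoD(2)[of _ 0]) auto
    have "\<forall>\<^sub>F x in at x0. x \<in> S" using S x0 by (rule eventually_at_in_open')
    with ev have "\<forall>\<^sub>F x in at x0. x \<in> S \<and> (\<forall>u. norm (N x u) \<le> (2 * K) * norm u)"
    proof eventually_elim
      case (elim x)
      have "norm (N x u) \<le> (2 * K) * norm u" for u
      proof -
        define w where "w = N x u"
        have lin: "linear (\<lambda>w. A x w - A x0 w)"
          using lA elim(2) x0 by (intro linear_compose_sub) auto
        have "A x w - A x0 w = (\<Sum>b\<in>Basis. (w \<bullet> b) *\<^sub>R (A x b - A x0 b))"
          by (rule linear_basis_expand[OF lin])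
        also have "norm \<dots> \<le> (\<Sum>b\<in>Basis. norm w * norm (A x b - A x0 b))"
          by (intro order_trans[OF norm_sum] sum_mono) (auto intro!: mult_right_mono Basis_le_norm)
        also have "\<dots> = norm w * s x" by (simp add: s_def sum_distrib_left)
        also have "\<dots> \<le> norm w * (1 / (2 * K))"
          using elim(1) by (intro mult_left_mono) auto
        finally have 1: "norm (A x w - A x0 w) \<le> norm w / (2 * K)" by simp
        have "norm w = norm (N x0 (A x0 w))" by (simp add: NA x0)
        also have "\<dots> \<le> K * norm (A x0 w)" by (rule K)
        also have "\<dots> \<le> K * (norm (A x w) + norm w / (2 * K))"
          using K(1) 1 norm_triangle_ineq4[of "A x w" "A x w - A x0 w"] by (intro mult_left_mono) auto
        also have "\<dots> = K * norm (A x w) + norm w / 2" using K(1) by (simp add: field_simps)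
        finally show ?thesis using AN[OF elim(2)] by (simp add: w_def)
      qed
      with elim show ?case by blast
    qed
    then show ?thesis by blast
  qed
  have cont: "isCont (\<lambda>x. N x v) x0" if x0: "x0 \<in> S" for x0 v
  proof -
    obtain K where K: "\<forall>\<^sub>F x in at x0. x \<in> S \<and> (\<forall>u. norm (N x u) \<le> K * norm u)"
      using bound[OF x0] by blast
    have "isCont (\<lambda>x. A x (N x0 v)) x0"
      using smooth_on_continuous[OF sm] S x0 continuous_on_eq_continuous_at by blast
    then have l: "((\<lambda>x. K * norm (A x (N x0 v) - v)) \<longlongrightarrow> 0) (at x0)"
      using AN[OF x0] by (auto simp: isCont_def intro!: tendsto_mult_right_zero tendsto_norm_zero LIM_zero)
    have "((\<lambda>x. N x v - N x0 v) \<longlongrightarrow> 0) (at x0)"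
    proof (rule Lim_null_comparison[OF _ l])
      show "\<forall>\<^sub>F x in at x0. norm (N x v - N x0 v) \<le> K * norm (A x (N x0 v) - v)"
        using K
      proof eventually_elim
        case (elim x)
        have "N x0 v - N x v = N x (A x (N x0 v) - v)"
          using elim by (simp add: linear_diff[OF lN] NA)
        then have "norm (N x v - N x0 v) = norm (N x (A x (N x0 v) - v))"
          by (metis norm_minus_commute)
        then show ?case using elim by simp
      qed
    qed
    then show ?thesis by (simp add: isCont_def LIM_zero_iff)
  qed
  define dA where "dA x u w = frechet_derivative (\<lambda>x. A x w) (at x) u" for x u w
  have dN: "((\<lambda>x. N x v) has_derivative (\<lambda>u. - N x0 (dA x0 u (N x0 v)))) (at x0)"
    if x0: "x0 \<in> S" for x0 v
  proof -
    define w where "w = N x0 v"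
    have "((\<lambda>x. A x w) has_derivative (\<lambda>u. dA x0 u w)) (at x0)"
      unfolding dA_def using smooth_on_has_derivative[OF sm x0] by blast
    then have "((\<lambda>x. (A x w - v) \<bullet> b) has_derivative (\<lambda>u. dA x0 u w \<bullet> b)) (at x0)" for b
      by (auto intro!: derivative_eq_intros)
    then have "((\<lambda>x. ((A x w - v) \<bullet> b) *\<^sub>R N x b) has_derivative (\<lambda>u. (dA x0 u w \<bullet> b) *\<^sub>R N x0 b)) (at x0)" for b
      by (rule has_derivative_scaleR_zero) (auto simp: w_def AN x0 cont)
    then have "((\<lambda>x. w - (\<Sum>b\<in>Basis. ((A x w - v) \<bullet> b) *\<^sub>R N x b)) has_derivative
        (\<lambda>u. 0 - (\<Sum>b\<in>Basis. (dA x0 u w \<bullet> b) *\<^sub>R N x0 b))) (at x0)"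
      by (intro has_derivative_diff has_derivative_sum has_derivative_const)
    moreover have "(\<Sum>b\<in>Basis. (dA x0 u w \<bullet> b) *\<^sub>R N x0 b) = N x0 (dA x0 u w)" for u
      by (rule linear_basis_expand[OF lN[OF x0], symmetric])
    moreover have "w - (\<Sum>b\<in>Basis. ((A x w - v) \<bullet> b) *\<^sub>R N x b) = N x v" if "x \<in> S" for x
      using that by (simp add: linear_basis_expand[OF lN, symmetric] linear_diff[OF lN] NA)
    ultimately show ?thesis
      by (auto simp: w_def intro: has_derivative_transform_within_open[OF _ S x0])
  qed
  have "Ck_on k S (\<lambda>x. N x v)" for k v
  proof (induction k arbitrary: v)
    case 0
    then show ?case using cont by (auto intro!: continuous_at_imp_continuous_on)
  next
    case (Suc k)
    show ?case
    proof (rule Ck_on_Suc_has_derivative[OF S dN])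
      fix u
      \<comment> \<open>\<open>dA\<close> is defined for one vector \<open>w\<close> at a time, so
        its linearity in \<open>w\<close> comes from the uniqueness of derivatives.\<close>
      have "linear (\<lambda>w. dA x u w)" if x: "x \<in> S" for x
      proof (rule linearI)
        have hd: "((\<lambda>x. A x w) has_derivative (\<lambda>u. dA x u w)) (at x)" for w
          unfolding dA_def using smooth_on_has_derivative[OF sm x] by blast
        fix w1 w2 :: 'c and r :: real
        have "((\<lambda>x. A x (w1 + w2)) has_derivative (\<lambda>u. dA x u w1 + dA x u w2)) (at x)"
          by (rule has_derivative_transform_within_open[OF has_derivative_add[OF hd hd] S x])
            (simp add: linear_add[OF lA])
        then show "dA x u (w1 + w2) = dA x u w1 + dA x u w2"
          using fun_cong[OF has_derivative_unique[OF hd], of "w1 + w2" _ u] by simp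
        have "((\<lambda>x. A x (r *\<^sub>R w1)) has_derivative (\<lambda>u. r *\<^sub>R dA x u w1)) (at x)"
          by (rule has_derivative_transform_within_open[OF has_derivative_scaleR_right[OF hd] S x])
            (simp add: linear_cmul[OF lA])
        then show "dA x u (r *\<^sub>R w1) = r *\<^sub>R dA x u w1"
          using fun_cong[OF has_derivative_unique[OF hd], of "r *\<^sub>R w1" _ u] by simp
      qed
      moreover have "Ck_on k S (\<lambda>x. dA x u b)" for b
        unfolding dA_def by (intro smooth_onD smooth_on_frechet sm)
      ultimately have "Ck_on k S (\<lambda>x. dA x u (N x v))"
        using Suc.IH by (intro Ck_on_linear_family[OF S, where A = "\<lambda>x. dA x u" and w = "\<lambda>x. N x v"])
      then have "Ck_on k S (\<lambda>x. N x (dA x u (N x v)))"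
        using Suc.IH lN
        by (intro Ck_on_linear_family[OF S, where A = N and w = "\<lambda>x. dA x u (N x v)"])
      then show "Ck_on k S (\<lambda>x. - N x (dA x u (N x v)))"
        by (intro Ck_on_linear[OF S bounded_linear_minus[OF bounded_linear_ident]])
    qed
  qed
  then show ?thesis by (simp add: smooth_on_def)
qed

text \<open>The derivative at \<open>x0\<close> is normalised to the identity, so that the identity
  is also the inverse demanded by the C^1 inverse function theorem. Smoothness is a bootstrap: the
  derivative of \<sigma> at y is the inverse of the derivative of \<Phi> at \<sigma> y, hence as
  regular as \<sigma> itself.\<close>

lemma smooth_inverse_function:
  fixes \<Phi> :: "'a::euclidean_space \<Rightarrow> 'a"
  assumes S: "open S" and sm: "smooth_on S \<Phi>" and x0: "x0 \<in> S"
    and id: "\<And>u. frechet_derivative \<Phi> (at x0) u = u"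
  obtains U V \<sigma> where "open U" "U \<subseteq> S" "x0 \<in> U" "open V" "homeomorphism U V \<Phi> \<sigma>" "smooth_on V \<sigma>"
proof -
  define f' where "f' x = Blinfun (frechet_derivative \<Phi> (at x))" for x
  have app: "blinfun_apply (f' x) = frechet_derivative \<Phi> (at x)" if "x \<in> S" for x
    unfolding f'_def
    using smooth_on_has_derivative[OF sm that] has_derivative_bounded_linear bounded_linear_Blinfun_apply
    by blast
  have c: "continuous_on S f'"
  proof (rule continuous_on_blinfun_componentwise)
    fix i :: 'a assume "i \<in> Basis"
    show "continuous_on S (\<lambda>x. blinfun_apply (f' x) i)"
      by (rule continuous_on_eq[OF smooth_on_continuous[OF smooth_on_frechet[OF sm, of i]]]) (simp add: app)
  qed
  have "id_blinfun o\<^sub>L f' x0 = id_blinfun"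
    by (rule blinfun_eqI) (simp add: app x0 id)
  then obtain U V \<sigma> g' where UV: "open U" "U \<subseteq> S" "x0 \<in> U" "open V" "\<Phi> x0 \<in> V"
    and hom: "homeomorphism U V \<Phi> \<sigma>"
    and d: "\<And>y. y \<in> V \<Longrightarrow> (\<sigma> has_derivative (g' y)) (at y)"
    and g': "\<And>y. y \<in> V \<Longrightarrow> g' y = inv (blinfun_apply (f' (\<sigma> y)))"
    and bij: "\<And>y. y \<in> V \<Longrightarrow> bij (blinfun_apply (f' (\<sigma> y)))"
    using inverse_function_theorem[OF S _ c x0, of \<Phi> id_blinfun] smooth_on_has_derivative[OF sm] app
    by metis
  have sU: "\<sigma> y \<in> U" if "y \<in> V" for y using hom that by (auto simp: homeomorphism_def)
  define A where "A x = frechet_derivative \<Phi> (at x)" for x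
  define N where "N x = inv (A x)" for x
  have lA: "linear (A x)" if "x \<in> U" for x
    unfolding A_def using smooth_on_differentiable[OF sm] UV(2) that by (auto intro: linear_frechet_derivative)
  have bijA: "bij (A x)" if "x \<in> U" for x
  proof -
    have "\<Phi> x \<in> V" "\<sigma> (\<Phi> x) = x" using hom that by (auto simp: homeomorphism_def)
    then show ?thesis using bij[of "\<Phi> x"] app[of x] UV(2) that by (auto simp: A_def)
  qed
  have smN: "smooth_on U (\<lambda>x. N x v)" for v
  proof (rule smooth_on_inverse_family[OF UV(1) lA])
    fix x assume x: "x \<in> U"
    show NA: "N x (A x w) = w" for w using bijA[OF x] by (simp add: N_def bij_is_inj)
    show AN: "A x (N x w) = w" for w using bijA[OF x] by (simp add: N_def bij_is_surj surj_f_inv_f)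
    show "linear (N x)"
    proof (rule linearI)
      fix v w :: 'a and r :: real
      have "N x (v + w) = N x (A x (N x v + N x w))" by (simp add: linear_add[OF lA[OF x]] AN)
      then show "N x (v + w) = N x v + N x w" by (simp only: NA)
      have "N x (r *\<^sub>R v) = N x (A x (r *\<^sub>R N x v))" by (simp add: linear_cmul[OF lA[OF x]] AN)
      then show "N x (r *\<^sub>R v) = r *\<^sub>R N x v" by (simp only: NA)
    qed
  qed (auto simp: A_def intro!: smooth_on_frechet smooth_on_subset[OF sm UV(2)])
  have "Ck_on k V \<sigma>" for k
  proof (induction k)
    case 0
    show ?case using hom by (simp add: homeomorphism_def)
  next
    case (Suc k)
    show ?case
    proof (rule Ck_on_Suc_has_derivative[OF UV(4) d])
      fix v
      have "Ck_on k V (\<lambda>y. N (\<sigma> y) v)"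
        using Ck_on_compose[OF UV(4) UV(1) Suc smooth_onD[OF smN]] sU by auto
      moreover have "N (\<sigma> y) v = g' y v" if "y \<in> V" for y
        using g'[OF that] app[of "\<sigma> y"] sU[OF that] UV(2) by (auto simp: N_def A_def)
      ultimately show "Ck_on k V (\<lambda>y. g' y v)"
        using Ck_on_cong[OF UV(4), of "\<lambda>y. N (\<sigma> y) v" "\<lambda>y. g' y v"] by simp
    qed
  qed
  then show ?thesis using that[OF UV(1-4) hom] by (simp add: smooth_on_def)
qed

section \<open>Tangent vectors, smooth maps and vector fields\<close>

lemma
  assumes "smooth_atlas A" "(U, x) \<in> A"
  shows chart_open: "open U" and chart_inj: "inj_on x U"
    and chart_cont: "continuous_on U x"
    and chart_inv: "\<And>p. p \<in> U \<Longrightarrow> inv_into U x (x p) = p"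
    and chart_open_image: "\<And>W. open W \<Longrightarrow> open (x ` (U \<inter> W))"
proof -
  have c: "open U" "open (x ` U)" "homeomorphism U (x ` U) x (inv_into U x)"
    using assms unfolding smooth_atlas_def is_chart_def by auto
  then show "open U" "continuous_on U x" by (auto simp: homeomorphism_def)
  show i: "inv_into U x (x p) = p" if "p \<in> U" for p using c(3) that by (simp add: homeomorphism_def)
  then show inj: "inj_on x U" by (rule inj_on_inverseI)
  fix W :: "'a set" assume W: "open W"
  have "x ` (U \<inter> W) = x ` U \<inter> inv_into U x -` W" using i by auto
  moreover have "continuous_on (x ` U) (inv_into U x)" using c(3) by (simp add: homeomorphism_def)
  ultimately show "open (x ` (U \<inter> W))"
    using continuous_open_preimage[OF _ c(2) W] by simp
qed

lemma chart_at:
  assumes "smooth_atlas A"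
  obtains U x where "(U, x) \<in> A" "p \<in> U"
proof -
  have "p \<in> (\<Union>(U, x)\<in>A. U)" using assms unfolding smooth_atlas_def by simp
  then show ?thesis using that by auto
qed

lemma chart_transition:
  "smooth_atlas A \<Longrightarrow> (U, x) \<in> A \<Longrightarrow> (V, y) \<in> A \<Longrightarrow> smooth_on (x ` (U \<inter> V)) (y \<circ> inv_into U x)"
  unfolding smooth_atlas_def by fast

lemma smooth_fun_onD:
  "smooth_fun_on A W h \<Longrightarrow> (U, x) \<in> A \<Longrightarrow> smooth_on (x ` (U \<inter> W)) (h \<circ> inv_into U x)"
  unfolding smooth_fun_on_def by auto

text \<open>\<open>smooth_fun_on\<close> quantifies over all charts; since transition maps are
  smooth, one chart around each point is enough.\<close>

lemma smooth_fun_on_local: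
  assumes A: "smooth_atlas A"
    and loc: "\<And>p. p \<in> W \<Longrightarrow> \<exists>U x W0. (U, x) \<in> A \<and> p \<in> U \<and> open W0 \<and> p \<in> W0 \<and>
        smooth_on (x ` (U \<inter> W0)) (h \<circ> inv_into U x)"
  shows "smooth_fun_on A W h"
  unfolding smooth_fun_on_def
proof clarify
  fix V y assume Vy: "(V, y) \<in> A"
  show "smooth_on (y ` (V \<inter> W)) (h \<circ> inv_into V y)"
  proof (rule smooth_on_local)
    fix a assume "a \<in> y ` (V \<inter> W)"
    then obtain p where p: "p \<in> V" "p \<in> W" "a = y p" by auto
    obtain U x W0 where U: "(U, x) \<in> A" "p \<in> U" "open W0" "p \<in> W0"
      and s: "smooth_on (x ` (U \<inter> W0)) (h \<circ> inv_into U x)" using loc[OF p(2)] by blast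
    let ?T = "y ` (V \<inter> (U \<inter> W0))"
    have T: "open ?T" using chart_open_image[OF A Vy] chart_open[OF A U(1)] U(3) by auto
    have "smooth_on ?T (\<lambda>t. (h \<circ> inv_into U x) ((x \<circ> inv_into V y) t))"
    proof (rule smooth_on_compose[OF T chart_open_image[OF A U(1,3)] _ s])
      show "smooth_on ?T (x \<circ> inv_into V y)"
        by (rule smooth_on_subset[OF chart_transition[OF A Vy U(1)]]) auto
      show "(x \<circ> inv_into V y) ` ?T \<subseteq> x ` (U \<inter> W0)" using chart_inv[OF A Vy] by auto
    qed
    then have "smooth_on ?T (h \<circ> inv_into V y)"
      by (rule smooth_on_transform[OF _ T]) (auto simp: chart_inv[OF A Vy] chart_inv[OF A U(1)])
    then show "\<exists>T. open T \<and> a \<in> T \<and> smooth_on T (h \<circ> inv_into V y)" using T p U by blast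
  qed
qed

lemma smooth_fun_on_subset: "smooth_fun_on A W h \<Longrightarrow> V \<subseteq> W \<Longrightarrow> smooth_fun_on A V h"
  unfolding smooth_fun_on_def by (fastforce intro: smooth_on_subset)

lemma smooth_fun_on_cong:
  assumes A: "smooth_atlas A" and W: "open W" and e: "\<And>p. p \<in> W \<Longrightarrow> h p = k p"
  shows "smooth_fun_on A W h \<longleftrightarrow> smooth_fun_on A W k"
proof -
  have "smooth_on (x ` (U \<inter> W)) (h \<circ> inv_into U x) \<longleftrightarrow> smooth_on (x ` (U \<inter> W)) (k \<circ> inv_into U x)"
    if "(U, x) \<in> A" for U x
    using that by (intro smooth_on_cong chart_open_image[OF A that W]) (auto simp: chart_inv[OF A that] e)
  then show ?thesis unfolding smooth_fun_on_def by fastforce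
qed

lemma smooth_fun_on_const: "smooth_fun_on A W (\<lambda>p. c)"
  unfolding smooth_fun_on_def by (auto simp: comp_def smooth_on_const)

lemma smooth_fun_on_add:
  assumes "smooth_atlas A" "open W" "smooth_fun_on A W h" "smooth_fun_on A W k"
  shows "smooth_fun_on A W (\<lambda>p. h p + k p)"
  unfolding smooth_fun_on_def
proof clarify
  fix U x assume c: "(U, x) \<in> A"
  show "smooth_on (x ` (U \<inter> W)) ((\<lambda>p. h p + k p) \<circ> inv_into U x)"
    using smooth_on_add[OF chart_open_image[OF assms(1) c assms(2)] smooth_fun_onD[OF assms(3) c]
        smooth_fun_onD[OF assms(4) c]] by (simp add: comp_def)
qed

lemma smooth_fun_on_mult:
  assumes "smooth_atlas A" "open W" "smooth_fun_on A W h" "smooth_fun_on A W k"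
  shows "smooth_fun_on A W (\<lambda>p. h p * k p)"
  unfolding smooth_fun_on_def
proof clarify
  fix U x assume c: "(U, x) \<in> A"
  show "smooth_on (x ` (U \<inter> W)) ((\<lambda>p. h p * k p) \<circ> inv_into U x)"
    using smooth_on_bilinear[OF chart_open_image[OF assms(1) c assms(2)] bounded_bilinear_mult
        smooth_fun_onD[OF assms(3) c] smooth_fun_onD[OF assms(4) c]] by (simp add: comp_def)
qed

section \<open>Functions that are smooth near a point\<close>

lemma smooth_atI: "smooth_fun_on A W h \<Longrightarrow> open W \<Longrightarrow> p \<in> W \<Longrightarrow> smooth_at A p h"
  unfolding smooth_at_def by blast

lemma smooth_at_cong:
  assumes A: "smooth_atlas A" and W: "open W" "p \<in> W" and e: "\<And>q. q \<in> W \<Longrightarrow> h q = k q"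
  shows "smooth_at A p h \<longleftrightarrow> smooth_at A p k"
proof -
  have "smooth_at A p k'" if s: "smooth_at A p h'" and e: "\<And>q. q \<in> W \<Longrightarrow> h' q = k' q" for h' k'
  proof -
    obtain W' where W': "open W'" "p \<in> W'" "smooth_fun_on A W' h'" using s unfolding smooth_at_def by blast
    have "smooth_fun_on A (W \<inter> W') h'" using W'(3) by (rule smooth_fun_on_subset) auto
    then have "smooth_fun_on A (W \<inter> W') k'"
      using smooth_fun_on_cong[OF A, of "W \<inter> W'" h' k'] W(1) W'(1) e by auto
    then show ?thesis by (rule smooth_atI) (use W W' in auto)
  qed
  then show ?thesis using e by metis
qed

lemma smooth_at_binary:
  assumes "smooth_at A p h" "smooth_at A p k"
  obtains W where "open W" "p \<in> W" "smooth_fun_on A W h" "smooth_fun_on A W k"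
proof -
  obtain W1 W2 where "open W1" "p \<in> W1" "smooth_fun_on A W1 h" "open W2" "p \<in> W2" "smooth_fun_on A W2 k"
    using assms unfolding smooth_at_def by blast
  then show ?thesis
    by (intro that[of "W1 \<inter> W2"]) (auto intro: smooth_fun_on_subset)
qed

lemma smooth_at_const: "smooth_at A p (\<lambda>q. c)"
  by (rule smooth_atI[OF smooth_fun_on_const open_UNIV UNIV_I])

lemma smooth_at_add:
  "smooth_atlas A \<Longrightarrow> smooth_at A p h \<Longrightarrow> smooth_at A p k \<Longrightarrow> smooth_at A p (\<lambda>q. h q + k q)"
  by (erule (1) smooth_at_binary) (auto intro: smooth_atI smooth_fun_on_add)

lemma smooth_at_mult:
  "smooth_atlas A \<Longrightarrow> smooth_at A p h \<Longrightarrow> smooth_at A p k \<Longrightarrow> smooth_at A p (\<lambda>q. h q * k q)"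
  by (erule (1) smooth_at_binary) (auto intro: smooth_atI smooth_fun_on_mult)

lemma smooth_fun_on_chart:
  assumes A: "smooth_atlas A" and c: "(U, x) \<in> A" and W: "open W" and s: "smooth_on (x ` (U \<inter> W)) k"
  shows "smooth_fun_on A (U \<inter> W) (\<lambda>q. k (x q))"
proof (rule smooth_fun_on_local[OF A])
  fix p assume p: "p \<in> U \<inter> W"
  have "smooth_on (x ` (U \<inter> W)) ((\<lambda>q. k (x q)) \<circ> inv_into U x)"
    by (rule smooth_on_transform[OF s chart_open_image[OF A c W]]) (auto simp: chart_inv[OF A c])
  then show "\<exists>V y W0. (V, y) \<in> A \<and> p \<in> V \<and> open W0 \<and> p \<in> W0 \<and>
      smooth_on (y ` (V \<inter> W0)) ((\<lambda>q. k (x q)) \<circ> inv_into V y)"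
    using c p W by blast
qed

text \<open>Coordinate functions are the test functions that recover the components of a tangent
  vector; their arbitrary values off \<open>U\<close> do no harm because only the germ at
  \<open>p\<close> counts.\<close>

lemma smooth_at_coord:
  assumes A: "smooth_atlas A" and c: "(U, x) \<in> A" "p \<in> U"
  shows "smooth_at A p (\<lambda>q. x q \<bullet> b)"
proof (rule smooth_atI[OF smooth_fun_on_chart[OF A c(1) open_UNIV]])
  have o: "open (x ` (U \<inter> UNIV))" by (rule chart_open_image[OF A c(1) open_UNIV])
  show "smooth_on (x ` (U \<inter> UNIV)) (\<lambda>a. a \<bullet> b)"
    by (rule smooth_on_linear[OF o bounded_linear_inner_left smooth_on_id[OF o]])
qed (use c chart_open[OF A] in auto)

lemma smooth_at_differentiable:
  assumes A: "smooth_atlas A" and c: "(U, x) \<in> A" "p \<in> U" and s: "smooth_at A p h"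
  shows "(h \<circ> inv_into U x) differentiable (at (x p))"
proof -
  obtain W where W: "open W" "p \<in> W" "smooth_fun_on A W h" using s unfolding smooth_at_def by blast
  show ?thesis by (rule smooth_on_differentiable[OF smooth_fun_onD[OF W(3) c(1)]]) (use c W in auto)
qed

section \<open>Coordinate vectors and tangent spaces\<close>

lemma coord_vec_smooth:
  "smooth_at A p h \<Longrightarrow> coord_vec A (U, x) p e h = frechet_derivative (h \<circ> inv_into U x) (at (x p)) e"
  by (simp add: coord_vec_def)

lemma coord_vec_nonsmooth: "\<not> smooth_at A p h \<Longrightarrow> coord_vec A (U, x) p e h = 0"
  by (simp add: coord_vec_def)

lemma coord_vec_linear:
  assumes A: "smooth_atlas A" and c: "(U, x) \<in> A" "p \<in> U"
  shows "linear (coord_vec A (U, x) p)"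
proof (rule linearI)
  fix e e' :: 'b and r :: real
  have l: "linear (frechet_derivative (h \<circ> inv_into U x) (at (x p)))" if "smooth_at A p h" for h
    by (rule linear_frechet_derivative[OF smooth_at_differentiable[OF A c that]])
  show "coord_vec A (U, x) p (e + e') = coord_vec A (U, x) p e + coord_vec A (U, x) p e'"
    using l by (auto simp: coord_vec_def fun_eq_iff linear_add)
  show "coord_vec A (U, x) p (r *\<^sub>R e) = r *\<^sub>R coord_vec A (U, x) p e"
    using l by (auto simp: coord_vec_def fun_eq_iff linear_cmul scaleR_fun_def)
qed

lemma coord_vec_coord:
  assumes A: "smooth_atlas A" and c: "(U, x) \<in> A" "p \<in> U"
  shows "coord_vec A (U, x) p e (\<lambda>q. x q \<bullet> b) = e \<bullet> b"
proof -
  have "((\<lambda>q. x q \<bullet> b) \<circ> inv_into U x has_derivative (\<lambda>e. e \<bullet> b)) (at (x p))"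
    by (rule has_derivative_transform_within_open[where f = "\<lambda>a. a \<bullet> b" and s = "x ` (U \<inter> UNIV)"])
      (use c chart_open_image[OF A c(1) open_UNIV] in \<open>auto intro!: derivative_eq_intros simp: chart_inv[OF A c(1)]\<close>)
  from frechet_derivative_at[OF this, symmetric] show ?thesis
    by (simp add: coord_vec_smooth[OF smooth_at_coord[OF A c]])
qed

lemma coord_vec_inj:
  assumes A: "smooth_atlas A" and c: "(U, x) \<in> A" "p \<in> U"
    and e: "coord_vec A (U, x) p e = coord_vec A (U, x) p e'"
  shows "e = e'"
proof (rule euclidean_eqI)
  show "e \<bullet> b = e' \<bullet> b" for b
    using fun_cong[OF e, of "\<lambda>q. x q \<bullet> b"] by (simp add: coord_vec_coord[OF A c])
qed

text \<open>The chain rule through the transition map. Functions that are not smooth at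
  \<open>p\<close> make no exception, as both sides vanish on them.\<close>

lemma coord_vec_change:
  assumes A: "smooth_atlas A" and c: "(U, x) \<in> A" "p \<in> U" and d: "(V, y) \<in> A" "p \<in> V"
  shows "coord_vec A (V, y) p e
    = coord_vec A (U, x) p (frechet_derivative (x \<circ> inv_into V y) (at (y p)) e)"
proof
  fix h
  show "coord_vec A (V, y) p e h
    = coord_vec A (U, x) p (frechet_derivative (x \<circ> inv_into V y) (at (y p)) e) h"
  proof (cases "smooth_at A p h")
    case True
    have t: "(x \<circ> inv_into V y) differentiable (at (y p))"
      by (rule smooth_on_differentiable[OF chart_transition[OF A d(1) c(1)]]) (use c d in auto)
    have p: "(x \<circ> inv_into V y) (y p) = x p" using chart_inv[OF A d(1)] d by simp
    have "frechet_derivative (h \<circ> inv_into V y) (at (y p))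
        = frechet_derivative ((h \<circ> inv_into U x) \<circ> (x \<circ> inv_into V y)) (at (y p))"
    proof (rule frechet_derivative_transform_within_open[where X = "y ` (V \<inter> U)"])
      show "(h \<circ> inv_into V y) differentiable (at (y p))" by (rule smooth_at_differentiable[OF A d True])
      show "open (y ` (V \<inter> U))" by (rule chart_open_image[OF A d(1) chart_open[OF A c(1)]])
    qed (use c d in \<open>auto simp: chart_inv[OF A d(1)] chart_inv[OF A c(1)]\<close>)
    also have "\<dots> = frechet_derivative (h \<circ> inv_into U x) (at (x p))
        \<circ> frechet_derivative (x \<circ> inv_into V y) (at (y p))"
      using frechet_derivative_compose[OF t, of "h \<circ> inv_into U x", unfolded p]
        smooth_at_differentiable[OF A c True] by simp
    finally show ?thesis by (simp add: coord_vec_smooth[OF True])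
  qed (simp add: coord_vec_nonsmooth)
qed

text \<open>The definition collects the coordinate vectors of all charts. A change of chart reduces
  this union to the range of a single linear map, which is why it is a subspace.\<close>

lemma tangent_space_chart:
  assumes A: "smooth_atlas A" and c: "(U, x) \<in> A" "p \<in> U"
  shows "tangent_space A p = range (coord_vec A (U, x) p)"
proof
  show "tangent_space A p \<subseteq> range (coord_vec A (U, x) p)"
  proof
    fix v assume "v \<in> tangent_space A p"
    then obtain V y e where d: "(V, y) \<in> A" "p \<in> V" and v: "v = coord_vec A (V, y) p e"
      unfolding tangent_space_def by blast
    show "v \<in> range (coord_vec A (U, x) p)" unfolding v coord_vec_change[OF A c d] by (rule rangeI)
  qed
  show "range (coord_vec A (U, x) p) \<subseteq> tangent_space A p"
    unfolding tangent_space_def using c by blast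
qed

lemma coord_vec_tangent:
  "(U, x) \<in> A \<Longrightarrow> p \<in> U \<Longrightarrow> coord_vec A (U, x) p e \<in> tangent_space A p"
  unfolding tangent_space_def by blast

lemma tangent_space_subspace:
  assumes A: "smooth_atlas A"
  shows "subspace (tangent_space A p)"
proof -
  obtain U x where c: "(U, x) \<in> A" "p \<in> U" by (rule chart_at[OF A])
  show ?thesis
    unfolding tangent_space_chart[OF A c]
    by (rule linear_subspace_image[OF coord_vec_linear[OF A c] subspace_UNIV])
qed

lemma tangent_vec_nonsmooth: "v \<in> tangent_space A p \<Longrightarrow> \<not> smooth_at A p h \<Longrightarrow> v h = 0"
  unfolding tangent_space_def by (auto simp: coord_vec_nonsmooth)

text \<open>Locality, also for functions that are not smooth at \<open>p\<close>: smoothness at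
  \<open>p\<close> depends on the germ alone, and both values are then the default 0.\<close>

lemma tangent_vec_cong:
  assumes A: "smooth_atlas A" and v: "v \<in> tangent_space A p"
    and W: "open W" "p \<in> W" and e: "\<And>q. q \<in> W \<Longrightarrow> h q = k q"
  shows "v h = v k"
proof -
  obtain U x w where c: "(U, x) \<in> A" "p \<in> U" "v = coord_vec A (U, x) p w"
    using v unfolding tangent_space_def by blast
  have iff: "smooth_at A p h \<longleftrightarrow> smooth_at A p k" by (rule smooth_at_cong[OF A W]) (rule e)
  show ?thesis
  proof (cases "smooth_at A p h")
    case True
    have k: "smooth_at A p k" using True iff by simp
    have "frechet_derivative (h \<circ> inv_into U x) (at (x p)) = frechet_derivative (k \<circ> inv_into U x) (at (x p))"
      by (rule frechet_derivative_transform_within_open[OF smooth_at_differentiable[OF A c(1,2) True]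
            chart_open_image[OF A c(1) W(1)]])
        (use c W e in \<open>auto simp: chart_inv[OF A c(1)]\<close>)
    then show ?thesis by (simp add: c(3) coord_vec_smooth[OF True] coord_vec_smooth[OF k])
  next
    case False
    then have "\<not> smooth_at A p k" using iff by simp
    then show ?thesis using False by (simp add: c(3) coord_vec_nonsmooth)
  qed
qed

lemma smooth_at_has_derivative:
  assumes "smooth_atlas A" "(U, x) \<in> A" "p \<in> U" "smooth_at A p h"
  shows "((h \<circ> inv_into U x) has_derivative (\<lambda>w. coord_vec A (U, x) p w h)) (at (x p))"
  unfolding coord_vec_smooth[OF assms(4)]
  using smooth_at_differentiable[OF assms] unfolding frechet_derivative_works by simp

lemma coord_vec_eqI:
  assumes "smooth_at A p h" "((h \<circ> inv_into U x) has_derivative D) (at (x p))"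
  shows "coord_vec A (U, x) p w h = D w"
  using frechet_derivative_at[OF assms(2)] by (simp add: coord_vec_smooth[OF assms(1)])

section \<open>Tangent vectors as derivations\<close>

lemma tangent_vec_const: "smooth_atlas A \<Longrightarrow> v \<in> tangent_space A p \<Longrightarrow> v (\<lambda>q. c) = 0"
  unfolding tangent_space_def by (auto simp: coord_vec_smooth[OF smooth_at_const] comp_def)

lemma tangent_vec_add:
  assumes A: "smooth_atlas A" and v: "v \<in> tangent_space A p" and s: "smooth_at A p h" "smooth_at A p k"
  shows "v (\<lambda>q. h q + k q) = v h + v k"
proof -
  obtain U x w where c: "(U, x) \<in> A" "p \<in> U" and v: "v = coord_vec A (U, x) p w"
    using v unfolding tangent_space_def by blast
  note d = smooth_at_has_derivative[OF A c]
  show ?thesis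
    unfolding v
    by (rule coord_vec_eqI[OF smooth_at_add[OF A s]])
      (use has_derivative_add[OF d[OF s(1)] d[OF s(2)]] in \<open>simp add: comp_def\<close>)
qed

lemma tangent_vec_mult:
  assumes A: "smooth_atlas A" and v: "v \<in> tangent_space A p" and s: "smooth_at A p h" "smooth_at A p k"
  shows "v (\<lambda>q. h q * k q) = h p * v k + v h * k p"
proof -
  obtain U x w where c: "(U, x) \<in> A" "p \<in> U" and v: "v = coord_vec A (U, x) p w"
    using v unfolding tangent_space_def by blast
  note d = smooth_at_has_derivative[OF A c]
  show ?thesis
    unfolding v
    by (rule coord_vec_eqI[OF smooth_at_mult[OF A s]])
      (use has_derivative_mult[OF d[OF s(1)] d[OF s(2)]] in \<open>simp add: comp_def chart_inv[OF A c]\<close>)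
qed

lemma tangent_vec_cmult:
  assumes A: "smooth_atlas A" and v: "v \<in> tangent_space A p" and s: "smooth_at A p h"
  shows "v (\<lambda>q. c * h q) = c * v h"
  using tangent_vec_mult[OF A v smooth_at_const s, of c] tangent_vec_const[OF A v, of c] by simp

lemma tangent_vec_diff:
  assumes A: "smooth_atlas A" and v: "v \<in> tangent_space A p" and s: "smooth_at A p h" "smooth_at A p k"
  shows "v (\<lambda>q. h q - k q) = v h - v k"
  using tangent_vec_add[OF A v s(1) smooth_at_mult[OF A smooth_at_const[of _ _ "-1"] s(2)]]
    tangent_vec_cmult[OF A v s(2), of "-1"] by simp

section \<open>Smooth maps and their differentials\<close>

lemma smooth_map_open_preimage: "smooth_map A B \<psi> \<Longrightarrow> open W \<Longrightarrow> open (\<psi> -` W)"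
  unfolding smooth_map_def by (simp add: continuous_on_open_vimage)

lemma smooth_mapD:
  "smooth_map A B \<psi> \<Longrightarrow> (U, x) \<in> A \<Longrightarrow> (V, y) \<in> B \<Longrightarrow>
    smooth_on (x ` (U \<inter> \<psi> -` V)) (y \<circ> \<psi> \<circ> inv_into U x)"
  unfolding smooth_map_def by auto

lemma smooth_fun_on_compose_map:
  assumes A: "smooth_atlas A" and B: "smooth_atlas B" and \<psi>: "smooth_map A B \<psi>"
    and W: "open W" and h: "smooth_fun_on B W h"
  shows "smooth_fun_on A (\<psi> -` W) (h \<circ> \<psi>)"
proof (rule smooth_fun_on_local[OF A])
  fix p assume p: "p \<in> \<psi> -` W"
  obtain U x where U: "(U, x) \<in> A" "p \<in> U" by (rule chart_at[OF A])
  obtain V y where V: "(V, y) \<in> B" "\<psi> p \<in> V" by (rule chart_at[OF B])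
  let ?W = "\<psi> -` (V \<inter> W)"
  have oW: "open ?W" by (intro smooth_map_open_preimage[OF \<psi>] open_Int W chart_open[OF B V(1)])
  have "smooth_on (x ` (U \<inter> ?W)) (\<lambda>a. (h \<circ> inv_into V y) ((y \<circ> \<psi> \<circ> inv_into U x) a))"
  proof (rule smooth_on_compose[OF chart_open_image[OF A U(1) oW] chart_open_image[OF B V(1) W]])
    show "smooth_on (x ` (U \<inter> ?W)) (y \<circ> \<psi> \<circ> inv_into U x)"
      by (rule smooth_on_subset[OF smooth_mapD[OF \<psi> U(1) V(1)]]) auto
    show "smooth_on (y ` (V \<inter> W)) (h \<circ> inv_into V y)" by (rule smooth_fun_onD[OF h V(1)])
  qed (auto simp: chart_inv[OF A U(1)])
  then have "smooth_on (x ` (U \<inter> ?W)) (h \<circ> \<psi> \<circ> inv_into U x)"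
    by (rule smooth_on_transform[OF _ chart_open_image[OF A U(1) oW]]) (auto simp: chart_inv[OF A U(1)] chart_inv[OF B V(1)])
  then show "\<exists>U x W0. (U, x) \<in> A \<and> p \<in> U \<and> open W0 \<and> p \<in> W0 \<and>
      smooth_on (x ` (U \<inter> W0)) (h \<circ> \<psi> \<circ> inv_into U x)"
    using U oW p V by blast
qed

lemma smooth_at_compose_map:
  assumes A: "smooth_atlas A" and B: "smooth_atlas B" and \<psi>: "smooth_map A B \<psi>"
    and h: "smooth_at B (\<psi> p) h"
  shows "smooth_at A p (h \<circ> \<psi>)"
proof -
  obtain W where W: "open W" "\<psi> p \<in> W" "smooth_fun_on B W h" using h unfolding smooth_at_def by blast
  show ?thesis
    by (rule smooth_atI[OF smooth_fun_on_compose_map[OF A B \<psi> W(1,3)] smooth_map_open_preimage[OF \<psi> W(1)]])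
      (use W in auto)
qed

text \<open>The chain rule in charts; it reduces questions about pushforwards to derivatives between
  Euclidean spaces.\<close>

lemma pushforward_coord_vec:
  assumes A: "smooth_atlas A" and B: "smooth_atlas B" and \<psi>: "smooth_map A B \<psi>"
    and c: "(U, x) \<in> A" "p \<in> U" and d: "(V, y) \<in> B" "\<psi> p \<in> V"
  shows "pushforward B \<psi> p (coord_vec A (U, x) p e)
    = coord_vec B (V, y) (\<psi> p) (frechet_derivative (y \<circ> \<psi> \<circ> inv_into U x) (at (x p)) e)"
proof
  fix h
  show "pushforward B \<psi> p (coord_vec A (U, x) p e) h
    = coord_vec B (V, y) (\<psi> p) (frechet_derivative (y \<circ> \<psi> \<circ> inv_into U x) (at (x p)) e) h"
  proof (cases "smooth_at B (\<psi> p) h")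
    case True
    note hs = smooth_at_compose_map[OF A B \<psi> True]
    let ?F = "y \<circ> \<psi> \<circ> inv_into U x"
    have t: "?F differentiable (at (x p))"
      by (rule smooth_on_differentiable[OF smooth_mapD[OF \<psi> c(1) d(1)]]) (use c d in auto)
    have p: "?F (x p) = y (\<psi> p)" using chart_inv[OF A c] by simp
    have "frechet_derivative (h \<circ> \<psi> \<circ> inv_into U x) (at (x p))
        = frechet_derivative ((h \<circ> inv_into V y) \<circ> ?F) (at (x p))"
    proof (rule frechet_derivative_transform_within_open[where X = "x ` (U \<inter> \<psi> -` V)"])
      show "(h \<circ> \<psi> \<circ> inv_into U x) differentiable (at (x p))" by (rule smooth_at_differentiable[OF A c hs])
      show "open (x ` (U \<inter> \<psi> -` V))"
        by (rule chart_open_image[OF A c(1) smooth_map_open_preimage[OF \<psi> chart_open[OF B d(1)]]])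
    qed (use c d in \<open>auto simp: chart_inv[OF A c(1)] chart_inv[OF B d(1)]\<close>)
    also have "\<dots> = frechet_derivative (h \<circ> inv_into V y) (at (y (\<psi> p))) \<circ> frechet_derivative ?F (at (x p))"
      using frechet_derivative_compose[OF t, of "h \<circ> inv_into V y"] smooth_at_differentiable[OF B d True]
      by (simp only: p)
    finally show ?thesis by (simp add: pushforward_def True coord_vec_smooth[OF True] coord_vec_smooth[OF hs])
  qed (simp add: coord_vec_nonsmooth pushforward_def)
qed

lemma pushforward_tangent:
  assumes A: "smooth_atlas A" and B: "smooth_atlas B" and \<psi>: "smooth_map A B \<psi>"
    and v: "v \<in> tangent_space A p"
  shows "pushforward B \<psi> p v \<in> tangent_space B (\<psi> p)"
proof -
  obtain U x where U: "(U, x) \<in> A" "p \<in> U" by (rule chart_at[OF A])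
  obtain V y where V: "(V, y) \<in> B" "\<psi> p \<in> V" by (rule chart_at[OF B])
  obtain e where "v = coord_vec A (U, x) p e" using v tangent_space_chart[OF A U] by blast
  then show ?thesis by (simp add: pushforward_coord_vec[OF A B \<psi> U V] coord_vec_tangent V)
qed

lemma pushforward_linear:
  "pushforward B \<psi> p (u + v) = pushforward B \<psi> p u + pushforward B \<psi> p v"
  "pushforward B \<psi> p (r *\<^sub>R u) = r *\<^sub>R pushforward B \<psi> p u"
  "pushforward B \<psi> p (u - v) = pushforward B \<psi> p u - pushforward B \<psi> p v"
  "pushforward B \<psi> p 0 = 0"
  by (auto simp: pushforward_def fun_eq_iff scaleR_fun_def)

section \<open>Smooth vector fields and their components\<close>

lemma smooth_vfield_tangent: "smooth_vfield_on A W X \<Longrightarrow> p \<in> W \<Longrightarrow> X p \<in> tangent_space A p"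
  unfolding smooth_vfield_on_def by blast

lemma smooth_vfield_fun:
  "smooth_vfield_on A W X \<Longrightarrow> open V \<Longrightarrow> V \<subseteq> W \<Longrightarrow> smooth_fun_on A V h \<Longrightarrow> smooth_fun_on A V (\<lambda>p. X p h)"
  unfolding smooth_vfield_on_def by blast

lemma smooth_vfield_subset: "smooth_vfield_on A W X \<Longrightarrow> V \<subseteq> W \<Longrightarrow> smooth_vfield_on A V X"
  unfolding smooth_vfield_on_def by (meson subsetD subset_trans)

lemma smooth_vfield_smooth_at:
  assumes "smooth_vfield_on A W X" "open W" "p \<in> W" "smooth_at A p h"
  shows "smooth_at A p (\<lambda>q. X q h)"
proof -
  obtain V where V: "open V" "p \<in> V" "smooth_fun_on A V h" using assms(4) unfolding smooth_at_def by blast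
  have "smooth_fun_on A (W \<inter> V) (\<lambda>q. X q h)"
    by (rule smooth_vfield_fun[OF assms(1)]) (use assms V in \<open>auto intro: smooth_fun_on_subset\<close>)
  then show ?thesis by (rule smooth_atI) (use assms V in auto)
qed

lemma smooth_vfield_cong:
  assumes A: "smooth_atlas A" and e: "\<And>p. p \<in> W \<Longrightarrow> X p = Y p" and X: "smooth_vfield_on A W X"
  shows "smooth_vfield_on A W Y"
  unfolding smooth_vfield_on_def
proof (intro conjI ballI allI impI)
  show "Y p \<in> tangent_space A p" if "p \<in> W" for p using smooth_vfield_tangent[OF X that] e[OF that] by simp
  fix V h assume V: "open V \<and> V \<subseteq> W \<and> smooth_fun_on A V h"
  then have "smooth_fun_on A V (\<lambda>p. X p h)" using smooth_vfield_fun[OF X] by blast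
  then show "smooth_fun_on A V (\<lambda>p. Y p h)"
    using smooth_fun_on_cong[OF A, of V "\<lambda>p. X p h" "\<lambda>p. Y p h"] V e by (auto simp: subset_iff)
qed

lemma smooth_vfield_add:
  assumes A: "smooth_atlas A" and X: "smooth_vfield_on A W X" and Y: "smooth_vfield_on A W Y"
  shows "smooth_vfield_on A W (\<lambda>p. X p + Y p)"
  unfolding smooth_vfield_on_def
proof (intro conjI ballI allI impI)
  show "X p + Y p \<in> tangent_space A p" if "p \<in> W" for p
    using subspace_add[OF tangent_space_subspace[OF A]] smooth_vfield_tangent[OF X that]
      smooth_vfield_tangent[OF Y that] by blast
  fix V h assume V: "open V \<and> V \<subseteq> W \<and> smooth_fun_on A V h"
  then have "smooth_fun_on A V (\<lambda>p. X p h)" "smooth_fun_on A V (\<lambda>p. Y p h)"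
    using smooth_vfield_fun[OF X] smooth_vfield_fun[OF Y] by blast+
  then show "smooth_fun_on A V (\<lambda>p. (X p + Y p) h)"
    using smooth_fun_on_add[OF A] V by simp
qed

lemma smooth_vfield_scale:
  assumes A: "smooth_atlas A" and h: "smooth_fun_on A W h" and X: "smooth_vfield_on A W X"
  shows "smooth_vfield_on A W (\<lambda>p. h p *\<^sub>R X p)"
  unfolding smooth_vfield_on_def scaleR_fun_def real_scaleR_def
proof (intro conjI ballI allI impI)
  show "(\<lambda>k. h p * X p k) \<in> tangent_space A p" if "p \<in> W" for p
    using subspace_scale[OF tangent_space_subspace[OF A] smooth_vfield_tangent[OF X that], of "h p"]
    by (simp add: scaleR_fun_def)
  fix V k assume V: "open V \<and> V \<subseteq> W \<and> smooth_fun_on A V k"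
  then have "smooth_fun_on A V (\<lambda>p. X p k)" "smooth_fun_on A V h"
    using smooth_vfield_fun[OF X] smooth_fun_on_subset[OF h] by blast+
  then show "smooth_fun_on A V (\<lambda>p. h p * X p k)"
    using smooth_fun_on_mult[OF A] V by simp
qed

lemma smooth_vfield_cscale:
  "smooth_atlas A \<Longrightarrow> smooth_vfield_on A W X \<Longrightarrow> smooth_vfield_on A W (\<lambda>p. c *\<^sub>R X p)"
  using smooth_vfield_scale[OF _ smooth_fun_on_const] by blast

lemma smooth_vfield_diff:
  assumes A: "smooth_atlas A" and X: "smooth_vfield_on A W X" and Y: "smooth_vfield_on A W Y"
  shows "smooth_vfield_on A W (\<lambda>p. X p - Y p)"
  using smooth_vfield_add[OF A X smooth_vfield_cscale[OF A Y, of "-1"]] by simp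

lemma smooth_vfield_zero: "smooth_atlas A \<Longrightarrow> smooth_vfield_on A W (\<lambda>p. 0)"
  unfolding smooth_vfield_on_def
  by (simp add: subspace_0[OF tangent_space_subspace] smooth_fun_on_const)

text \<open>The components are the values of \<open>X\<close> on the coordinate functions. These are
  smooth only on the chart domain, so it matters that a smooth field acts on functions on smaller
  open sets.\<close>

lemma smooth_vfield_components:
  fixes A :: "('p::{t2_space, second_countable_topology}, 'e::euclidean_space) atlas"
  assumes A: "smooth_atlas A" and X: "smooth_vfield_on A W X" and W: "open W" and c: "(U, x) \<in> A"
  shows "\<exists>\<epsilon>. smooth_on (x ` (U \<inter> W)) \<epsilon> \<and> (\<forall>q\<in>U \<inter> W. X q = coord_vec A (U, x) q (\<epsilon> (x q)))"
proof -
  define \<epsilon> where "\<epsilon> a = (\<Sum>b\<in>Basis. X (inv_into U x a) (\<lambda>q. x q \<bullet> b) *\<^sub>R b)" for a :: 'e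
  note o = chart_open_image[OF A c W]
  show ?thesis
  proof (intro exI conjI ballI)
    have "smooth_on (x ` (U \<inter> W)) (\<lambda>a. X (inv_into U x a) (\<lambda>q. x q \<bullet> b))" for b
    proof -
      have "smooth_on (x ` (U \<inter> W)) (\<lambda>a. a \<bullet> b)"
        by (rule smooth_on_linear[OF o bounded_linear_inner_left smooth_on_id[OF o]])
      then have "smooth_fun_on A (U \<inter> W) (\<lambda>q. x q \<bullet> b)"
        by (rule smooth_fun_on_chart[OF A c W])
      then have "smooth_fun_on A (U \<inter> W) (\<lambda>p. X p (\<lambda>q. x q \<bullet> b))"
        using chart_open[OF A c] W by (intro smooth_vfield_fun[OF X]) auto
      from smooth_fun_onD[OF this c] show ?thesis by (simp add: comp_def)
    qed
    then show "smooth_on (x ` (U \<inter> W)) \<epsilon>"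
      unfolding \<epsilon>_def by (intro smooth_on_sum o smooth_on_linear[OF _ bounded_linear_scaleR_left])
    fix q assume q: "q \<in> U \<inter> W"
    then obtain e where e: "X q = coord_vec A (U, x) q e"
      using smooth_vfield_tangent[OF X] tangent_space_chart[OF A c] by blast
    have "\<epsilon> (x q) = e"
      using q by (simp add: \<epsilon>_def chart_inv[OF A c] e coord_vec_coord[OF A c] euclidean_representation)
    with e show "X q = coord_vec A (U, x) q (\<epsilon> (x q))" by simp
  qed
qed

text \<open>The converse of \<open>smooth_vfield_components\<close>; lifts to a product, ambient
  extensions and fields with constant components are shown to be smooth by it.\<close>

lemma smooth_vfieldI:
  assumes A: "smooth_atlas A"
    and loc: "\<And>p. p \<in> W \<Longrightarrow> \<exists>U x W0 \<epsilon>. (U, x) \<in> A \<and> p \<in> U \<and> open W0 \<and> p \<in> W0 \<and>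
        smooth_on (x ` (U \<inter> W0)) \<epsilon> \<and> (\<forall>q\<in>U \<inter> W0. X q = coord_vec A (U, x) q (\<epsilon> (x q)))"
  shows "smooth_vfield_on A W X"
  unfolding smooth_vfield_on_def
proof (intro conjI ballI allI impI)
  show "X p \<in> tangent_space A p" if "p \<in> W" for p
    using loc[OF that] coord_vec_tangent by (metis IntI)
  fix V h assume "open V \<and> V \<subseteq> W \<and> smooth_fun_on A V h"
  then have V: "open V" "V \<subseteq> W" "smooth_fun_on A V h" by auto
  show "smooth_fun_on A V (\<lambda>p. X p h)"
  proof (rule smooth_fun_on_local[OF A])
    fix p assume p: "p \<in> V"
    then obtain U x W0 \<epsilon> where U: "(U, x) \<in> A" "p \<in> U" "open W0" "p \<in> W0"
      and s: "smooth_on (x ` (U \<inter> W0)) \<epsilon>"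
      and X: "\<And>q. q \<in> U \<inter> W0 \<Longrightarrow> X q = coord_vec A (U, x) q (\<epsilon> (x q))"
      using loc V(2) by (metis subsetD)
    let ?S = "x ` (U \<inter> (W0 \<inter> V))"
    have o: "open ?S" using chart_open_image[OF A U(1)] U(3) V(1) by blast
    note hs = smooth_fun_onD[OF V(3) U(1)]
    have "smooth_on ?S (\<lambda>a. frechet_derivative (h \<circ> inv_into U x) (at a) (\<epsilon> a))"
    proof (rule smooth_on_linear_family[OF o,
          where A = "\<lambda>a. frechet_derivative (h \<circ> inv_into U x) (at a)" and w = \<epsilon>])
      show "linear (frechet_derivative (h \<circ> inv_into U x) (at a))" if "a \<in> ?S" for a
        using that by (intro linear_frechet_derivative smooth_on_differentiable[OF hs]) auto
      show "smooth_on ?S (\<lambda>a. frechet_derivative (h \<circ> inv_into U x) (at a) b)" for b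
        by (rule smooth_on_subset[OF smooth_on_frechet[OF hs]]) auto
      show "smooth_on ?S \<epsilon>" by (rule smooth_on_subset[OF s]) auto
    qed
    then have "smooth_on ?S ((\<lambda>p. X p h) \<circ> inv_into U x)"
      by (rule smooth_on_transform[OF _ o])
        (auto simp: chart_inv[OF A U(1)] X coord_vec_smooth[OF smooth_atI[OF V(3,1)]])
    then show "\<exists>U x W0. (U, x) \<in> A \<and> p \<in> U \<and> open W0 \<and> p \<in> W0 \<and>
        smooth_on (x ` (U \<inter> W0)) ((\<lambda>p. X p h) \<circ> inv_into U x)"
      using U V p by blast
  qed
qed

section \<open>Curvature of the Levi-Civita connection\<close>

lemma connection_cong:
  assumes A: "smooth_atlas A" and D: "affine_connection A D" and W: "open W" "p \<in> W"
    and s: "smooth_vfield_on A W X" "smooth_vfield_on A W Y"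
    and e: "\<And>q. q \<in> W \<Longrightarrow> X q = X' q" "\<And>q. q \<in> W \<Longrightarrow> Y q = Y' q"
  shows "D X Y p = D X' Y' p"
proof -
  \<comment> \<open>multiplying by the indicator of \<open>W\<close> makes the two pairs of fields equal as functions\<close>
  define h :: "'a \<Rightarrow> real" where "h q = (if q \<in> W then 1 else 0)" for q
  have "smooth_fun_on A W h"
    using smooth_fun_on_cong[OF A W(1), of h "\<lambda>_. 1"] by (simp add: h_def smooth_fun_on_const)
  note h = this
  have left: "D (\<lambda>q. h q *\<^sub>R X q) Y p = h p *\<^sub>R D X Y p"
    and right: "D X (\<lambda>q. h q *\<^sub>R Y q) p = X p h *\<^sub>R Y p + h p *\<^sub>R D X Y p"
    if "smooth_vfield_on A W X" "smooth_vfield_on A W Y" for X Y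
    using D that W h unfolding affine_connection_def by blast+
  have X'[simp]: "smooth_vfield_on A W X'" by (rule smooth_vfield_cong[OF A e(1) s(1)])
  have Y'[simp]: "smooth_vfield_on A W Y'" by (rule smooth_vfield_cong[OF A e(2) s(2)])
  have h0: "v h = 0" if "v \<in> tangent_space A p" for v
    using tangent_vec_cong[OF A that W, of h "\<lambda>_. 1"] tangent_vec_const[OF A that] by (simp add: h_def)
  have "(\<lambda>q. h q *\<^sub>R X q) = (\<lambda>q. h q *\<^sub>R X' q)" "(\<lambda>q. h q *\<^sub>R Y q) = (\<lambda>q. h q *\<^sub>R Y' q)"
    using e by (auto simp: h_def fun_eq_iff)
  then have "D X Y p = D X' Y p" "D X' Y p = D X' Y' p"
    using left[OF s] left[OF X' s(2)] right[OF X' s(2)] right[OF X' Y'] W(2)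
      h0[OF smooth_vfield_tangent[OF X' W(2)]] by (simp_all add: h_def)
  then show ?thesis by simp
qed

text \<open>The total space of the warped product instantiates this locale, whereas the base and the
  ambient manifold instantiate its extension by \<open>riemannian_metric\<close>.\<close>

locale levi_civita_manifold =
  fixes A :: "('p::{t2_space, second_countable_topology}, 'e::euclidean_space) atlas"
    and g :: "'p metric" and D :: "'p connection"
  assumes atlas: "smooth_atlas A" and lc: "levi_civita A g D"
begin

abbreviation X_on :: "'p set \<Rightarrow> 'p vfield \<Rightarrow> bool" where "X_on \<equiv> smooth_vfield_on A"

lemma D_smooth: "open W \<Longrightarrow> X_on W X \<Longrightarrow> X_on W Y \<Longrightarrow> X_on W (D X Y)"
  using lc smooth_fun_on_const[of A W 0] unfolding levi_civita_def affine_connection_def by blast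

lemma D_cong:
  assumes "open W" "p \<in> W" "X_on W X" "X_on W Y" "\<And>q. q \<in> W \<Longrightarrow> X q = X' q" "\<And>q. q \<in> W \<Longrightarrow> Y q = Y' q"
  shows "D X Y p = D X' Y' p"
  by (rule connection_cong[OF atlas _ assms]) (use lc in \<open>simp add: levi_civita_def\<close>)

lemma D_add_left:
  "open W \<Longrightarrow> p \<in> W \<Longrightarrow> X_on W X \<Longrightarrow> X_on W Y \<Longrightarrow> X_on W Z \<Longrightarrow>
    D (\<lambda>q. X q + Y q) Z p = D X Z p + D Y Z p"
  using lc smooth_fun_on_const[of A W 0] unfolding levi_civita_def affine_connection_def by blast

lemma D_add_right:
  "open W \<Longrightarrow> p \<in> W \<Longrightarrow> X_on W X \<Longrightarrow> X_on W Y \<Longrightarrow> X_on W Z \<Longrightarrow>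
    D X (\<lambda>q. Y q + Z q) p = D X Y p + D X Z p"
  using lc smooth_fun_on_const[of A W 0] unfolding levi_civita_def affine_connection_def by blast

lemma D_scale_right:
  "open W \<Longrightarrow> p \<in> W \<Longrightarrow> X_on W X \<Longrightarrow> X_on W Y \<Longrightarrow> smooth_fun_on A W h \<Longrightarrow>
    D X (\<lambda>q. h q *\<^sub>R Y q) p = X p h *\<^sub>R Y p + h p *\<^sub>R D X Y p"
  using lc unfolding levi_civita_def affine_connection_def by blast

lemma D_cscale_left:
  "open W \<Longrightarrow> p \<in> W \<Longrightarrow> X_on W X \<Longrightarrow> X_on W Y \<Longrightarrow> D (\<lambda>q. c *\<^sub>R X q) Y p = c *\<^sub>R D X Y p"
  using lc smooth_fun_on_const[of A W c] unfolding levi_civita_def affine_connection_def by blast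

lemma D_cscale_right:
  "open W \<Longrightarrow> p \<in> W \<Longrightarrow> X_on W X \<Longrightarrow> X_on W Y \<Longrightarrow> D X (\<lambda>q. c *\<^sub>R Y q) p = c *\<^sub>R D X Y p"
  using D_scale_right[of W p X Y "\<lambda>_. c"] smooth_fun_on_const[of A W c]
    tangent_vec_const[OF atlas smooth_vfield_tangent] by simp

lemma torsion_free:
  "open W \<Longrightarrow> p \<in> W \<Longrightarrow> X_on W X \<Longrightarrow> X_on W Y \<Longrightarrow> lie_bracket A X Y p = D X Y p - D Y X p"
  using lc unfolding levi_civita_def by metis

lemma metric_compatible:
  "open W \<Longrightarrow> p \<in> W \<Longrightarrow> X_on W X \<Longrightarrow> X_on W Y \<Longrightarrow> X_on W Z \<Longrightarrow>
    X p (\<lambda>q. g q (Y q) (Z q)) = g p (D X Y p) (Z p) + g p (Y p) (D X Z p)"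
  using lc unfolding levi_civita_def by blast

lemma D_diff_right:
  assumes "open W" "p \<in> W" "X_on W X" "X_on W Y" "X_on W Z"
  shows "D X (\<lambda>q. Y q - Z q) p = D X Y p - D X Z p"
  using D_add_right[OF assms(1-4) smooth_vfield_cscale[OF atlas assms(5), of "-1"]]
    D_cscale_right[OF assms(1-3,5), of "-1"] by simp

text \<open>Torsion-freeness writes the bracket as a difference of two smooth fields, which replaces
  a computation in coordinates. The linearity rules for brackets come from the same formula.\<close>

lemma bracket_smooth:
  assumes "open W" "X_on W X" "X_on W Y"
  shows "X_on W (lie_bracket A X Y)"
proof (rule smooth_vfield_cong[OF atlas])
  show "X_on W (\<lambda>p. D X Y p - D Y X p)" by (intro smooth_vfield_diff[OF atlas] D_smooth assms)
  show "D X Y p - D Y X p = lie_bracket A X Y p" if "p \<in> W" for p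
    by (rule torsion_free[OF assms(1) that assms(2,3), symmetric])
qed

abbreviation Rm :: "'p vfield \<Rightarrow> 'p vfield \<Rightarrow> 'p vfield \<Rightarrow> 'p vfield" where "Rm \<equiv> curvature A D"

lemma curvature_smooth:
  assumes "open W" "X_on W X" "X_on W Y" "X_on W Z"
  shows "X_on W (Rm X Y Z)"
  unfolding curvature_def
  by (intro smooth_vfield_diff[OF atlas] D_smooth bracket_smooth assms)

lemma bracket_add_left:
  assumes W: "open W" "p \<in> W" and s: "X_on W X" "X_on W X'" "X_on W Y"
  shows "lie_bracket A (\<lambda>q. X q + X' q) Y p = lie_bracket A X Y p + lie_bracket A X' Y p"
  by (simp add: torsion_free[OF W] s smooth_vfield_add[OF atlas] D_add_left[OF W] D_add_right[OF W])

lemma bracket_cscale_left: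
  assumes W: "open W" "p \<in> W" and s: "X_on W X" "X_on W Y"
  shows "lie_bracket A (\<lambda>q. c *\<^sub>R X q) Y p = c *\<^sub>R lie_bracket A X Y p"
  by (simp add: torsion_free[OF W] s smooth_vfield_cscale[OF atlas] D_cscale_left[OF W] D_cscale_right[OF W]
      scaleR_diff_right)

lemma bracket_skew:
  assumes W: "open W" "p \<in> W" and s: "X_on W X" "X_on W Y"
  shows "lie_bracket A Y X p = (-1) *\<^sub>R lie_bracket A X Y p"
  by (simp add: torsion_free[OF W] s)

text \<open>Linearity over constants is what the algebra in vector spaces of fields asks for. The
  inner identities hold on \<open>W\<close> only, so \<open>D_cong\<close> carries them under the
  outer derivative.\<close>

lemma curvature_add_left:
  assumes W: "open W" "p \<in> W" and s: "X_on W X" "X_on W X'" "X_on W Y" "X_on W Z"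
  shows "Rm (\<lambda>q. X q + X' q) Y Z p = Rm X Y Z p + Rm X' Y Z p"
proof -
  note sm = s D_smooth[OF W(1)] bracket_smooth[OF W(1)] smooth_vfield_add[OF atlas]
  have "D (\<lambda>q. X q + X' q) (D Y Z) p = D X (D Y Z) p + D X' (D Y Z) p"
    by (rule D_add_left[OF W]) (intro sm)+
  moreover have "D Y (D (\<lambda>q. X q + X' q) Z) p = D Y (\<lambda>q. D X Z q + D X' Z q) p"
    by (rule D_cong[OF W]) (intro sm refl D_add_left[OF W(1)] | assumption)+
  moreover have "\<dots> = D Y (D X Z) p + D Y (D X' Z) p"
    by (rule D_add_right[OF W]) (intro sm)+
  moreover have "D (lie_bracket A (\<lambda>q. X q + X' q) Y) Z p
      = D (\<lambda>q. lie_bracket A X Y q + lie_bracket A X' Y q) Z p"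
    by (rule D_cong[OF W]) (intro sm refl bracket_add_left[OF W(1)] | assumption)+
  moreover have "\<dots> = D (lie_bracket A X Y) Z p + D (lie_bracket A X' Y) Z p"
    by (rule D_add_left[OF W]) (intro sm)+
  ultimately show ?thesis by (simp add: curvature_def)
qed

lemma curvature_cscale_left:
  assumes W: "open W" "p \<in> W" and s: "X_on W X" "X_on W Y" "X_on W Z"
  shows "Rm (\<lambda>q. c *\<^sub>R X q) Y Z p = c *\<^sub>R Rm X Y Z p"
proof -
  note sm = s D_smooth[OF W(1)] bracket_smooth[OF W(1)] smooth_vfield_cscale[OF atlas]
  have "D (\<lambda>q. c *\<^sub>R X q) (D Y Z) p = c *\<^sub>R D X (D Y Z) p"
    by (rule D_cscale_left[OF W]) (intro sm)+
  moreover have "D Y (D (\<lambda>q. c *\<^sub>R X q) Z) p = D Y (\<lambda>q. c *\<^sub>R D X Z q) p"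
    by (rule D_cong[OF W]) (intro sm refl D_cscale_left[OF W(1)] | assumption)+
  moreover have "\<dots> = c *\<^sub>R D Y (D X Z) p"
    by (rule D_cscale_right[OF W]) (intro sm)+
  moreover have "D (lie_bracket A (\<lambda>q. c *\<^sub>R X q) Y) Z p = D (\<lambda>q. c *\<^sub>R lie_bracket A X Y q) Z p"
    by (rule D_cong[OF W]) (intro sm refl bracket_cscale_left[OF W(1)] | assumption)+
  moreover have "\<dots> = c *\<^sub>R D (lie_bracket A X Y) Z p"
    by (rule D_cscale_left[OF W]) (intro sm)+
  ultimately show ?thesis by (simp add: curvature_def scaleR_diff_right)
qed

lemma curvature_add_right:
  assumes W: "open W" "p \<in> W" and s: "X_on W X" "X_on W Y" "X_on W Z" "X_on W Z'"
  shows "Rm X Y (\<lambda>q. Z q + Z' q) p = Rm X Y Z p + Rm X Y Z' p"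
proof -
  note sm = s D_smooth[OF W(1)] bracket_smooth[OF W(1)] smooth_vfield_add[OF atlas]
  have *: "D X (D Y (\<lambda>q. Z q + Z' q)) p = D X (D Y Z) p + D X (D Y Z') p"
    if s: "X_on W X" "X_on W Y" for X Y
  proof -
    have "D X (D Y (\<lambda>q. Z q + Z' q)) p = D X (\<lambda>q. D Y Z q + D Y Z' q) p"
      by (rule D_cong[OF W]) (intro sm s refl D_add_right[OF W(1)] | assumption)+
    also have "\<dots> = D X (D Y Z) p + D X (D Y Z') p"
      by (rule D_add_right[OF W]) (intro sm s)+
    finally show ?thesis .
  qed
  have "D (lie_bracket A X Y) (\<lambda>q. Z q + Z' q) p = D (lie_bracket A X Y) Z p + D (lie_bracket A X Y) Z' p"
    by (rule D_add_right[OF W]) (intro sm)+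
  then show ?thesis using *[OF s(1,2)] *[OF s(2,1)] by (simp add: curvature_def)
qed

lemma curvature_skew:
  assumes W: "open W" "p \<in> W" and s: "X_on W X" "X_on W Y" "X_on W Z"
  shows "Rm Y X Z p = - Rm X Y Z p"
proof -
  note sm = s D_smooth[OF W(1)] bracket_smooth[OF W(1)] smooth_vfield_cscale[OF atlas]
  have "D (lie_bracket A Y X) Z p = D (\<lambda>q. (-1) *\<^sub>R lie_bracket A X Y q) Z p"
    by (rule D_cong[OF W]) (intro sm refl bracket_skew[OF W(1)] | assumption)+
  also have "\<dots> = (-1) *\<^sub>R D (lie_bracket A X Y) Z p"
    by (rule D_cscale_left[OF W]) (intro sm)+
  finally show ?thesis by (simp add: curvature_def)
qed

section \<open>Jacobi identity and first Bianchi identity\<close>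

lemma bracket_apply:
  "smooth_at A p h \<Longrightarrow> lie_bracket A X Y p h = X p (\<lambda>q. Y q h) - Y p (\<lambda>q. X q h)"
  by (simp add: lie_bracket_def)

text \<open>On a smooth function each double bracket is a sum of four threefold derivatives, and the
  twelve terms cancel in pairs.\<close>

lemma jacobi:
  assumes W: "open W" "p \<in> W" and s: "X_on W X" "X_on W Y" "X_on W Z"
  shows "lie_bracket A X (lie_bracket A Y Z) p + lie_bracket A Y (lie_bracket A Z X) p
    + lie_bracket A Z (lie_bracket A X Y) p = 0"
proof
  fix h
  show "(lie_bracket A X (lie_bracket A Y Z) p + lie_bracket A Y (lie_bracket A Z X) p
    + lie_bracket A Z (lie_bracket A X Y) p) h = 0 h"
  proof (cases "smooth_at A p h")
    case True
    then obtain V where V: "open V" "p \<in> V" "smooth_fun_on A V h" unfolding smooth_at_def by blast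
    have hV: "smooth_at A q h" if "q \<in> V" for q by (rule smooth_atI[OF V(3,1) that])
    note sat = smooth_vfield_smooth_at[OF _ W]
    have *: "lie_bracket A X (lie_bracket A Y Z) p h
        = X p (\<lambda>q. Y q (\<lambda>q. Z q h)) - X p (\<lambda>q. Z q (\<lambda>q. Y q h))
        - (Y p (\<lambda>q. Z q (\<lambda>q. X q h)) - Z p (\<lambda>q. Y q (\<lambda>q. X q h)))"
      if s: "X_on W X" "X_on W Y" "X_on W Z" for X Y Z
    proof -
      \<comment> \<open>\<open>lie_bracket\<close> is defined by cases on smoothness, so the
        expansion under \<open>X p\<close> is available only on the neighbourhood
        \<open>V\<close>.\<close>
      have "X p (\<lambda>q. lie_bracket A Y Z q h) = X p (\<lambda>q. Y q (\<lambda>q. Z q h) - Z q (\<lambda>q. Y q h))"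
        by (rule tangent_vec_cong[OF atlas smooth_vfield_tangent[OF s(1) W(2)] V(1,2)])
          (simp add: bracket_apply hV)
      also have "\<dots> = X p (\<lambda>q. Y q (\<lambda>q. Z q h)) - X p (\<lambda>q. Z q (\<lambda>q. Y q h))"
        by (rule tangent_vec_diff[OF atlas smooth_vfield_tangent[OF s(1) W(2)]
              sat[OF s(2) sat[OF s(3) True]] sat[OF s(3) sat[OF s(2) True]]])
      finally show ?thesis
        using bracket_apply[OF sat[OF s(1) True], of Y Z] by (simp add: bracket_apply[OF True])
    qed
    show ?thesis
      using *[OF s(1,2,3)] *[OF s(2,3,1)] *[OF s(3,1,2)] by simp
  qed (simp add: lie_bracket_def)
qed

text \<open>Grouped by the outer derivative, the differences of second derivatives become
  derivatives of brackets by torsion-freeness. Together with the bracket terms of the curvature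
  these are double brackets, and their sum is the Jacobi identity.\<close>

lemma bianchi:
  assumes W: "open W" "p \<in> W" and s: "X_on W X" "X_on W Y" "X_on W Z"
  shows "Rm X Y Z p + Rm Y Z X p + Rm Z X Y p = 0"
proof -
  note sm = D_smooth[OF W(1)] bracket_smooth[OF W(1)]
  have *: "D X (D Y Z) p - D X (D Z Y) p = D X (lie_bracket A Y Z) p"
    if s: "X_on W X" "X_on W Y" "X_on W Z" for X Y Z
  proof -
    have "D X (lie_bracket A Y Z) p = D X (\<lambda>q. D Y Z q - D Z Y q) p"
      by (rule D_cong[OF W]) (intro sm s refl torsion_free[OF W(1)] | assumption)+
    also have "\<dots> = D X (D Y Z) p - D X (D Z Y) p"
      by (rule D_diff_right[OF W]) (intro sm s)+
    finally show ?thesis by simp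
  qed
  have **: "lie_bracket A X (lie_bracket A Y Z) p
      = D X (lie_bracket A Y Z) p - D (lie_bracket A Y Z) X p"
    if s: "X_on W X" "X_on W Y" "X_on W Z" for X Y Z
    by (rule torsion_free[OF W]) (intro sm s)+
  have "Rm X Y Z p + Rm Y Z X p + Rm Z X Y p
    = (D X (D Y Z) p - D X (D Z Y) p - D (lie_bracket A Y Z) X p)
    + (D Y (D Z X) p - D Y (D X Z) p - D (lie_bracket A Z X) Y p)
    + (D Z (D X Y) p - D Z (D Y X) p - D (lie_bracket A X Y) Z p)"
    by (simp add: curvature_def)
  also have "\<dots> = 0"
    unfolding *[OF s(1,2,3)] *[OF s(2,3,1)] *[OF s(3,1,2)]
      **[OF s(1,2,3), symmetric] **[OF s(2,3,1), symmetric] **[OF s(3,1,2), symmetric]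
    by (rule jacobi[OF W s])
  finally show ?thesis .
qed

end

section \<open>Symmetries of the curvature of a Riemannian metric\<close>

locale riemannian_manifold = levi_civita_manifold +
  assumes metric: "riemannian_metric A g"
begin

abbreviation T where "T \<equiv> tangent_space A"

lemma g_add_right: "u \<in> T p \<Longrightarrow> v \<in> T p \<Longrightarrow> w \<in> T p \<Longrightarrow> g p u (v + w) = g p u v + g p u w"
  using metric unfolding riemannian_metric_def linear_on_set_def by blast

lemma g_scale_right: "u \<in> T p \<Longrightarrow> v \<in> T p \<Longrightarrow> g p u (c *\<^sub>R v) = c * g p u v"
  using metric unfolding riemannian_metric_def linear_on_set_def by (metis real_scaleR_def)

lemma g_sym: "u \<in> T p \<Longrightarrow> v \<in> T p \<Longrightarrow> g p u v = g p v u"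
  using metric unfolding riemannian_metric_def by blast

lemma T_closed: "u \<in> T p \<Longrightarrow> v \<in> T p \<Longrightarrow> u + v \<in> T p" "u \<in> T p \<Longrightarrow> c *\<^sub>R u \<in> T p"
  "0 \<in> T p" "u \<in> T p \<Longrightarrow> - u \<in> T p" "u \<in> T p \<Longrightarrow> v \<in> T p \<Longrightarrow> u - v \<in> T p"
  using tangent_space_subspace[OF atlas, of p]
  by (auto simp: subspace_add subspace_scale subspace_0 subspace_neg subspace_diff)

lemma g_add_left: "u \<in> T p \<Longrightarrow> v \<in> T p \<Longrightarrow> w \<in> T p \<Longrightarrow> g p (v + w) u = g p v u + g p w u"
  using g_sym g_add_right T_closed by metis

lemma g_scale_left: "u \<in> T p \<Longrightarrow> v \<in> T p \<Longrightarrow> g p (c *\<^sub>R v) u = c * g p v u"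
  using g_sym g_scale_right T_closed by metis

lemma g_minus: "u \<in> T p \<Longrightarrow> v \<in> T p \<Longrightarrow> g p (- v) u = - g p v u"
  "u \<in> T p \<Longrightarrow> v \<in> T p \<Longrightarrow> g p u (- v) = - g p u v"
  using g_scale_left[of u p v "-1"] g_scale_right[of u p v "-1"] by simp_all

lemma g_diff: "u \<in> T p \<Longrightarrow> v \<in> T p \<Longrightarrow> w \<in> T p \<Longrightarrow> g p (v - w) u = g p v u - g p w u"
  "u \<in> T p \<Longrightarrow> v \<in> T p \<Longrightarrow> w \<in> T p \<Longrightarrow> g p u (v - w) = g p u v - g p u w"
  using g_add_left[of u p v "- w"] g_add_right[of u p v "- w"] g_minus T_closed by simp_all

lemma g_zero: "u \<in> T p \<Longrightarrow> g p 0 u = 0" "u \<in> T p \<Longrightarrow> g p u 0 = 0"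
  using g_scale_left[of u p u 0] g_scale_right[of u p u 0] by simp_all

lemma g_smooth: "open W \<Longrightarrow> X_on W X \<Longrightarrow> X_on W Y \<Longrightarrow> smooth_fun_on A W (\<lambda>p. g p (X p) (Y p))"
  using metric unfolding riemannian_metric_def by blast

text \<open>With this order of the slots the numerator of \<open>sectional_curvature\<close> is
  \<open>Rm4 X Y Y X\<close>.\<close>

definition Rm4 :: "'a vfield \<Rightarrow> 'a vfield \<Rightarrow> 'a vfield \<Rightarrow> 'a vfield \<Rightarrow> 'a \<Rightarrow> real" where
  "Rm4 X Y Z U p = g p (Rm X Y Z p) (U p)"

lemma Rm_T: "open W \<Longrightarrow> p \<in> W \<Longrightarrow> X_on W X \<Longrightarrow> X_on W Y \<Longrightarrow> X_on W Z \<Longrightarrow> Rm X Y Z p \<in> T p"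
  using curvature_smooth smooth_vfield_tangent by blast

lemma Rm4_add1:
  assumes W: "open W" "p \<in> W" and s: "X_on W X" "X_on W X'" "X_on W Y" "X_on W Z" "X_on W U"
  shows "Rm4 (\<lambda>q. X q + X' q) Y Z U p = Rm4 X Y Z U p + Rm4 X' Y Z U p"
  unfolding Rm4_def curvature_add_left[OF W s(1-4)]
  by (rule g_add_left) (intro Rm_T[OF W] s smooth_vfield_tangent[OF s(5) W(2)])+

lemma Rm4_cscale1:
  assumes W: "open W" "p \<in> W" and s: "X_on W X" "X_on W Y" "X_on W Z" "X_on W U"
  shows "Rm4 (\<lambda>q. c *\<^sub>R X q) Y Z U p = c * Rm4 X Y Z U p"
  unfolding Rm4_def curvature_cscale_left[OF W s(1-3)]
  by (rule g_scale_left) (intro Rm_T[OF W] s smooth_vfield_tangent[OF s(4) W(2)])+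

lemma Rm4_skew12:
  assumes W: "open W" "p \<in> W" and s: "X_on W X" "X_on W Y" "X_on W Z" "X_on W U"
  shows "Rm4 Y X Z U p = - Rm4 X Y Z U p"
  unfolding Rm4_def curvature_skew[OF W s(1-3)]
  by (rule g_minus(1)) (intro Rm_T[OF W] s smooth_vfield_tangent[OF s(4) W(2)])+

lemma Rm4_bianchi:
  assumes W: "open W" "p \<in> W" and s: "X_on W X" "X_on W Y" "X_on W Z" "X_on W U"
  shows "Rm4 X Y Z U p + Rm4 Y Z X U p + Rm4 Z X Y U p = 0"
proof -
  note t = Rm_T[OF W] s smooth_vfield_tangent[OF s(4) W(2)]
  have "g p (Rm X Y Z p + Rm Y Z X p + Rm Z X Y p) (U p) = 0"
    unfolding bianchi[OF W s(1-3)] by (rule g_zero(1)) (intro t)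
  then show ?thesis
    unfolding Rm4_def by (subst (asm) g_add_left, (intro t T_closed)+, subst (asm) g_add_left, (intro t T_closed)+)
qed

text \<open>The function G = g(Z, Z) satisfies X Y G - Y X G = [X, Y] G. Metric compatibility
  expands all three terms; the products of two first derivatives of Z cancel by symmetry, and twice
  the curvature term is left.\<close>

lemma Rm4_diag:
  assumes W: "open W" "p \<in> W" and s: "X_on W X" "X_on W Y" "X_on W Z"
  shows "Rm4 X Y Z Z p = 0"
proof -
  note sm = D_smooth[OF W(1)] bracket_smooth[OF W(1)]
  have tv: "X p \<in> T p" if "X_on W X" for X using smooth_vfield_tangent[OF that W(2)] .
  define G where "G = (\<lambda>q. g q (Z q) (Z q))"
  have G: "smooth_fun_on A W G" unfolding G_def by (rule g_smooth[OF W(1) s(3,3)])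
  have XG: "X q G = 2 * g q (D X Z q) (Z q)" if "X_on W X" "q \<in> W" for X q
  proof -
    have t: "D X Z q \<in> T q" "Z q \<in> T q"
      using smooth_vfield_tangent[OF sm(1)[OF that(1) s(3)] that(2)] smooth_vfield_tangent[OF s(3) that(2)] by auto
    show ?thesis
      using metric_compatible[OF W(1) that(2,1) s(3,3)] g_sym[OF t] by (simp add: G_def)
  qed
  have XYG: "X p (\<lambda>q. Y q G) = 2 * (g p (D X (D Y Z) p) (Z p) + g p (D Y Z p) (D X Z p))"
    if s': "X_on W X" "X_on W Y" for X Y
  proof -
    have "X p (\<lambda>q. Y q G) = X p (\<lambda>q. 2 * g q (D Y Z q) (Z q))"
      by (rule tangent_vec_cong[OF atlas tv[OF s'(1)] W]) (rule XG[OF s'(2)])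
    also have "\<dots> = 2 * X p (\<lambda>q. g q (D Y Z q) (Z q))"
      by (rule tangent_vec_cmult[OF atlas tv[OF s'(1)]])
        (rule smooth_atI[OF g_smooth[OF W(1) sm(1)[OF s'(2) s(3)] s(3)] W])
    finally show ?thesis
      using metric_compatible[OF W s'(1) sm(1)[OF s'(2) s(3)] s(3)] by simp
  qed
  have "lie_bracket A X Y p G = X p (\<lambda>q. Y q G) - Y p (\<lambda>q. X q G)"
    by (rule bracket_apply[OF smooth_atI[OF G W]])
  moreover have "lie_bracket A X Y p G = 2 * g p (D (lie_bracket A X Y) Z p) (Z p)"
    by (rule XG[OF bracket_smooth[OF W(1) s(1,2)] W(2)])
  moreover have "g p (D Y Z p) (D X Z p) = g p (D X Z p) (D Y Z p)"
    by (rule g_sym) (intro tv sm s)+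
  moreover have "Rm4 X Y Z Z p = g p (D X (D Y Z) p) (Z p) - g p (D Y (D X Z) p) (Z p)
      - g p (D (lie_bracket A X Y) Z p) (Z p)"
    unfolding Rm4_def curvature_def
    by (subst g_diff(1), (intro tv sm s T_closed)+, subst g_diff(1), (intro tv sm s T_closed refl)+)
  ultimately show ?thesis using XYG[OF s(1,2)] XYG[OF s(2,1)] by simp
qed

text \<open>Polarisation of \<open>Rm4_diag\<close> at \<open>Z + U\<close>.\<close>

lemma Rm4_skew34:
  assumes W: "open W" "p \<in> W" and s: "X_on W X" "X_on W Y" "X_on W Z" "X_on W U"
  shows "Rm4 X Y U Z p = - Rm4 X Y Z U p"
proof -
  have tv: "X p \<in> T p" if "X_on W X" for X using smooth_vfield_tangent[OF that W(2)] .
  note t = Rm_T[OF W] s tv T_closed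
  have "0 = Rm4 X Y (\<lambda>q. Z q + U q) (\<lambda>q. Z q + U q) p"
    by (rule Rm4_diag[OF W s(1,2) smooth_vfield_add[OF atlas s(3,4)], symmetric])
  also have "\<dots> = g p (Rm X Y Z p + Rm X Y U p) (Z p + U p)"
    by (simp add: Rm4_def curvature_add_right[OF W s])
  also have "\<dots> = Rm4 X Y Z Z p + Rm4 X Y Z U p + Rm4 X Y U Z p + Rm4 X Y U U p"
    by (simp add: Rm4_def g_add_left g_add_right t)
  finally show ?thesis by (simp add: Rm4_diag[OF W] s)
qed

text \<open>The octahedron argument: the four Bianchi identities in which each field in turn takes
  the last slot, combined with the two skew symmetries, are linear equations that imply the
  claim.\<close>

lemma Rm4_pair:
  assumes W: "open W" "p \<in> W" and s: "X_on W X" "X_on W Y" "X_on W Z" "X_on W U"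
  shows "Rm4 Z U X Y p = Rm4 X Y Z U p"
  using Rm4_bianchi[OF W s(1,2,3,4)] Rm4_bianchi[OF W s(2,3,4,1)] Rm4_bianchi[OF W s(3,4,1,2)]
    Rm4_bianchi[OF W s(4,1,2,3)]
    Rm4_skew12[OF W s(1,3,2,4)] Rm4_skew12[OF W s(1,3,4,2)] Rm4_skew12[OF W s(2,4,1,3)]
    Rm4_skew12[OF W s(2,4,3,1)] Rm4_skew34[OF W s(1,3,2,4)] Rm4_skew34[OF W s(2,4,1,3)]
    Rm4_skew34[OF W s(1,2,3,4)] Rm4_skew34[OF W s(3,4,1,2)] Rm4_skew34[OF W s(2,3,1,4)]
    Rm4_skew34[OF W s(4,1,2,3)] Rm4_skew34[OF W s(2,3,4,1)] 
    Rm4_skew12[OF W s(1,4,2,3)] Rm4_skew12[OF W s(2,3,1,4)] Rm4_skew12[OF W s(1,4,3,2)]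
  by linarith

end

section \<open>Sectional curvature of Sasakian space forms\<close>

text \<open>Adding \<open>Q\<close> at X + Z and at X - Z leaves, beyond the pure terms, 4 S X Z Z X
  + 12 S X (J Z) (J Z) X. With a = S X Y Y X and b = S X (J Y) (J Y) X, the choices Z = Y and Z = J
  Y give 4 a + 12 b = 4 b + 12 a = 4 k (n X) (n Y); hence a = b, and the factor 1 / 4 appears.
  \<open>n\<close> stands for the squared length, and the equations for it hold when X is orthogonal
  to Y and J Y. The vector space is abstract so that its elements can be fields.\<close>

lemma kaehler_sectional:
  fixes S :: "'v::real_vector \<Rightarrow> 'v \<Rightarrow> 'v \<Rightarrow> 'v \<Rightarrow> real"
  assumes H: "subspace H" and JH: "\<And>X. X \<in> H \<Longrightarrow> J X \<in> H"
    and Jadd: "\<And>X Y. X \<in> H \<Longrightarrow> Y \<in> H \<Longrightarrow> J (X + Y) = J X + J Y"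
    and Jneg: "\<And>X. X \<in> H \<Longrightarrow> J (- X) = - J X" and JJ: "\<And>X. X \<in> H \<Longrightarrow> J (J X) = - X"
    and add1: "\<And>X X' Y Z U. X \<in> H \<Longrightarrow> X' \<in> H \<Longrightarrow> Y \<in> H \<Longrightarrow> Z \<in> H \<Longrightarrow> U \<in> H \<Longrightarrow>
      S (X + X') Y Z U = S X Y Z U + S X' Y Z U"
    and neg1: "\<And>X Y Z U. X \<in> H \<Longrightarrow> Y \<in> H \<Longrightarrow> Z \<in> H \<Longrightarrow> U \<in> H \<Longrightarrow> S (- X) Y Z U = - S X Y Z U"
    and skew12: "\<And>X Y Z U. X \<in> H \<Longrightarrow> Y \<in> H \<Longrightarrow> Z \<in> H \<Longrightarrow> U \<in> H \<Longrightarrow> S Y X Z U = - S X Y Z U"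
    and pair: "\<And>X Y Z U. X \<in> H \<Longrightarrow> Y \<in> H \<Longrightarrow> Z \<in> H \<Longrightarrow> U \<in> H \<Longrightarrow> S Z U X Y = S X Y Z U"
    and bianchi: "\<And>X Y Z U. X \<in> H \<Longrightarrow> Y \<in> H \<Longrightarrow> Z \<in> H \<Longrightarrow> U \<in> H \<Longrightarrow>
      S X Y Z U + S Y Z X U + S Z X Y U = 0"
    and kaehler: "\<And>X Y Z U. X \<in> H \<Longrightarrow> Y \<in> H \<Longrightarrow> Z \<in> H \<Longrightarrow> U \<in> H \<Longrightarrow> S X Y (J Z) (J U) = S X Y Z U"
    and Q: "\<And>X. X \<in> H \<Longrightarrow> S X (J X) (J X) X = k * (n X)\<^sup>2"
    and XY: "X \<in> H" "Y \<in> H"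
    and n: "n (X + Y) = n X + n Y" "n (X + - Y) = n X + n Y" "n (X + J Y) = n X + n Y"
      "n (X + - J Y) = n X + n Y" "n (J Y) = n Y"
  shows "S X Y Y X = k / 4 * (n X * n Y)"
proof -
  have Hneg: "- X \<in> H" if "X \<in> H" for X using H that by (rule subspace_neg)
  have Hadd: "X + Y \<in> H" if "X \<in> H" "Y \<in> H" for X Y using H that by (rule subspace_add)
  note mem = JH Hneg Hadd
  \<comment> \<open>The symmetries carry linearity from the first slot to the other three.\<close>
  have add2: "S Y (X + X') Z U = S Y X Z U + S Y X' Z U" and neg2: "S Y (- X) Z U = - S Y X Z U"
    if "X \<in> H" "X' \<in> H" "Y \<in> H" "Z \<in> H" "U \<in> H" for X X' Y Z U
    using skew12[of _ Y Z U] add1[of X X' Y Z U] neg1[of X Y Z U] mem that by force+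
  have add3: "S Y Z (X + X') U = S Y Z X U + S Y Z X' U" and neg3: "S Y Z (- X) U = - S Y Z X U"
    if "X \<in> H" "X' \<in> H" "Y \<in> H" "Z \<in> H" "U \<in> H" for X X' Y Z U
    using pair[of _ U Y Z] add1[of X X' U Y Z] neg1[of X U Y Z] mem that by force+
  have add4: "S Y Z U (X + X') = S Y Z U X + S Y Z U X'" and neg4: "S Y Z U (- X) = - S Y Z U X"
    if "X \<in> H" "X' \<in> H" "Y \<in> H" "Z \<in> H" "U \<in> H" for X X' Y Z U
    using pair[of U _ Y Z] add2[of X X' U Y Z] neg2[of X X' U Y Z] mem that by force+
  have skew34: "S X Y U Z = - S X Y Z U" if "X \<in> H" "Y \<in> H" "Z \<in> H" "U \<in> H" for X Y Z U
    using pair[of X Y U Z] pair[of X Y Z U] skew12[of Z U X Y] that by simp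
  have polar: "S (X + Z) (J (X + Z)) (J (X + Z)) (X + Z)
      + S (X + - Z) (J (X + - Z)) (J (X + - Z)) (X + - Z)
      = 2 * S X (J X) (J X) X + 2 * S Z (J Z) (J Z) Z + 4 * S X Z Z X + 12 * S X (J Z) (J Z) X"
    if Z: "Z \<in> H" for Z
  proof -
    note X = XY(1)
    \<comment> \<open>Terms of odd degree in \<open>Z\<close> cancel. The six terms of degree two,
      one for each choice of two slots for \<open>Z\<close>, are reduced below to S X Z Z X and S X
      (J Z) (J Z) X.\<close>
    have 1: "S (X + Z) (J (X + Z)) (J (X + Z)) (X + Z)
      + S (X + - Z) (J (X + - Z)) (J (X + - Z)) (X + - Z)
      = 2 * S X (J X) (J X) X + 2 * S Z (J Z) (J Z) Z
        + 2 * (S Z (J Z) (J X) X + S Z (J X) (J Z) X + S Z (J X) (J X) Z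
          + S X (J Z) (J Z) X + S X (J Z) (J X) Z + S X (J X) (J Z) Z)"
      using X Z mem
      by (simp add: Jadd Jneg add1 neg1 add2[OF _ _ _ _ _] add3 add4 neg2[where X' = X] neg3[where X' = X]
          neg4[where X' = X] del: add_uminus_conv_diff)
    have 2: "S Z (J Z) (J X) X = S X (J X) (J Z) Z"
      using pair[of Z "J Z" "J X" X] skew12[of X "J X" Z "J Z"] skew34[of X "J X" "J Z" Z] X Z mem by simp
    have 3: "S Z (J X) (J Z) X = S X (J Z) (J X) Z"
      using pair[of Z "J X" "J Z" X] skew12[of X "J Z" Z "J X"] skew34[of X "J Z" "J X" Z] X Z mem by simp
    have 4: "S X (J Z) (J X) Z = S X (J Z) (J Z) X"
    proof -
      have "S X (J Z) (J X) Z = S X (J Z) (- X) (J Z)"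
        using kaehler[of X "J Z" "J X" Z] X Z mem JJ[OF X] by simp
      also have "\<dots> = - S X (J Z) X (J Z)" using neg3[of X X X "J Z" "J Z"] X Z mem by simp
      also have "\<dots> = S X (J Z) (J Z) X" using skew34[of X "J Z" X "J Z"] X Z mem by simp
      finally show ?thesis .
    qed
    have 5: "S Z (J X) (J X) Z = S X (J Z) (J X) Z"
    proof -
      have "S Z (J X) (J X) Z = S (J X) Z Z (J X)"
        using pair[of Z "J X" "J X" Z] X Z mem by simp
      also have "\<dots> = S (J X) Z (J Z) (J (J X))" using kaehler[of "J X" Z Z "J X"] X Z mem by simp
      also have "\<dots> = - S (J X) Z (J Z) X" using X Z mem JJ neg4[of X X "J X" Z "J Z"] by simp
      also have "\<dots> = - S (J Z) X (J X) Z" using pair[of "J X" Z "J Z" X] X Z mem by simp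
      also have "\<dots> = S X (J Z) (J X) Z" using skew12[of X "J Z" "J X" Z] X Z mem by simp
      finally show ?thesis .
    qed
    \<comment> \<open>The one reduction that uses the Bianchi identity; it brings in the curvature S
      X Z Z X.\<close>
    have 6: "S X (J X) (J Z) Z = S X Z Z X + S X (J Z) (J X) Z"
    proof -
      have "S (J X) (J Z) X Z = S X Z X Z"
        using pair[of X Z "J X" "J Z"] pair[of X Z X Z] kaehler[of X Z X Z] X Z mem by simp
      then show ?thesis
        using bianchi[of X "J X" "J Z" Z] skew12[of X "J Z" "J X" Z] skew34[of X Z Z X] X Z mem by simp
    qed
    show ?thesis unfolding 1 using 2 3 4 5 6 by simp
  qed
  have JY: "J Y \<in> H" "- J Y \<in> H" "- Y \<in> H" using XY mem by auto
  \<comment> \<open>Since J J = -1, the choice Z = J Y exchanges the two unknown curvatures.\<close>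
  have "S X (J (J Y)) (J (J Y)) X = S X Y Y X"
    using XY mem JJ neg2[of Y Y X "- Y" X] neg3[of Y Y X Y X] by simp
  then have b: "S (X + J Y) (J (X + J Y)) (J (X + J Y)) (X + J Y)
      + S (X + - J Y) (J (X + - J Y)) (J (X + - J Y)) (X + - J Y)
      = 2 * S X (J X) (J X) X + 2 * S (J Y) (J (J Y)) (J (J Y)) (J Y) + 4 * S X (J Y) (J Y) X + 12 * S X Y Y X"
    using polar[OF JY(1)] by simp
  have "k * (n X + n Y)\<^sup>2 * 2 = 2 * (k * (n X)\<^sup>2) + 2 * (k * (n Y)\<^sup>2) + 4 * S X Y Y X + 12 * S X (J Y) (J Y) X"
    using polar[OF XY(2)] unfolding Q[OF Hadd[OF XY]] Q[OF Hadd[OF XY(1) JY(3)]] Q[OF XY(1)] Q[OF XY(2)] n by simp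
  moreover have "k * (n X + n Y)\<^sup>2 * 2 = 2 * (k * (n X)\<^sup>2) + 2 * (k * (n Y)\<^sup>2) + 4 * S X (J Y) (J Y) X + 12 * S X Y Y X"
    using b unfolding Q[OF Hadd[OF XY(1) JY(1)]] Q[OF Hadd[OF XY(1) JY(2)]] Q[OF XY(1)] Q[OF JY(1)] n by simp
  moreover have "k * (n X + n Y)\<^sup>2 = k * (n X)\<^sup>2 + k * (n Y)\<^sup>2 + 2 * (k * (n X * n Y))"
    by (simp add: power2_sum algebra_simps)
  ultimately show ?thesis by (simp add: field_simps)
qed

section \<open>Identities of Sasakian structures\<close>

locale sasakian_manifold = riemannian_manifold +
  fixes \<phi> :: "'a \<Rightarrow> 'a tvec \<Rightarrow> 'a tvec" and \<xi> :: "'a vfield" and \<eta> :: "'a \<Rightarrow> 'a tvec \<Rightarrow> real"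
  assumes sasaki: "sasakian A \<phi> \<xi> \<eta> g D"
begin

lemma acm: "almost_contact_metric A \<phi> \<xi> \<eta> g"
  using sasaki unfolding sasakian_def by blast

lemma xi_smooth: "X_on W \<xi>"
proof -
  have "X_on UNIV \<xi>" using acm unfolding almost_contact_metric_def by (elim conjE)
  then show ?thesis by (rule smooth_vfield_subset) simp
qed

lemma xi_T: "\<xi> p \<in> T p"
  using smooth_vfield_tangent[OF xi_smooth UNIV_I] .

lemma phi_linear: "linear_on_set (T p) (\<phi> p)" and eta_linear: "linear_on_set (T p) (\<eta> p)"
  using acm unfolding almost_contact_metric_def by (elim conjE; simp)+

lemma phi_add: "u \<in> T p \<Longrightarrow> v \<in> T p \<Longrightarrow> \<phi> p (u + v) = \<phi> p u + \<phi> p v"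
  and phi_scale: "u \<in> T p \<Longrightarrow> \<phi> p (a *\<^sub>R u) = a *\<^sub>R \<phi> p u"
  using phi_linear unfolding linear_on_set_def by blast+

lemma eta_add: "u \<in> T p \<Longrightarrow> v \<in> T p \<Longrightarrow> \<eta> p (u + v) = \<eta> p u + \<eta> p v"
  and eta_scale: "u \<in> T p \<Longrightarrow> \<eta> p (a *\<^sub>R u) = a * \<eta> p u"
  using eta_linear[of p] unfolding linear_on_set_def real_scaleR_def by blast+

lemma phi_smooth: "open W \<Longrightarrow> X_on W X \<Longrightarrow> X_on W (\<lambda>p. \<phi> p (X p))"
  and eta_smooth: "open W \<Longrightarrow> X_on W X \<Longrightarrow> smooth_fun_on A W (\<lambda>p. \<eta> p (X p))"
  using acm unfolding almost_contact_metric_def by (elim conjE; simp)+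

lemma phi_T: "u \<in> T p \<Longrightarrow> \<phi> p u \<in> T p"
  and phi_phi: "u \<in> T p \<Longrightarrow> \<phi> p (\<phi> p u) = - u + \<eta> p u *\<^sub>R \<xi> p"
  using acm unfolding almost_contact_metric_def by (elim conjE; blast)+

lemma eta_xi: "\<eta> p (\<xi> p) = 1"
  and g_phi_phi: "u \<in> T p \<Longrightarrow> v \<in> T p \<Longrightarrow> g p (\<phi> p u) (\<phi> p v) = g p u v - \<eta> p u * \<eta> p v"
  using acm unfolding almost_contact_metric_def by (elim conjE; simp)+

lemma phi_0: "\<phi> p 0 = 0" and eta_0: "\<eta> p 0 = 0"
  using phi_scale[OF xi_T, of p 0] eta_scale[OF xi_T, of p 0] by simp_all

lemma phi_minus: "u \<in> T p \<Longrightarrow> \<phi> p (- u) = - \<phi> p u"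
  using phi_scale[of u p "-1"] by simp

lemma phi_diff: "u \<in> T p \<Longrightarrow> v \<in> T p \<Longrightarrow> \<phi> p (u - v) = \<phi> p u - \<phi> p v"
  using phi_add[of u p "- v"] phi_minus T_closed by simp

text \<open>\<open>phi_phi\<close> at \<xi> gives \<phi> (\<phi> \<xi>) = 0, and at \<phi> \<xi> it
  makes \<phi> \<xi> a multiple a \<xi>; together a^2 \<xi> = 0.\<close>

lemma phi_xi: "\<phi> p (\<xi> p) = 0"
proof -
  define a where "a = \<eta> p (\<phi> p (\<xi> p))"
  have x: "\<phi> p (\<phi> p (\<xi> p)) = 0" using phi_phi[OF xi_T] by (simp add: eta_xi)
  then have "\<phi> p (\<phi> p (\<phi> p (\<xi> p))) = 0" by (simp add: phi_0)
  then have e: "\<phi> p (\<xi> p) = a *\<^sub>R \<xi> p" using phi_phi[OF phi_T[OF xi_T]] by (simp add: a_def)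
  have "a *\<^sub>R (a *\<^sub>R \<xi> p) = 0" using x by (simp add: e phi_scale[OF xi_T])
  moreover have "\<xi> p \<noteq> 0" using eta_xi[of p] eta_0[of p] by auto
  ultimately have "a = 0" by simp
  then show ?thesis by (simp add: e)
qed

text \<open>Applying \<phi> three times can be evaluated with \<open>phi_phi\<close> in two ways,
  which differ by \<eta> (\<phi> u) \<xi>.\<close>

lemma eta_phi: "u \<in> T p \<Longrightarrow> \<eta> p (\<phi> p u) = 0"
proof -
  assume u: "u \<in> T p"
  have "\<phi> p (\<phi> p (\<phi> p u)) = \<phi> p (- u + \<eta> p u *\<^sub>R \<xi> p)" by (simp only: phi_phi[OF u])
  also have "\<dots> = - \<phi> p u"
    using u xi_T by (simp add: phi_diff phi_scale phi_xi T_closed)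
  finally have "\<eta> p (\<phi> p u) *\<^sub>R \<xi> p = 0" using phi_phi[OF phi_T[OF u]] by simp
  moreover have "\<xi> p \<noteq> 0" using eta_xi[of p] eta_0[of p] by auto
  ultimately show ?thesis by simp
qed

text \<open>This is \<open>g_phi_phi\<close> with second argument \<xi>, where the left side
  vanishes.\<close>

lemma eta_g: "u \<in> T p \<Longrightarrow> \<eta> p u = g p u (\<xi> p)"
  using g_phi_phi[OF _ xi_T, of u] g_zero(2)[OF phi_T] by (simp add: phi_xi eta_xi)

text \<open>Put \<phi> v for v in \<open>g_phi_phi\<close>; the terms with \<eta> drop out by
  \<open>eta_phi\<close>.\<close>

lemma phi_skew: "u \<in> T p \<Longrightarrow> v \<in> T p \<Longrightarrow> g p (\<phi> p u) v = - g p u (\<phi> p v)"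
proof -
  assume u: "u \<in> T p" and v: "v \<in> T p"
  have "g p u (\<phi> p v) = g p (\<phi> p u) (\<phi> p (\<phi> p v))"
    using g_phi_phi[OF u phi_T[OF v]] eta_phi[OF v] by simp
  also have "\<dots> = g p (\<phi> p u) (- v) + \<eta> p v * \<eta> p (\<phi> p u)"
    using u v xi_T phi_T by (simp add: phi_phi g_diff g_minus g_scale_right T_closed eta_g)
  also have "\<dots> = - g p (\<phi> p u) v" using u v phi_T by (simp add: g_minus eta_phi)
  finally show ?thesis by simp
qed

lemma D_phi:
  "open W \<Longrightarrow> p \<in> W \<Longrightarrow> X_on W X \<Longrightarrow> X_on W Y \<Longrightarrow>
    D X (\<lambda>q. \<phi> q (Y q)) p = \<phi> p (D X Y p) + g p (X p) (Y p) *\<^sub>R \<xi> p - \<eta> p (Y p) *\<^sub>R X p"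
proof -
  assume a: "open W" "p \<in> W" "X_on W X" "X_on W Y"
  then have "D X (\<lambda>q. \<phi> q (Y q)) p - \<phi> p (D X Y p) = g p (X p) (Y p) *\<^sub>R \<xi> p - \<eta> p (Y p) *\<^sub>R X p"
    using sasaki unfolding sasakian_def by blast
  then show ?thesis by (simp add: algebra_simps)
qed

text \<open>Differentiating \<phi> \<xi> = 0 determines the derivative of \<xi> up to its component
  along \<xi>, and this component vanishes because \<xi> has constant length.\<close>

lemma D_xi:
  assumes W: "open W" "p \<in> W" and X: "X_on W X"
  shows "D X \<xi> p = - \<phi> p (X p)"
proof -
  have Xp: "X p \<in> T p" by (rule smooth_vfield_tangent[OF X W(2)])
  have d: "D X \<xi> p \<in> T p" by (rule smooth_vfield_tangent[OF D_smooth[OF W(1) X xi_smooth] W(2)])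
  have "D X (\<lambda>q. \<phi> q (\<xi> q)) p = 0"
    using D_cscale_right[OF W X xi_smooth, of 0] by (simp add: phi_xi)
  then have "\<phi> p (D X \<xi> p) = X p + (- \<eta> p (X p)) *\<^sub>R \<xi> p"
    using D_phi[OF W X xi_smooth] by (simp add: eta_xi eta_g[OF Xp] algebra_simps)
  then have "\<phi> p (\<phi> p (D X \<xi> p)) = \<phi> p (X p)"
    using Xp xi_T by (simp add: phi_diff phi_scale phi_xi T_closed)
  moreover have "\<eta> p (D X \<xi> p) = 0"
  proof -
    have "X p (\<lambda>q. g q (\<xi> q) (\<xi> q)) = 0"
      using tangent_vec_const[OF atlas Xp, of 1] eta_g[OF xi_T] by (simp add: eta_xi)
    then show ?thesis
      using metric_compatible[OF W X xi_smooth xi_smooth] g_sym[OF d xi_T] eta_g[OF d] by simp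
  qed
  ultimately have "- D X \<xi> p = \<phi> p (X p)" using phi_phi[OF d] by simp
  then show ?thesis by (metis minus_minus)
qed

text \<open>
  The condition outside \<open>W\<close> makes \<open>\<phi> \<circ> \<phi> = -1\<close> an identity between functions on the whole type.
\<close>

definition contact_fields :: "'a set \<Rightarrow> 'a vfield set" where
  "contact_fields W = {X. X_on W X \<and> (\<forall>q. q \<notin> W \<longrightarrow> X q = 0) \<and> (\<forall>q\<in>W. \<eta> q (X q) = 0)}"

abbreviation J :: "'a vfield \<Rightarrow> 'a vfield" where "J X \<equiv> \<lambda>q. \<phi> q (X q)"

lemma contact_fieldsD:
  assumes "X \<in> contact_fields W"
  shows "X_on W X" "q \<notin> W \<Longrightarrow> X q = 0" "\<eta> q (X q) = 0" "X q \<in> T q"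
proof -
  show X: "X_on W X" and 0: "q \<notin> W \<Longrightarrow> X q = 0" using assms unfolding contact_fields_def by auto
  show "\<eta> q (X q) = 0" "X q \<in> T q"
    using assms 0 X smooth_vfield_tangent[of A W X q]
    by (cases "q \<in> W"; auto simp: contact_fields_def eta_0 T_closed)+
qed

lemma contact_fields_subspace: "subspace (contact_fields W)"
proof (rule subspaceI)
  note sm = contact_fieldsD(1)
  have "(0 :: 'a vfield) = (\<lambda>q. 0)" by (rule ext) simp
  then show "0 \<in> contact_fields W"
    using smooth_vfield_zero[OF atlas, of W] by (simp add: contact_fields_def eta_0)
  show "X + Y \<in> contact_fields W" if h: "X \<in> contact_fields W" "Y \<in> contact_fields W" for X Y
  proof -
    have "(\<lambda>q. X q + Y q) = X + Y" by (rule ext) simp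
    then have "X_on W (X + Y)" using smooth_vfield_add[OF atlas h[THEN sm]] by simp
    then show ?thesis
      using contact_fieldsD(2-4)[OF h(1)] contact_fieldsD(2-4)[OF h(2)]
      by (simp add: contact_fields_def eta_add)
  qed
  show "c *\<^sub>R X \<in> contact_fields W" if h: "X \<in> contact_fields W" for c X
  proof -
    have e: "c *\<^sub>R X = (\<lambda>q. c *\<^sub>R X q)" by (rule scaleR_fun_def)
    show ?thesis
      unfolding e using contact_fieldsD(2-4)[OF h] smooth_vfield_cscale[OF atlas sm[OF h]]
      by (simp add: contact_fields_def eta_scale)
  qed
qed

lemma J_contact:
  assumes W: "open W" and X: "X \<in> contact_fields W"
  shows "J X \<in> contact_fields W"
  using contact_fieldsD[OF X] phi_smooth[OF W] by (simp add: contact_fields_def eta_phi phi_0)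

lemma J_J: "X \<in> contact_fields W \<Longrightarrow> J (J X) = - X"
  using contact_fieldsD by (fastforce simp: phi_phi)

text \<open>The fundamental 2-form up to sign. By \<open>eta_D\<close> it is the \<xi>-component of
  a covariant derivative of contact fields, so it measures how far these are from being closed under
  \<open>D\<close>.\<close>

definition \<Omega> :: "'a \<Rightarrow> 'a vfield \<Rightarrow> 'a vfield \<Rightarrow> real" where
  "\<Omega> p X Y = g p (\<phi> p (X p)) (Y p)"

lemma \<Omega>_skew: "X \<in> contact_fields W \<Longrightarrow> Y \<in> contact_fields W \<Longrightarrow> \<Omega> p Y X = - \<Omega> p X Y"
  unfolding \<Omega>_def using contact_fieldsD(4) phi_skew g_sym phi_T by metis

text \<open>Differentiate g(Z, \<xi>) = 0 along \<open>Y\<close> and insert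
  \<open>D_xi\<close>.\<close>

lemma eta_D:
  assumes W: "open W" "q \<in> W" and H: "Y \<in> contact_fields W" "Z \<in> contact_fields W"
  shows "\<eta> q (D Y Z q) = \<Omega> q Y Z"
proof -
  note Y = contact_fieldsD[OF H(1)] and Z = contact_fieldsD[OF H(2)]
  \<comment> \<open>The equation holds on the whole type because contact fields vanish off
    \<open>W\<close>.\<close>
  have "(\<lambda>r. g r (Z r) (\<xi> r)) = (\<lambda>r. 0)" using Z(3,4) eta_g by (auto simp: fun_eq_iff)
  then have "g q (D Y Z q) (\<xi> q) + g q (Z q) (D Y \<xi> q) = 0"
    using metric_compatible[OF W Y(1) Z(1) xi_smooth] tangent_vec_const[OF atlas Y(4)] by simp
  moreover have "g q (Z q) (D Y \<xi> q) = - \<Omega> q Y Z"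
    unfolding D_xi[OF W Y(1)] \<Omega>_def using Y(4) Z(4) phi_T g_minus g_sym by metis
  moreover have "D Y Z q \<in> T q" by (rule smooth_vfield_tangent[OF D_smooth[OF W(1) Y(1) Z(1)] W(2)])
  ultimately show ?thesis by (simp add: eta_g)
qed

text \<open>The Sasakian identity is used twice. The field \<open>D Y Z\<close> need not be
  orthogonal to \<xi>, so the second use leaves a term with \<eta>, which \<open>eta_D\<close> turns
  into \<Omega>; differentiating g(Y, Z) \<xi> leaves - g(Y, Z) \<phi> X. Pairing with \<phi> U
  removes everything along \<xi>.\<close>

lemma second_derivative_J:
  assumes W: "open W" "p \<in> W" and H: "X \<in> contact_fields W" "Y \<in> contact_fields W"
    "Z \<in> contact_fields W" "U \<in> contact_fields W"
  shows "g p (D X (D Y (J Z)) p) (\<phi> p (U p)) = g p (D X (D Y Z) p) (U p)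
    + \<Omega> p Y Z * \<Omega> p X U - g p (Y p) (Z p) * g p (X p) (U p)"
proof -
  note X = contact_fieldsD[OF H(1)] and Y = contact_fieldsD[OF H(2)]
    and Z = contact_fieldsD[OF H(3)] and U = contact_fieldsD[OF H(4)]
  define E where "E = D Y Z"
  define G where "G = (\<lambda>q. g q (Y q) (Z q))"
  have E: "X_on W E" unfolding E_def by (rule D_smooth[OF W(1) Y(1) Z(1)])
  have G: "smooth_fun_on A W G" unfolding G_def by (rule g_smooth[OF W(1) Y(1) Z(1)])
  have JZ: "X_on W (J Z)" by (rule phi_smooth[OF W(1) Z(1)])
  have Gxi: "X_on W (\<lambda>q. G q *\<^sub>R \<xi> q)" by (rule smooth_vfield_scale[OF atlas G xi_smooth])
  have Ep: "E p \<in> T p" by (rule smooth_vfield_tangent[OF E W(2)])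
  have DE: "D X E p \<in> T p" by (rule smooth_vfield_tangent[OF D_smooth[OF W(1) X(1) E] W(2)])
  have "D X (D Y (J Z)) p = D X (\<lambda>q. \<phi> q (E q) + G q *\<^sub>R \<xi> q) p"
    by (rule D_cong[OF W X(1) D_smooth[OF W(1) Y(1) JZ] refl])
      (simp add: D_phi[OF W(1) _ Y(1) Z(1)] Z(3) E_def G_def)
  also have "\<dots> = D X (\<lambda>q. \<phi> q (E q)) p + D X (\<lambda>q. G q *\<^sub>R \<xi> q) p"
    by (rule D_add_right[OF W X(1) phi_smooth[OF W(1) E] Gxi])
  also have "\<dots> = \<phi> p (D X E p) + g p (X p) (E p) *\<^sub>R \<xi> p - \<eta> p (E p) *\<^sub>R X p
      + (X p G *\<^sub>R \<xi> p + G p *\<^sub>R (- \<phi> p (X p)))"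
    unfolding D_phi[OF W X(1) E] D_scale_right[OF W X(1) xi_smooth G] D_xi[OF W X(1)] by simp
  finally have e: "D X (D Y (J Z)) p = \<dots>" .
  define w where "w = \<phi> p (U p)"
  have w: "w \<in> T p" unfolding w_def by (rule phi_T[OF U(4)])
  have xw: "g p (\<xi> p) w = 0" using eta_phi[OF U(4)] eta_g[OF w] g_sym[OF w xi_T] by (simp add: w_def)
  have "g p (D X (D Y (J Z)) p) w = g p (\<phi> p (D X E p)) w - \<eta> p (E p) * g p (X p) w
      - G p * g p (\<phi> p (X p)) w"
    unfolding e using w xw X(4) DE xi_T phi_T
    by (simp add: g_add_left g_diff g_scale_left g_minus T_closed)
  moreover have "g p (\<phi> p (D X E p)) w = g p (D X E p) (U p)" "g p (\<phi> p (X p)) w = g p (X p) (U p)"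
    unfolding w_def using g_phi_phi[OF DE U(4)] g_phi_phi[OF X(4) U(4)] U(3) by simp_all
  moreover have "g p (X p) w = - \<Omega> p X U"
    unfolding w_def \<Omega>_def using phi_skew[OF X(4) U(4)] by simp
  moreover have "\<eta> p (E p) = \<Omega> p Y Z" unfolding E_def by (rule eta_D[OF W H(2,3)])
  ultimately show ?thesis by (simp add: w_def E_def G_def)
qed

text \<open>Antisymmetrise \<open>second_derivative_J\<close>. The bracket term of the curvature
  adds no correction: its Sasakian defect is a multiple of \<xi>, which is orthogonal to \<phi>
  U.\<close>

lemma Rm4_J:
  assumes W: "open W" "p \<in> W" and H: "X \<in> contact_fields W" "Y \<in> contact_fields W"
    "Z \<in> contact_fields W" "U \<in> contact_fields W"
  shows "Rm4 X Y (J Z) (J U) p = Rm4 X Y Z U p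
    + \<Omega> p Y Z * \<Omega> p X U - \<Omega> p X Z * \<Omega> p Y U
    - g p (Y p) (Z p) * g p (X p) (U p) + g p (X p) (Z p) * g p (Y p) (U p)"
proof -
  note X = contact_fieldsD[OF H(1)] and Y = contact_fieldsD[OF H(2)]
    and Z = contact_fieldsD[OF H(3)] and U = contact_fieldsD[OF H(4)]
  have JZ: "X_on W (J Z)" by (rule phi_smooth[OF W(1) Z(1)])
  note B = bracket_smooth[OF W(1) X(1) Y(1)]
  have tv: "X p \<in> T p" if "X_on W X" for X using smooth_vfield_tangent[OF that W(2)] .
  note ds = D_smooth[OF W(1)]
  have split: "Rm4 X Y Z V p = g p (D X (D Y Z) p) (V p) - g p (D Y (D X Z) p) (V p)
      - g p (D (lie_bracket A X Y) Z p) (V p)" if "X_on W Z" "V p \<in> T p" for Z V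
    using tv[OF ds[OF X(1) ds[OF Y(1) that(1)]]] tv[OF ds[OF Y(1) ds[OF X(1) that(1)]]]
      tv[OF ds[OF B that(1)]] that(2)
    by (simp add: Rm4_def curvature_def g_diff T_closed)
  have "g p (D (lie_bracket A X Y) (J Z) p) (\<phi> p (U p)) = g p (D (lie_bracket A X Y) Z p) (U p)"
  proof -
    have d: "D (lie_bracket A X Y) Z p \<in> T p" by (rule tv[OF ds[OF B Z(1)]])
    have w: "\<phi> p (U p) \<in> T p" by (rule phi_T[OF U(4)])
    have "g p (\<xi> p) (\<phi> p (U p)) = 0" using eta_phi[OF U(4)] eta_g[OF w] g_sym[OF w xi_T] by simp
    then show ?thesis
      unfolding D_phi[OF W B Z(1)] Z(3) using d w xi_T phi_T g_phi_phi[OF d U(4)] U(3)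
      by (simp add: g_add_left g_scale_left T_closed)
  qed
  then show ?thesis
    unfolding split[OF JZ, of "J U", OF phi_T[OF U(4)]] split[OF Z(1), of U, OF U(4)]
    using second_derivative_J[OF W H] second_derivative_J[OF W H(2,1,3,4)] by simp
qed

lemma space_form_sectional:
  assumes sf: "sasakian_space_form A \<phi> \<xi> \<eta> g D c"
    and W: "open W" "p \<in> W" and H: "X \<in> contact_fields W" "Y \<in> contact_fields W"
    and o: "g p (X p) (Y p) = 0" "g p (X p) (\<phi> p (Y p)) = 0"
  shows "Rm4 X Y Y X p = (c + 3) / 4 * (g p (X p) (X p) * g p (Y p) (Y p))"
proof -
  \<comment> \<open>On fields orthogonal to \<open>\<xi>\<close>, \<open>- P\<close> is the curvature of the space form with \<open>c = -3\<close>;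
    subtracting it from \<open>Rm4\<close> leaves a tensor with the symmetries of a Kaehler curvature tensor.\<close>
  define P where "P X Y Z U = \<Omega> p Y Z * \<Omega> p X U - \<Omega> p X Z * \<Omega> p Y U - 2 * \<Omega> p X Y * \<Omega> p Z U" for X Y Z U
  define S where "S X Y Z U = Rm4 X Y Z U p + P X Y Z U" for X Y Z U
  let ?H = "contact_fields W"
  note sm = contact_fieldsD(1) and tv = contact_fieldsD(4)
  have \<Omega>1: "\<Omega> p (X + X') Z = \<Omega> p X Z + \<Omega> p X' Z" "\<Omega> p (- X) Z = - \<Omega> p X Z"
    if "X \<in> ?H" "X' \<in> ?H" "Z \<in> ?H" for X X' Z
    using tv[OF that(1)] tv[OF that(2)] tv[OF that(3)] phi_T
    by (simp_all add: \<Omega>_def phi_add phi_minus g_add_left g_minus)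
  have \<Omega>JJ: "\<Omega> p (J X) (J Y) = \<Omega> p X Y" "\<Omega> p X (J Y) = g p (X p) (Y p)"
    "\<Omega> p (J X) Y = - g p (X p) (Y p)" if "X \<in> ?H" "Y \<in> ?H" for X Y
    using tv[OF that(1)] tv[OF that(2)] phi_T contact_fieldsD(3)[OF that(1)] contact_fieldsD(3)[OF that(2)]
      phi_skew[OF tv[OF that(1)] tv[OF that(2)]]
    by (simp_all add: \<Omega>_def g_phi_phi phi_phi g_minus eta_phi)
  have \<Omega>s: "\<Omega> p Y X = - \<Omega> p X Y" if "X \<in> ?H" "Y \<in> ?H" for X Y by (rule \<Omega>_skew[OF that])
  have "S X Y Y X = (c + 3) / 4 * (g p (X p) (X p) * g p (Y p) (Y p))"
  proof (rule kaehler_sectional[where H = ?H and J = J and n = "\<lambda>X. g p (X p) (X p)" and S = S,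
        OF contact_fields_subspace])
    show "J X \<in> ?H" if "X \<in> ?H" for X by (rule J_contact[OF W(1) that])
    show "J (X + Y) = J X + J Y" if "X \<in> ?H" "Y \<in> ?H" for X Y
      by (rule ext) (simp add: phi_add tv[OF that(1)] tv[OF that(2)])
    show "J (- X) = - J X" if "X \<in> ?H" for X
      by (rule ext) (simp add: phi_minus tv[OF that])
    show "J (J X) = - X" if "X \<in> ?H" for X by (rule J_J[OF that])
    show "S (X + X') Y Z U = S X Y Z U + S X' Y Z U"
      if h: "X \<in> ?H" "X' \<in> ?H" "Y \<in> ?H" "Z \<in> ?H" "U \<in> ?H" for X X' Y Z U
    proof -
      have "(\<lambda>q. X q + X' q) = X + X'" by (rule ext) simp
      then have "Rm4 (X + X') Y Z U p = Rm4 X Y Z U p + Rm4 X' Y Z U p"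
        using Rm4_add1[OF W h[THEN sm]] by simp
      then show ?thesis
        by (simp only: S_def P_def \<Omega>1(1)[OF h(1,2,3)] \<Omega>1(1)[OF h(1,2,4)] \<Omega>1(1)[OF h(1,2,5)])
          (simp add: algebra_simps)
    qed
    show "S (- X) Y Z U = - S X Y Z U"
      if h: "X \<in> ?H" "Y \<in> ?H" "Z \<in> ?H" "U \<in> ?H" for X Y Z U
    proof -
      have "(\<lambda>q. (-1) *\<^sub>R X q) = - X" by (rule ext) simp
      then have "Rm4 (- X) Y Z U p = - Rm4 X Y Z U p"
        using Rm4_cscale1[OF W h[THEN sm], of "-1"] by simp
      then show ?thesis
        by (simp add: S_def P_def \<Omega>1(2)[OF h(1,1,2)] \<Omega>1(2)[OF h(1,1,3)] \<Omega>1(2)[OF h(1,1,4)])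
    qed
    show "S Y X Z U = - S X Y Z U"
      if h: "X \<in> ?H" "Y \<in> ?H" "Z \<in> ?H" "U \<in> ?H" for X Y Z U
      using Rm4_skew12[OF W h[THEN sm]] \<Omega>s[OF h(1,2)] by (simp add: S_def P_def algebra_simps)
    show "S Z U X Y = S X Y Z U"
      if h: "X \<in> ?H" "Y \<in> ?H" "Z \<in> ?H" "U \<in> ?H" for X Y Z U
      using Rm4_pair[OF W h[THEN sm]] \<Omega>s[OF h(1,3)] \<Omega>s[OF h(1,4)] \<Omega>s[OF h(2,3)] \<Omega>s[OF h(2,4)]
      by (simp add: S_def P_def algebra_simps)
    \<comment> \<open>The first two summands of \<open>P\<close> contribute twice the cyclic sum of
      \<Omega>(X, Y) \<Omega>(Z, U); the coefficient 2 in the third cancels it.\<close>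
    show "S X Y Z U + S Y Z X U + S Z X Y U = 0"
      if h: "X \<in> ?H" "Y \<in> ?H" "Z \<in> ?H" "U \<in> ?H" for X Y Z U
      using Rm4_bianchi[OF W h[THEN sm]] \<Omega>s[OF h(1,2)] \<Omega>s[OF h(1,3)] \<Omega>s[OF h(2,3)]
      by (simp add: S_def P_def algebra_simps)
    \<comment> \<open>The third summand of \<open>P\<close> is invariant under \<open>J\<close>, and
      the change of the first two is the negative of the correction in \<open>Rm4_J\<close>.\<close>
    show "S X Y (J Z) (J U) = S X Y Z U"
      if h: "X \<in> ?H" "Y \<in> ?H" "Z \<in> ?H" "U \<in> ?H" for X Y Z U
      using Rm4_J[OF W h] by (simp add: S_def P_def \<Omega>JJ h)
    \<comment> \<open>Here c becomes c + 3: P X (J X) (J X) X is three times the squared value of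
      g(X, X), one part coming from the second summand and two from the third.\<close>
    show "S X (J X) (J X) X = (c + 3) * (g p (X p) (X p))\<^sup>2" if h: "X \<in> ?H" for X
    proof -
      have JX: "J X \<in> ?H" by (rule J_contact[OF W(1) h])
      have "Rm4 X (J X) (J X) X p = c * (g p (X p) (X p))\<^sup>2"
      \<comment> \<open>The space form condition speaks only of points where the field is nonzero,
        whereas this claim covers all contact fields.\<close>
      proof (cases "X p = 0")
        case True
        then show ?thesis
          using g_zero(2)[OF Rm_T[OF W sm[OF h] sm[OF JX] sm[OF JX]]] g_zero(2)[OF T_closed(3)]
          by (simp add: Rm4_def)
      next
        case False
        have "g p (X p) (\<xi> p) = 0" using contact_fieldsD(3,4)[OF h] eta_g by metis
        then have "sectional_curvature A g D X (J X) p = c"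
          using sf False W sm[OF h] unfolding sasakian_space_form_def by blast
        moreover have "g p (X p) (X p) > 0"
          using metric tv[OF h] False unfolding riemannian_metric_def by blast
        moreover have "g p (X p) (\<phi> p (X p)) = 0"
          using phi_skew[OF tv[OF h] tv[OF h]] g_sym[OF tv[OF h] phi_T[OF tv[OF h]]] by simp
        moreover have "g p (\<phi> p (X p)) (\<phi> p (X p)) = g p (X p) (X p)"
          using g_phi_phi[OF tv[OF h] tv[OF h]] contact_fieldsD(3)[OF h] by simp
        ultimately show ?thesis
          by (simp add: sectional_curvature_def Rm4_def power2_eq_square field_simps)
      qed
      moreover have "\<Omega> p (J X) (J X) = 0" using \<Omega>s[OF JX JX] by simp
      ultimately show ?thesis
        using \<Omega>JJ(2,3)[OF h h] by (simp add: S_def P_def power2_eq_square algebra_simps)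
    qed
    note XT = tv[OF H(1)] and YT = tv[OF H(2)]
    have o': "g p (Y p) (X p) = 0" "g p (\<phi> p (Y p)) (X p) = 0"
      using o g_sym[OF XT YT] g_sym[OF XT phi_T[OF YT]] by simp_all
    \<comment> \<open>Orthogonality of X to Y and to \<phi> Y makes squared lengths additive, as
      \<open>kaehler_sectional\<close> demands of \<open>n\<close>.\<close>
    have "g p (\<phi> p (Y p)) (\<phi> p (Y p)) = g p (Y p) (Y p)"
      using g_phi_phi[OF YT YT] contact_fieldsD(3)[OF H(2)] by simp
    then show "g p ((X + Y) p) ((X + Y) p) = g p (X p) (X p) + g p (Y p) (Y p)"
      "g p ((X + - Y) p) ((X + - Y) p) = g p (X p) (X p) + g p (Y p) (Y p)"
      "g p ((X + J Y) p) ((X + J Y) p) = g p (X p) (X p) + g p (Y p) (Y p)"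
      "g p ((X + - J Y) p) ((X + - J Y) p) = g p (X p) (X p) + g p (Y p) (Y p)"
      "g p (\<phi> p (Y p)) (\<phi> p (Y p)) = g p (Y p) (Y p)"
      using XT YT phi_T o o'
      by (simp_all add: g_add_left g_add_right g_diff g_minus T_closed)
  qed (rule H)+
  \<comment> \<open>The totally real condition is \<Omega>(X, Y) = 0, so on this plane the
    correction disappears and \<open>S\<close> agrees with \<open>Rm4\<close>.\<close>
  moreover have "P X Y Y X = 0"
  proof -
    have "\<Omega> p X Y = 0" unfolding \<Omega>_def using phi_skew[OF tv[OF H(1)] tv[OF H(2)]] o by simp
    moreover have "\<Omega> p Y Y = 0" "\<Omega> p X X = 0" using \<Omega>s[OF H(2,2)] \<Omega>s[OF H(1,1)] by simp_all
    ultimately show ?thesis by (simp add: P_def)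
  qed
  ultimately show ?thesis by (simp add: S_def)
qed

end

section \<open>Extending fields along an immersion\<close>

text \<open>\<open>totally_geodesic\<close> speaks only of fields with ambient extensions, and the
  curvature involves several fields at once; hence \<open>W0\<close> and \<open>W'\<close> are fixed
  before \<open>X\<close>. The composite of \<open>y\<close>, \<open>L\<close> and
  \<open>\<sigma>\<close> is a smooth map back to coordinates on the source that inverts \<psi> on
  \<open>W0\<close>. The extension at a point takes the components of the pushforward of
  \<open>X\<close> computed at the coordinates so obtained.\<close>

lemma immersion_extension:
  fixes A :: "('p::{t2_space, second_countable_topology}, 'e::euclidean_space) atlas"
    and B :: "('r::{t2_space, second_countable_topology}, 'm::euclidean_space) atlas"
  assumes A: "smooth_atlas A" and B: "smooth_atlas B" and \<psi>: "smooth_map A B \<psi>"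
    and inj: "inj_on (pushforward B \<psi> p) (tangent_space A p)"
    and W: "open W" "p \<in> W"
  obtains W0 W' where "open W0" "p \<in> W0" "W0 \<subseteq> W"
    "\<And>X. smooth_vfield_on A W X \<Longrightarrow> \<exists>X'. extends_field B \<psi> W0 X W' X'"
proof -
  obtain U x where U: "(U, x) \<in> A" "p \<in> U" by (rule chart_at[OF A])
  obtain V y where V: "(V, y) \<in> B" "\<psi> p \<in> V" by (rule chart_at[OF B])
  define S where "S = x ` (U \<inter> (W \<inter> \<psi> -` V))"
  have S: "open S"
    unfolding S_def
    by (intro chart_open_image[OF A U(1)] open_Int W smooth_map_open_preimage[OF \<psi> chart_open[OF B V(1)]])
  have xp: "x p \<in> S" using U V W by (auto simp: S_def)
  define \<Psi> where "\<Psi> = y \<circ> \<psi> \<circ> inv_into U x"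
  have \<Psi>: "smooth_on S \<Psi>"
    unfolding \<Psi>_def S_def by (rule smooth_on_subset[OF smooth_mapD[OF \<psi> U(1) V(1)]]) auto
  define d where "d a = frechet_derivative \<Psi> (at a)" for a
  have ld: "linear (d a)" if "a \<in> S" for a
    unfolding d_def by (rule linear_frechet_derivative[OF smooth_on_differentiable[OF \<Psi> that]])
  have "inj (d (x p))"
  proof (rule injI)
    fix e e' assume "d (x p) e = d (x p) e'"
    then have "pushforward B \<psi> p (coord_vec A (U, x) p e) = pushforward B \<psi> p (coord_vec A (U, x) p e')"
      unfolding pushforward_coord_vec[OF A B \<psi> U V] by (simp add: d_def \<Psi>_def)
    then have "coord_vec A (U, x) p e = coord_vec A (U, x) p e'"
      by (rule inj_onD[OF inj _ coord_vec_tangent[OF U] coord_vec_tangent[OF U]])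
    then show "e = e'" by (rule coord_vec_inj[OF A U])
  qed
  \<comment> \<open>\<open>L \<circ> y\<close> is a submersion near \<open>\<psi> p\<close> that turns \<open>\<psi>\<close> into a local diffeomorphism of the model space\<close>
  then obtain L where L: "linear L" "L \<circ> d (x p) = id"
    using linear_injective_left_inverse[OF ld[OF xp]] by blast
  have bL: "bounded_linear L" using L(1) by (simp add: linear_conv_bounded_linear)
  define \<Phi> where "\<Phi> a = L (\<Psi> a)" for a
  have \<Phi>: "smooth_on S \<Phi>" unfolding \<Phi>_def by (rule smooth_on_linear[OF S bL \<Psi>])
  have "(\<Phi> has_derivative (\<lambda>u. L (d (x p) u))) (at (x p))"
    unfolding \<Phi>_def d_def by (rule bounded_linear.has_derivative[OF bL smooth_on_has_derivative[OF \<Psi> xp]])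
  from frechet_derivative_at[OF this, symmetric] have id: "frechet_derivative \<Phi> (at (x p)) u = u" for u
    using L(2) by (simp add: fun_eq_iff)
  obtain S' V' \<sigma> where S': "open S'" "S' \<subseteq> S" "x p \<in> S'" and V': "open V'"
    and hom: "homeomorphism S' V' \<Phi> \<sigma>" and \<sigma>: "smooth_on V' \<sigma>"
    by (rule smooth_inverse_function[OF S \<Phi> xp id])
  define W0 where "W0 = U \<inter> x -` S'"
  define W' where "W' = V \<inter> (\<lambda>r. L (y r)) -` V'"
  have SU: "x q \<in> S \<Longrightarrow> q \<in> U \<Longrightarrow> q \<in> W \<and> \<psi> q \<in> V" for q
    unfolding S_def using chart_inj[OF A U(1)] by (auto dest: inj_onD)
  have W0: "open W0" "p \<in> W0" "W0 \<subseteq> W"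
    unfolding W0_def
    using continuous_open_preimage[OF chart_cont[OF A U(1)] chart_open[OF A U(1)] S'(1)] U(2) S' SU by auto
  have oW': "open W'"
    unfolding W'_def
    by (rule continuous_open_preimage[OF _ chart_open[OF B V(1)] V'])
      (rule bounded_linear.continuous_on[OF bL chart_cont[OF B V(1)]])
  have \<Psi>x: "\<Psi> (x q) = y (\<psi> q)" if "q \<in> W0" for q
    using that chart_inv[OF A U(1)] by (simp add: \<Psi>_def W0_def)
  have inv: "L (y (\<psi> q)) \<in> V'" "\<sigma> (L (y (\<psi> q))) = x q" if "q \<in> W0" for q
  proof -
    have "x q \<in> S'" using that by (simp add: W0_def)
    then have "\<Phi> (x q) \<in> V'" "\<sigma> (\<Phi> (x q)) = x q" using hom by (auto simp: homeomorphism_def)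
    then show "L (y (\<psi> q)) \<in> V'" "\<sigma> (L (y (\<psi> q))) = x q" by (simp_all add: \<Phi>_def \<Psi>x[OF that])
  qed
  have im: "\<psi> ` W0 \<subseteq> W'"
    using inv(1) SU S'(2) by (auto simp: W'_def W0_def)
  have ext: "\<exists>X'. extends_field B \<psi> W0 X W' X'" if X: "smooth_vfield_on A W X" for X
  proof -
    obtain \<epsilon> where \<epsilon>: "smooth_on (x ` (U \<inter> W)) \<epsilon>"
      and Xe: "\<And>q. q \<in> U \<inter> W \<Longrightarrow> X q = coord_vec A (U, x) q (\<epsilon> (x q))"
      using smooth_vfield_components[OF A X W(1) U(1)] by blast
    \<comment> \<open>\<open>\<tau>\<close> leads from ambient coordinates back to those of the
      submanifold, so \<open>\<epsilon>'\<close> makes sense off the image of \<psi> as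
      well.\<close>
    define \<tau> where "\<tau> t = \<sigma> (L t)" for t
    define \<epsilon>' where "\<epsilon>' t = d (\<tau> t) (\<epsilon> (\<tau> t))" for t
    define X' where "X' r = coord_vec B (V, y) r (\<epsilon>' (y r))" for r
    define R where "R = y ` (V \<inter> W')"
    have R: "open R" unfolding R_def by (rule chart_open_image[OF B V(1) oW'])
    have LR: "L ` R \<subseteq> V'" by (auto simp: R_def W'_def)
    have \<tau>: "smooth_on R \<tau>"
      unfolding \<tau>_def by (rule smooth_on_compose[OF R V' smooth_on_linear[OF R bL smooth_on_id[OF R]] \<sigma> LR])
    have \<tau>R: "\<tau> ` R \<subseteq> S'"
      using LR hom by (auto simp: \<tau>_def homeomorphism_def)
    have \<tau>S: "\<tau> ` R \<subseteq> S" using \<tau>R S'(2) by blast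
    have SW: "S \<subseteq> x ` (U \<inter> W)" by (auto simp: S_def)
    have "smooth_on R \<epsilon>'"
      unfolding \<epsilon>'_def
    proof (rule smooth_on_linear_family[OF R, where A = "\<lambda>t. d (\<tau> t)" and w = "\<lambda>t. \<epsilon> (\<tau> t)"])
      show "linear (d (\<tau> t))" if "t \<in> R" for t using ld \<tau>S that by blast
      show "smooth_on R (\<lambda>t. d (\<tau> t) b)" for b
        unfolding d_def by (rule smooth_on_compose[OF R S \<tau> smooth_on_frechet[OF \<Psi>] \<tau>S])
      show "smooth_on R (\<lambda>t. \<epsilon> (\<tau> t))"
        by (rule smooth_on_compose[OF R S \<tau> smooth_on_subset[OF \<epsilon> SW] \<tau>S])
    qed
    have "smooth_vfield_on B W' X'"
    proof (rule smooth_vfieldI[OF B])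
      fix r assume r: "r \<in> W'"
      have "smooth_on (y ` (V \<inter> W')) \<epsilon>' \<and> (\<forall>q\<in>V \<inter> W'. X' q = coord_vec B (V, y) q (\<epsilon>' (y q)))"
        using \<open>smooth_on R \<epsilon>'\<close> by (simp add: R_def X'_def)
      then show "\<exists>V y W0 \<epsilon>. (V, y) \<in> B \<and> r \<in> V \<and> open W0 \<and> r \<in> W0 \<and>
          smooth_on (y ` (V \<inter> W0)) \<epsilon> \<and> (\<forall>q\<in>V \<inter> W0. X' q = coord_vec B (V, y) q (\<epsilon> (y q)))"
        using V(1) oW' r unfolding W'_def by blast
    qed
    moreover have "X' (\<psi> q) = pushforward B \<psi> q (X q)" if q: "q \<in> W0" for q
    proof -
      have q': "q \<in> U" "q \<in> W" "\<psi> q \<in> V" using q SU S'(2) by (auto simp: W0_def)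
      show ?thesis
        using q' inv(2)[OF q] Xe[of q] pushforward_coord_vec[OF A B \<psi> U(1) q'(1) V(1) q'(3)]
        by (simp add: X'_def \<epsilon>'_def \<tau>_def d_def \<Psi>_def)
    qed
    ultimately show ?thesis unfolding extends_field_def using oW' im by blast
  qed
  show ?thesis by (rule that[OF W0 ext])
qed

text \<open>Keep the components of \<open>v\<close> constant throughout a chart.\<close>

lemma exists_field:
  assumes A: "smooth_atlas A" and v: "v \<in> tangent_space A p"
  obtains W X where "open W" "p \<in> W" "smooth_vfield_on A W X" "X p = v"
proof -
  obtain U x e where U: "(U, x) \<in> A" "p \<in> U" and v: "v = coord_vec A (U, x) p e"
    using v unfolding tangent_space_def by blast
  show ?thesis
  proof (rule that[OF chart_open[OF A U(1)] U(2)])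
    show "smooth_vfield_on A U (\<lambda>q. coord_vec A (U, x) q e)"
    proof (rule smooth_vfieldI[OF A])
      fix q assume "q \<in> U"
      then show "\<exists>V y W0 \<epsilon>. (V, y) \<in> A \<and> q \<in> V \<and> open W0 \<and> q \<in> W0 \<and> smooth_on (y ` (V \<inter> W0)) \<epsilon> \<and>
          (\<forall>r\<in>V \<inter> W0. coord_vec A (U, x) r e = coord_vec A (V, y) r (\<epsilon> (y r)))"
        using U smooth_on_const[of "x ` (U \<inter> UNIV)" e] by blast
    qed
  qed (simp add: v)
qed

lemma exists_local_field:
  assumes A: "smooth_atlas A" and W: "open W" "p \<in> W" and v: "v \<in> tangent_space A p"
  obtains W1 X where "open W1" "p \<in> W1" "W1 \<subseteq> W" "smooth_vfield_on A W1 X" "X p = v"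
proof -
  obtain W1 X where 1: "open W1" "p \<in> W1" "smooth_vfield_on A W1 X" "X p = v"
    using exists_field[OF A v] by metis
  show ?thesis
    by (rule that[of "W \<inter> W1" X]) (use 1 W smooth_vfield_subset[OF 1(3)] in auto)
qed

section \<open>Product manifolds\<close>

lemma smooth_on_fst: "open S \<Longrightarrow> open T \<Longrightarrow> smooth_on S h \<Longrightarrow> smooth_on (S \<times> T) (\<lambda>z. h (fst z))"
  for S :: "'x::euclidean_space set" and T :: "'y::euclidean_space set"
  by (rule smooth_on_compose[OF open_Times _ smooth_on_linear[OF open_Times bounded_linear_fst smooth_on_id[OF open_Times]]])
    auto

lemma smooth_on_snd: "open S \<Longrightarrow> open T \<Longrightarrow> smooth_on T h \<Longrightarrow> smooth_on (S \<times> T) (\<lambda>z. h (snd z))"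
  for S :: "'x::euclidean_space set" and T :: "'y::euclidean_space set"
  by (rule smooth_on_compose[OF open_Times _ smooth_on_linear[OF open_Times bounded_linear_snd smooth_on_id[OF open_Times]]])
    auto

locale product_manifold =
  fixes B :: "('p::{t2_space, second_countable_topology}, 'b::euclidean_space) atlas"
    and F :: "('q::{t2_space, second_countable_topology}, 'f::euclidean_space) atlas"
  assumes B: "smooth_atlas B" and F: "smooth_atlas F"
begin

abbreviation M :: "('p \<times> 'q, 'b \<times> 'f) atlas" where "M \<equiv> product_atlas B F"

lemma product_chart: "(U, x) \<in> B \<Longrightarrow> (V, y) \<in> F \<Longrightarrow> (U \<times> V, map_prod x y) \<in> M"
  unfolding product_atlas_def by blast

lemma product_chartE:
  assumes "(N, z) \<in> M"
  obtains U x V y where "(U, x) \<in> B" "(V, y) \<in> F" "N = U \<times> V" "z = map_prod x y"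
  using assms unfolding product_atlas_def by blast

lemma product_chart_inv:
  assumes c: "(U, x) \<in> B" "(V, y) \<in> F" and ab: "a \<in> x ` U" "b \<in> y ` V"
  shows "inv_into (U \<times> V) (map_prod x y) (a, b) = (inv_into U x a, inv_into V y b)"
proof -
  obtain p q where p: "p \<in> U" "a = x p" "q \<in> V" "b = y q" using ab by blast
  have "inj_on (map_prod x y) (U \<times> V)"
    by (rule map_prod_inj_on[OF chart_inj[OF B c(1)] chart_inj[OF F c(2)]])
  then have "inv_into (U \<times> V) (map_prod x y) (map_prod x y (p, q)) = (p, q)"
    by (rule inv_into_f_f) (use p in auto)
  then show ?thesis using p chart_inv[OF B c(1)] chart_inv[OF F c(2)] by simp
qed

lemma product_smooth_atlas: "smooth_atlas M"
  unfolding smooth_atlas_def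
proof (intro conjI)
  have inj: "inj_on (map_prod x y) (U \<times> V)" if "(U, x) \<in> B" "(V, y) \<in> F" for U x V y
    by (rule map_prod_inj_on[OF chart_inj[OF B that(1)] chart_inj[OF F that(2)]])
  show "\<forall>c\<in>M. is_chart c"
  proof
    fix c assume "c \<in> M"
    then obtain U x V y where c: "(U, x) \<in> B" "(V, y) \<in> F" "c = (U \<times> V, map_prod x y)"
      unfolding product_atlas_def by blast
    have hx: "homeomorphism U (x ` U) x (inv_into U x)" "open (x ` U)"
      using B c(1) unfolding smooth_atlas_def is_chart_def by auto
    have hy: "homeomorphism V (y ` V) y (inv_into V y)" "open (y ` V)"
      using F c(2) unfolding smooth_atlas_def is_chart_def by auto
    let ?z = "map_prod x y"
    have im: "?z ` (U \<times> V) = x ` U \<times> y ` V" by auto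
    have cont: "continuous_on (U \<times> V) ?z"
      unfolding map_prod_def case_prod_unfold
      using hx(1) hy(1)
      by (intro continuous_on_Pair continuous_on_compose2[OF _ continuous_on_fst[OF continuous_on_id]]
          continuous_on_compose2[OF _ continuous_on_snd[OF continuous_on_id]])
        (auto simp: homeomorphism_def)
    have "continuous_on (x ` U \<times> y ` V) (\<lambda>z. (inv_into U x (fst z), inv_into V y (snd z)))"
      using hx(1) hy(1)
      by (intro continuous_on_Pair continuous_on_compose2[OF _ continuous_on_fst[OF continuous_on_id]]
          continuous_on_compose2[OF _ continuous_on_snd[OF continuous_on_id]])
        (auto simp: homeomorphism_def)
    then have "continuous_on (x ` U \<times> y ` V) (inv_into (U \<times> V) ?z)"
      by (rule continuous_on_eq) (auto simp: product_chart_inv[OF c(1,2)])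
    then have "homeomorphism (U \<times> V) (?z ` (U \<times> V)) ?z (inv_into (U \<times> V) ?z)"
      using cont inj[OF c(1,2)] unfolding im
      by (auto simp: homeomorphism_def product_chart_inv[OF c(1,2)] chart_inv[OF B c(1)] chart_inv[OF F c(2)]
          image_iff) (force simp: chart_inv[OF B c(1)] chart_inv[OF F c(2)] product_chart_inv[OF c(1,2)])+
    then show "is_chart c"
      unfolding is_chart_def c(3)
      using hx(2) hy(2) chart_open[OF B c(1)] chart_open[OF F c(2)] by (simp add: im open_Times)
  qed
  show "(\<Union>(U, x)\<in>M. U) = UNIV"
  proof -
    have "z \<in> (\<Union>(U, x)\<in>M. U)" for z
    proof -
      obtain U x where U: "(U, x) \<in> B" "fst z \<in> U" by (rule chart_at[OF B])
      obtain V y where V: "(V, y) \<in> F" "snd z \<in> V" by (rule chart_at[OF F])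
      show ?thesis using product_chart[OF U(1) V(1)] U(2) V(2) 
        by (auto simp: mem_Times_iff intro!: bexI[of _ "(U \<times> V, map_prod x y)"])
    qed
    then show ?thesis by blast
  qed
  show "\<forall>(N, z)\<in>M. \<forall>(N', z')\<in>M. smooth_on (z ` (N \<inter> N')) (z' \<circ> inv_into N z)"
  proof clarify
    fix N z N' z' assume "(N, z) \<in> M" "(N', z') \<in> M"
    then obtain U x V y U' x' V' y' where c: "(U, x) \<in> B" "(V, y) \<in> F" and e: "N = U \<times> V" "z = map_prod x y"
      and c': "(U', x') \<in> B" "(V', y') \<in> F" and e': "N' = U' \<times> V'" "z' = map_prod x' y'"
      by (metis product_chartE)
    have im: "z ` (N \<inter> N') = x ` (U \<inter> U') \<times> y ` (V \<inter> V')" unfolding e e' by auto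
    have o: "open (x ` (U \<inter> U'))" "open (y ` (V \<inter> V'))"
      by (rule chart_open_image[OF B c(1) chart_open[OF B c'(1)]] chart_open_image[OF F c(2) chart_open[OF F c'(2)]])+
    show "smooth_on (z ` (N \<inter> N')) (z' \<circ> inv_into N z)"
      unfolding im
    proof (rule smooth_on_transform[OF smooth_on_Pair[OF open_Times[OF o]
          smooth_on_fst[OF o chart_transition[OF B c(1) c'(1)]]
          smooth_on_snd[OF o chart_transition[OF F c(2) c'(2)]]] open_Times[OF o]])
      fix w assume "w \<in> x ` (U \<inter> U') \<times> y ` (V \<inter> V')"
      then show "((x' \<circ> inv_into U x) (fst w), (y' \<circ> inv_into V y) (snd w)) = (z' \<circ> inv_into N z) w"
        by (cases w) (auto simp: e e' product_chart_inv[OF c])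
    qed
  qed
qed

lemma smooth_map_fst: "smooth_map M B fst"
  unfolding smooth_map_def
proof (intro conjI, goal_cases)
  case 1 show ?case by (intro continuous_on_fst continuous_on_id)
next
  case 2
  show ?case
  proof clarify
    fix N z U' x' assume "(N, z) \<in> M" and c': "(U', x') \<in> B"
    then obtain U x V y where c: "(U, x) \<in> B" "(V, y) \<in> F" and e: "N = U \<times> V" "z = map_prod x y"
      by (metis product_chartE)
    have im: "z ` (N \<inter> fst -` U') = x ` (U \<inter> U') \<times> y ` (V \<inter> UNIV)" unfolding e by auto
    have o: "open (x ` (U \<inter> U'))" "open (y ` (V \<inter> UNIV))"
      by (rule chart_open_image[OF B c(1) chart_open[OF B c']] chart_open_image[OF F c(2) open_UNIV])+
    show "smooth_on (z ` (N \<inter> fst -` U')) (x' \<circ> fst \<circ> inv_into N z)"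
      unfolding im
    proof (rule smooth_on_transform[OF smooth_on_fst[OF o chart_transition[OF B c(1) c']] open_Times[OF o]])
      fix w assume "w \<in> x ` (U \<inter> U') \<times> y ` (V \<inter> UNIV)"
      then show "(x' \<circ> inv_into U x) (fst w) = (x' \<circ> fst \<circ> inv_into N z) w"
        by (cases w) (auto simp: e product_chart_inv[OF c])
    qed
  qed
qed

lemma smooth_map_snd: "smooth_map M F snd"
  unfolding smooth_map_def
proof (intro conjI, goal_cases)
  case 1 show ?case by (intro continuous_on_snd continuous_on_id)
next
  case 2
  show ?case
  proof clarify
    fix N z V' y' assume "(N, z) \<in> M" and c': "(V', y') \<in> F"
    then obtain U x V y where c: "(U, x) \<in> B" "(V, y) \<in> F" and e: "N = U \<times> V" "z = map_prod x y"
      by (metis product_chartE)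
    have im: "z ` (N \<inter> snd -` V') = x ` (U \<inter> UNIV) \<times> y ` (V \<inter> V')" unfolding e by auto
    have o: "open (x ` (U \<inter> UNIV))" "open (y ` (V \<inter> V'))"
      by (rule chart_open_image[OF B c(1) open_UNIV] chart_open_image[OF F c(2) chart_open[OF F c']])+
    show "smooth_on (z ` (N \<inter> snd -` V')) (y' \<circ> snd \<circ> inv_into N z)"
      unfolding im
    proof (rule smooth_on_transform[OF smooth_on_snd[OF o chart_transition[OF F c(2) c']] open_Times[OF o]])
      fix w assume "w \<in> x ` (U \<inter> UNIV) \<times> y ` (V \<inter> V')"
      then show "(y' \<circ> inv_into V y) (snd w) = (y' \<circ> snd \<circ> inv_into N z) w"
        by (cases w) (auto simp: e product_chart_inv[OF c])
    qed
  qed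
qed

text \<open>The slices carry tangent vectors of a factor into the product; \<open>hor\<close> and
  \<open>ver\<close> are pushforwards along them.\<close>

lemma smooth_map_slice1: "smooth_map B M (\<lambda>b. (b, q))"
  unfolding smooth_map_def
proof (intro conjI, goal_cases)
  case 1 show ?case by (intro continuous_on_Pair continuous_on_id continuous_on_const)
next
  case 2
  show ?case
  proof clarify
    fix U' x' N z assume c': "(U', x') \<in> B" and "(N, z) \<in> M"
    then obtain U x V y where c: "(U, x) \<in> B" "(V, y) \<in> F" and e: "N = U \<times> V" "z = map_prod x y"
      by (metis product_chartE)
    let ?S = "x' ` (U' \<inter> (\<lambda>b. (b, q)) -` N)"
    have S: "?S \<subseteq> x' ` (U' \<inter> U)" unfolding e by auto
    have o: "open ?S"
      by (rule chart_open_image[OF B c'])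
        (cases "q \<in> V"; simp add: e vimage_def chart_open[OF B c(1)])
    show "smooth_on ?S (z \<circ> (\<lambda>b. (b, q)) \<circ> inv_into U' x')"
      by (rule smooth_on_transform[OF smooth_on_Pair[OF o
            smooth_on_subset[OF chart_transition[OF B c' c(1)] S] smooth_on_const[of _ "y q"]] o])
        (simp add: e)
  qed
qed

lemma smooth_map_slice2: "smooth_map F M (\<lambda>q. (b, q))"
  unfolding smooth_map_def
proof (intro conjI, goal_cases)
  case 1 show ?case by (intro continuous_on_Pair continuous_on_id continuous_on_const)
next
  case 2
  show ?case
  proof clarify
    fix V' y' N z assume c': "(V', y') \<in> F" and "(N, z) \<in> M"
    then obtain U x V y where c: "(U, x) \<in> B" "(V, y) \<in> F" and e: "N = U \<times> V" "z = map_prod x y"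
      by (metis product_chartE)
    let ?S = "y' ` (V' \<inter> (\<lambda>q. (b, q)) -` N)"
    have S: "?S \<subseteq> y' ` (V' \<inter> V)" unfolding e by auto
    have o: "open ?S"
      by (rule chart_open_image[OF F c'])
        (cases "b \<in> U"; simp add: e vimage_def chart_open[OF F c(2)])
    show "smooth_on ?S (z \<circ> (\<lambda>q. (b, q)) \<circ> inv_into V' y')"
      by (rule smooth_on_transform[OF smooth_on_Pair[OF o smooth_on_const[of _ "x b"]
            smooth_on_subset[OF chart_transition[OF F c' c(2)] S]] o])
        (simp add: e)
  qed
qed

text \<open>As a pushforward along a slice, the lift is tangent by the general theory and has the
  default value 0 on functions that are not smooth at \<open>z\<close>.\<close>

definition hor :: "'p vfield \<Rightarrow> ('p \<times> 'q) vfield" where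
  "hor X z = pushforward M (\<lambda>b. (b, snd z)) (fst z) (X (fst z))"

definition ver :: "'q vfield \<Rightarrow> ('p \<times> 'q) vfield" where
  "ver Y z = pushforward M (\<lambda>q. (fst z, q)) (snd z) (Y (snd z))"

lemma hor_apply: "smooth_at M z h \<Longrightarrow> hor X z h = X (fst z) (\<lambda>b. h (b, snd z))"
  by (simp add: hor_def pushforward_def comp_def)

lemma ver_apply: "smooth_at M z h \<Longrightarrow> ver Y z h = Y (snd z) (\<lambda>q. h (fst z, q))"
  by (simp add: ver_def pushforward_def comp_def)

lemma hor_tangent: "X (fst z) \<in> tangent_space B (fst z) \<Longrightarrow> hor X z \<in> tangent_space M z"
  using pushforward_tangent[OF B product_smooth_atlas smooth_map_slice1, of "X (fst z)" "fst z" "snd z"]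
  by (simp add: hor_def)

lemma ver_tangent: "Y (snd z) \<in> tangent_space F (snd z) \<Longrightarrow> ver Y z \<in> tangent_space M z"
  using pushforward_tangent[OF F product_smooth_atlas smooth_map_slice2, of "Y (snd z)" "snd z" "fst z"]
  by (simp add: ver_def)

lemma smooth_at_fst: "smooth_at B (fst z) h \<Longrightarrow> smooth_at M z (h \<circ> fst)"
  by (rule smooth_at_compose_map[OF product_smooth_atlas B smooth_map_fst])

lemma smooth_at_snd: "smooth_at F (snd z) h \<Longrightarrow> smooth_at M z (h \<circ> snd)"
  by (rule smooth_at_compose_map[OF product_smooth_atlas F smooth_map_snd])

lemma push_hor:
  assumes X: "X (fst z) \<in> tangent_space B (fst z)"
  shows "pushforward B fst z (hor X z) = X (fst z)" "pushforward F snd z (hor X z) = 0"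
proof -
  show "pushforward B fst z (hor X z) = X (fst z)"
  proof
    fix h show "pushforward B fst z (hor X z) h = X (fst z) h"
      using hor_apply[OF smooth_at_fst, of z h X] tangent_vec_nonsmooth[OF X, of h]
      by (cases "smooth_at B (fst z) h") (simp_all add: pushforward_def)
  qed
  show "pushforward F snd z (hor X z) = 0"
  proof
    fix h show "pushforward F snd z (hor X z) h = 0 h"
      using hor_apply[OF smooth_at_snd, of z h X] tangent_vec_const[OF B X]
      by (cases "smooth_at F (snd z) h") (simp_all add: pushforward_def)
  qed
qed

lemma push_ver:
  assumes Y: "Y (snd z) \<in> tangent_space F (snd z)"
  shows "pushforward F snd z (ver Y z) = Y (snd z)" "pushforward B fst z (ver Y z) = 0"
proof -
  show "pushforward F snd z (ver Y z) = Y (snd z)"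
  proof
    fix h show "pushforward F snd z (ver Y z) h = Y (snd z) h"
      using ver_apply[OF smooth_at_snd, of z h Y] tangent_vec_nonsmooth[OF Y, of h]
      by (cases "smooth_at F (snd z) h") (simp_all add: pushforward_def)
  qed
  show "pushforward B fst z (ver Y z) = 0"
  proof
    fix h show "pushforward B fst z (ver Y z) h = 0 h"
      using ver_apply[OF smooth_at_fst, of z h Y] tangent_vec_const[OF F Y]
      by (cases "smooth_at B (fst z) h") (simp_all add: pushforward_def)
  qed
qed

text \<open>Product charts turn slices and projections into the inclusions and projections of the
  model spaces.\<close>

lemma chart_slice_derivative:
  assumes c: "(U, x) \<in> B" "(V, y) \<in> F" and z: "z \<in> U \<times> V"
  shows "frechet_derivative (map_prod x y \<circ> (\<lambda>b. (b, snd z)) \<circ> inv_into U x) (at (x (fst z))) e = (e, 0)"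
    "frechet_derivative (map_prod x y \<circ> (\<lambda>q. (fst z, q)) \<circ> inv_into V y) (at (y (snd z))) e' = (0, e')"
    "frechet_derivative (x \<circ> fst \<circ> inv_into (U \<times> V) (map_prod x y)) (at (map_prod x y z)) w = fst w"
    "frechet_derivative (y \<circ> snd \<circ> inv_into (U \<times> V) (map_prod x y)) (at (map_prod x y z)) w = snd w"
proof -
  have o: "open (x ` U)" "open (y ` V)"
    using chart_open_image[OF B c(1) open_UNIV] chart_open_image[OF F c(2) open_UNIV] by simp_all
  have "(map_prod x y \<circ> (\<lambda>b. (b, snd z)) \<circ> inv_into U x has_derivative (\<lambda>e. (e, 0))) (at (x (fst z)))"
    by (rule has_derivative_transform_within_open[where f = "\<lambda>a. (a, y (snd z))", OF _ o(1)])
      (use z in \<open>auto intro!: derivative_eq_intros simp: chart_inv[OF B c(1)]\<close>)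
  from frechet_derivative_at[OF this, symmetric]
  show "frechet_derivative (map_prod x y \<circ> (\<lambda>b. (b, snd z)) \<circ> inv_into U x) (at (x (fst z))) e = (e, 0)"
    by simp
  have "(map_prod x y \<circ> (\<lambda>q. (fst z, q)) \<circ> inv_into V y has_derivative (\<lambda>e. (0, e))) (at (y (snd z)))"
    by (rule has_derivative_transform_within_open[where f = "\<lambda>a. (x (fst z), a)", OF _ o(2)])
      (use z in \<open>auto intro!: derivative_eq_intros simp: chart_inv[OF F c(2)]\<close>)
  from frechet_derivative_at[OF this, symmetric]
  show "frechet_derivative (map_prod x y \<circ> (\<lambda>q. (fst z, q)) \<circ> inv_into V y) (at (y (snd z))) e' = (0, e')"
    by simp
  have "(x \<circ> fst \<circ> inv_into (U \<times> V) (map_prod x y) has_derivative fst) (at (map_prod x y z))"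
    by (rule has_derivative_transform_within_open[where f = fst, OF _ open_Times[OF o]])
      (use z in \<open>auto intro!: derivative_eq_intros simp: product_chart_inv[OF c] chart_inv[OF B c(1)]\<close>)
  from frechet_derivative_at[OF this, symmetric]
  show "frechet_derivative (x \<circ> fst \<circ> inv_into (U \<times> V) (map_prod x y)) (at (map_prod x y z)) w = fst w"
    by simp
  have "(y \<circ> snd \<circ> inv_into (U \<times> V) (map_prod x y) has_derivative snd) (at (map_prod x y z))"
    by (rule has_derivative_transform_within_open[where f = snd, OF _ open_Times[OF o]])
      (use z in \<open>auto intro!: derivative_eq_intros simp: product_chart_inv[OF c] chart_inv[OF F c(2)]\<close>)
  from frechet_derivative_at[OF this, symmetric]
  show "frechet_derivative (y \<circ> snd \<circ> inv_into (U \<times> V) (map_prod x y)) (at (map_prod x y z)) w = snd w"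
    by simp
qed

text \<open>In a product chart the two differentials read off the two halves of the component
  vector. Identities between tangent vectors of the product are checked on the factors in this
  way.\<close>

lemma tangent_zeroI:
  assumes u: "u \<in> tangent_space M z" and 0: "pushforward B fst z u = 0" "pushforward F snd z u = 0"
  shows "u = 0"
proof -
  obtain U x where U: "(U, x) \<in> B" "fst z \<in> U" by (rule chart_at[OF B])
  obtain V y where V: "(V, y) \<in> F" "snd z \<in> V" by (rule chart_at[OF F])
  have z: "z \<in> U \<times> V" using U V by (simp add: mem_Times_iff)
  note c = product_chart[OF U(1) V(1)] and M = product_smooth_atlas
  obtain w where w: "u = coord_vec M (U \<times> V, map_prod x y) z w"
    using u tangent_space_chart[OF M c z] by blast
  have "coord_vec B (U, x) (fst z) (fst w) = coord_vec B (U, x) (fst z) 0"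
    using 0(1) unfolding w pushforward_coord_vec[OF M B smooth_map_fst c z U] chart_slice_derivative[OF U(1) V(1) z]
    by (simp add: linear_0[OF coord_vec_linear[OF B U]])
  then have "fst w = 0" by (rule coord_vec_inj[OF B U])
  moreover have "coord_vec F (V, y) (snd z) (snd w) = coord_vec F (V, y) (snd z) 0"
    using 0(2) unfolding w pushforward_coord_vec[OF M F smooth_map_snd c z V] chart_slice_derivative[OF U(1) V(1) z]
    by (simp add: linear_0[OF coord_vec_linear[OF F V]])
  then have "snd w = 0" by (rule coord_vec_inj[OF F V])
  ultimately have "w = 0" by (simp add: prod_eq_iff)
  then show ?thesis by (simp add: w linear_0[OF coord_vec_linear[OF M c z]])
qed

text \<open>In a product chart the first half of the components is that of \<open>X\<close> at the
  first coordinate, and the second half is 0.\<close>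

lemma hor_smooth:
  assumes W: "open W" and X: "smooth_vfield_on B W X"
  shows "smooth_vfield_on M (W \<times> N) (hor X)"
proof (rule smooth_vfieldI[OF product_smooth_atlas])
  fix z assume z: "z \<in> W \<times> N"
  obtain U x where U: "(U, x) \<in> B" "fst z \<in> U" by (rule chart_at[OF B])
  obtain V y where V: "(V, y) \<in> F" "snd z \<in> V" by (rule chart_at[OF F])
  obtain \<epsilon> where \<epsilon>: "smooth_on (x ` (U \<inter> W)) \<epsilon>"
    and Xe: "\<And>q. q \<in> U \<inter> W \<Longrightarrow> X q = coord_vec B (U, x) q (\<epsilon> (x q))"
    using smooth_vfield_components[OF B X W U(1)] by blast
  have o: "open (x ` (U \<inter> W))" "open (y ` (V \<inter> UNIV))"
    by (rule chart_open_image[OF B U(1) W] chart_open_image[OF F V(1) open_UNIV])+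
  let ?z = "map_prod x y"
  have "smooth_on (x ` (U \<inter> W) \<times> y ` (V \<inter> UNIV)) (\<lambda>w. (\<epsilon> (fst w), 0))"
    by (rule smooth_on_Pair[OF open_Times[OF o] smooth_on_fst[OF o \<epsilon>] smooth_on_const])
  moreover have "?z ` (U \<times> V \<inter> W \<times> UNIV) = x ` (U \<inter> W) \<times> y ` (V \<inter> UNIV)" by auto
  ultimately have s: "smooth_on (?z ` (U \<times> V \<inter> W \<times> UNIV)) (\<lambda>w. (\<epsilon> (fst w), 0))" by simp
  have "hor X q = coord_vec M (U \<times> V, ?z) q (\<epsilon> (fst (?z q)), 0)" if q: "q \<in> U \<times> V \<inter> W \<times> UNIV" for q
  proof -
    have q': "q \<in> U \<times> V" "fst q \<in> U" "fst q \<in> U \<inter> W" "(fst q, snd q) \<in> U \<times> V" using q by auto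
    show ?thesis
      unfolding hor_def Xe[OF q'(3)]
        pushforward_coord_vec[OF B product_smooth_atlas smooth_map_slice1 U(1) q'(2) product_chart[OF U(1) V(1)] q'(4)]
        chart_slice_derivative[OF U(1) V(1) q'(1)]
      by simp
  qed
  then show "\<exists>U x W0 \<epsilon>. (U, x) \<in> M \<and> z \<in> U \<and> open W0 \<and> z \<in> W0 \<and>
      smooth_on (x ` (U \<inter> W0)) \<epsilon> \<and> (\<forall>q\<in>U \<inter> W0. hor X q = coord_vec M (U, x) q (\<epsilon> (x q)))"
    using product_chart[OF U(1) V(1)] s z U(2) V(2) open_Times[OF W open_UNIV]
    by (intro exI[of _ "U \<times> V"] exI[of _ ?z] exI[of _ "W \<times> UNIV"] exI[of _ "\<lambda>w. (\<epsilon> (fst w), 0)"])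
      (auto simp: mem_Times_iff)
qed

lemma ver_smooth:
  assumes W: "open W" and Y: "smooth_vfield_on F W Y"
  shows "smooth_vfield_on M (N \<times> W) (ver Y)"
proof (rule smooth_vfieldI[OF product_smooth_atlas])
  fix z assume z: "z \<in> N \<times> W"
  obtain U x where U: "(U, x) \<in> B" "fst z \<in> U" by (rule chart_at[OF B])
  obtain V y where V: "(V, y) \<in> F" "snd z \<in> V" by (rule chart_at[OF F])
  obtain \<epsilon> where \<epsilon>: "smooth_on (y ` (V \<inter> W)) \<epsilon>"
    and Ye: "\<And>q. q \<in> V \<inter> W \<Longrightarrow> Y q = coord_vec F (V, y) q (\<epsilon> (y q))"
    using smooth_vfield_components[OF F Y W V(1)] by blast
  have o: "open (x ` (U \<inter> UNIV))" "open (y ` (V \<inter> W))"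
    by (rule chart_open_image[OF B U(1) open_UNIV] chart_open_image[OF F V(1) W])+
  let ?z = "map_prod x y"
  have "smooth_on (x ` (U \<inter> UNIV) \<times> y ` (V \<inter> W)) (\<lambda>w. (0, \<epsilon> (snd w)))"
    by (rule smooth_on_Pair[OF open_Times[OF o] smooth_on_const smooth_on_snd[OF o \<epsilon>]])
  moreover have "?z ` (U \<times> V \<inter> UNIV \<times> W) = x ` (U \<inter> UNIV) \<times> y ` (V \<inter> W)" by auto
  ultimately have s: "smooth_on (?z ` (U \<times> V \<inter> UNIV \<times> W)) (\<lambda>w. (0, \<epsilon> (snd w)))" by simp
  have "ver Y q = coord_vec M (U \<times> V, ?z) q (0, \<epsilon> (snd (?z q)))" if q: "q \<in> U \<times> V \<inter> UNIV \<times> W" for q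
  proof -
    have q': "q \<in> U \<times> V" "snd q \<in> V" "snd q \<in> V \<inter> W" "(fst q, snd q) \<in> U \<times> V" using q by auto
    show ?thesis
      unfolding ver_def Ye[OF q'(3)]
        pushforward_coord_vec[OF F product_smooth_atlas smooth_map_slice2 V(1) q'(2) product_chart[OF U(1) V(1)] q'(4)]
        chart_slice_derivative[OF U(1) V(1) q'(1)]
      by simp
  qed
  then show "\<exists>U x W0 \<epsilon>. (U, x) \<in> M \<and> z \<in> U \<and> open W0 \<and> z \<in> W0 \<and>
      smooth_on (x ` (U \<inter> W0)) \<epsilon> \<and> (\<forall>q\<in>U \<inter> W0. ver Y q = coord_vec M (U, x) q (\<epsilon> (x q)))"
    using product_chart[OF U(1) V(1)] s z U(2) V(2) open_Times[OF open_UNIV W]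
    by (intro exI[of _ "U \<times> V"] exI[of _ ?z] exI[of _ "UNIV \<times> W"] exI[of _ "\<lambda>w. (0, \<epsilon> (snd w))"])
      (auto simp: mem_Times_iff)
qed

end

section \<open>Warped products\<close>

text \<open>Relatedness means that Q acts on a pulled back function as the pullback of the action of
  \<beta>. Iterating, P after Q corresponds to \<alpha> after \<beta>, and the bracket is the
  difference of the two orders.\<close>

lemma bracket_related:
  assumes A: "smooth_atlas A" and B: "smooth_atlas B" and \<pi>: "smooth_map A B \<pi>"
    and O: "open O1" "z \<in> O1" and W: "open W" "\<pi> z \<in> W"
    and s: "smooth_vfield_on A O1 P" "smooth_vfield_on A O1 Q" "smooth_vfield_on B W \<alpha>" "smooth_vfield_on B W \<beta>"
    and r: "\<And>z. z \<in> O1 \<Longrightarrow> pushforward B \<pi> z (P z) = \<alpha> (\<pi> z)"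
      "\<And>z. z \<in> O1 \<Longrightarrow> pushforward B \<pi> z (Q z) = \<beta> (\<pi> z)"
  shows "pushforward B \<pi> z (lie_bracket A P Q z) = lie_bracket B \<alpha> \<beta> (\<pi> z)"
proof
  fix h
  show "pushforward B \<pi> z (lie_bracket A P Q z) h = lie_bracket B \<alpha> \<beta> (\<pi> z) h"
  proof (cases "smooth_at B (\<pi> z) h")
    case True
    then obtain V where V: "open V" "\<pi> z \<in> V" "smooth_fun_on B V h" unfolding smooth_at_def by blast
    have hV: "smooth_at B b h" if "b \<in> V" for b by (rule smooth_atI[OF V(3,1) that])
    let ?O = "O1 \<inter> \<pi> -` V"
    have oO: "open ?O" "z \<in> ?O" using O V smooth_map_open_preimage[OF \<pi> V(1)] by auto
    have *: "P z (\<lambda>z. Q z (h \<circ> \<pi>)) = \<alpha> (\<pi> z) (\<lambda>b. \<beta> b h)"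
      if s: "smooth_vfield_on A O1 P" "smooth_vfield_on B W \<beta>"
        and r: "pushforward B \<pi> z (P z) = \<alpha> (\<pi> z)" "\<And>z. z \<in> O1 \<Longrightarrow> pushforward B \<pi> z (Q z) = \<beta> (\<pi> z)"
      for P Q \<alpha> \<beta>
    proof -
      have "P z (\<lambda>z. Q z (h \<circ> \<pi>)) = P z ((\<lambda>b. \<beta> b h) \<circ> \<pi>)"
      proof (rule tangent_vec_cong[OF A smooth_vfield_tangent[OF s(1) O(2)] oO])
        fix q assume q: "q \<in> ?O"
        then have "Q q (h \<circ> \<pi>) = pushforward B \<pi> q (Q q) h" using hV by (simp add: pushforward_def)
        then show "Q q (h \<circ> \<pi>) = ((\<lambda>b. \<beta> b h) \<circ> \<pi>) q" using r(2) q by simp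
      qed
      also have "\<dots> = pushforward B \<pi> z (P z) (\<lambda>b. \<beta> b h)"
        using smooth_vfield_smooth_at[OF s(2) W True] by (simp add: pushforward_def)
      finally show ?thesis by (simp add: r(1))
    qed
    show ?thesis
      using *[where P = P and Q = Q and \<alpha> = \<alpha> and \<beta> = \<beta>, OF s(1,4) r(1)[OF O(2)] r(2)]
        *[where P = Q and Q = P and \<alpha> = \<beta> and \<beta> = \<alpha>, OF s(2,3) r(2)[OF O(2)] r(1)]
        smooth_at_compose_map[OF A B \<pi> True] True
      by (simp add: pushforward_def lie_bracket_def)
  qed (simp add: pushforward_def lie_bracket_def)
qed

lemma lie_bracket_zero:
  assumes A: "smooth_atlas A" and s: "smooth_vfield_on A W Y" "p \<in> W"
  shows "lie_bracket A (\<lambda>p. 0) Y p = 0" "lie_bracket A Y (\<lambda>p. 0) p = 0"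
  using tangent_vec_const[OF A smooth_vfield_tangent[OF s], of 0]
  by (auto simp: lie_bracket_def fun_eq_iff)

locale warped_product = product_manifold B F + base: riemannian_manifold B gB DB +
    total: levi_civita_manifold "product_atlas B F" "warped_metric B gB F gF f" D
  for B :: "('p::{t2_space, second_countable_topology}, 'b::euclidean_space) atlas"
    and F :: "('q::{t2_space, second_countable_topology}, 'f::euclidean_space) atlas"
    and gB DB gF and f :: "'p \<Rightarrow> real" and D +
  assumes gF: "riemannian_metric F gF" and f: "smooth_fun_on B UNIV f" and fpos: "\<And>b. f b > 0"
begin

abbreviation gM where "gM \<equiv> warped_metric B gB F gF f"
abbreviation ph where "ph z u \<equiv> pushforward B fst z u"
abbreviation pv where "pv z u \<equiv> pushforward F snd z u"
abbreviation TM where "TM \<equiv> tangent_space M"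
abbreviation TF where "TF \<equiv> tangent_space F"
abbreviation TB where "TB \<equiv> tangent_space B"

section \<open>The factor metrics and pairings with lifts\<close>

lemma gF_sym: "u \<in> TF q \<Longrightarrow> v \<in> TF q \<Longrightarrow> gF q u v = gF q v u"
  and gF_add: "u \<in> TF q \<Longrightarrow> v \<in> TF q \<Longrightarrow> w \<in> TF q \<Longrightarrow> gF q u (v + w) = gF q u v + gF q u w"
  and gF_pos: "u \<in> TF q \<Longrightarrow> u \<noteq> 0 \<Longrightarrow> gF q u u > 0"
  using gF unfolding riemannian_metric_def linear_on_set_def by blast+

lemma gF_scale: "u \<in> TF q \<Longrightarrow> v \<in> TF q \<Longrightarrow> gF q u (c *\<^sub>R v) = c * gF q u v"
  using gF unfolding riemannian_metric_def linear_on_set_def real_scaleR_def by blast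

lemma TF_closed: "u \<in> TF q \<Longrightarrow> v \<in> TF q \<Longrightarrow> u - v \<in> TF q" "u \<in> TF q \<Longrightarrow> c *\<^sub>R u \<in> TF q" "0 \<in> TF q"
  using tangent_space_subspace[OF F, of q] by (auto simp: subspace_diff subspace_scale subspace_0)

lemma gF_zero: "u \<in> TF q \<Longrightarrow> gF q u 0 = 0" "u \<in> TF q \<Longrightarrow> gF q 0 u = 0"
  using gF_scale[of u q u 0] gF_sym[of u q 0] TF_closed by simp_all

lemma gF_diff: "u \<in> TF q \<Longrightarrow> v \<in> TF q \<Longrightarrow> w \<in> TF q \<Longrightarrow> gF q u (v - w) = gF q u v - gF q u w"
  using gF_add[of u q "v - w" w] TF_closed by simp

lemma gF_smooth:
  "open W \<Longrightarrow> smooth_vfield_on F W X \<Longrightarrow> smooth_vfield_on F W Y \<Longrightarrow> smooth_fun_on F W (\<lambda>p. gF p (X p) (Y p))"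
  using gF unfolding riemannian_metric_def by blast

text \<open>Test with u - v. Covariant derivatives are identified below by their pairings with
  arbitrary vectors of the factors.\<close>

lemma gF_nondeg:
  assumes "u \<in> TF q" "v \<in> TF q" "\<And>w. w \<in> TF q \<Longrightarrow> gF q w u = gF q w v"
  shows "u = v"
proof -
  have w: "u - v \<in> TF q" using TF_closed assms by simp
  have "gF q (u - v) (u - v) = 0" using gF_diff[OF w assms(1,2)] assms(3)[OF w] by simp
  then show ?thesis using gF_pos[OF w] by (metis less_irrefl right_minus_eq)
qed

lemma gB_nondeg:
  assumes "u \<in> TB q" "v \<in> TB q" "\<And>w. w \<in> TB q \<Longrightarrow> gB q w u = gB q w v"
  shows "u = v"
proof -
  have w: "u - v \<in> TB q" using base.T_closed assms by simp
  have "gB q (u - v) (u - v) = 0" using base.g_diff(2)[OF w assms(1,2)] assms(3)[OF w] by simp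
  moreover have "u - v \<noteq> 0 \<Longrightarrow> gB q (u - v) (u - v) > 0"
    using base.metric w unfolding riemannian_metric_def by blast
  ultimately show ?thesis by (metis less_irrefl right_minus_eq)
qed

lemma ph_T: "u \<in> TM z \<Longrightarrow> ph z u \<in> TB (fst z)"
  by (rule pushforward_tangent[OF product_smooth_atlas B smooth_map_fst])

lemma pv_T: "u \<in> TM z \<Longrightarrow> pv z u \<in> TF (snd z)"
  by (rule pushforward_tangent[OF product_smooth_atlas F smooth_map_snd])

lemma gM_sym: "u \<in> TM z \<Longrightarrow> v \<in> TM z \<Longrightarrow> gM z u v = gM z v u"
  using base.g_sym[OF ph_T ph_T] gF_sym[OF pv_T pv_T] by (simp add: warped_metric_def)

lemma gM_hor:
  assumes X: "X (fst z) \<in> TB (fst z)" and u: "u \<in> TM z"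
  shows "gM z (hor X z) u = gB (fst z) (X (fst z)) (ph z u)" "gM z u (hor X z) = gB (fst z) (X (fst z)) (ph z u)"
  using gF_zero[OF pv_T[OF u]] base.g_sym[OF X ph_T[OF u]]
  by (simp_all add: warped_metric_def push_hor[of X, OF X])

lemma gM_ver:
  assumes Y: "Y (snd z) \<in> TF (snd z)" and u: "u \<in> TM z"
  shows "gM z (ver Y z) u = (f (fst z))\<^sup>2 * gF (snd z) (Y (snd z)) (pv z u)"
    "gM z u (ver Y z) = (f (fst z))\<^sup>2 * gF (snd z) (Y (snd z)) (pv z u)"
  using base.g_zero[OF ph_T[OF u]] gF_sym[OF Y pv_T[OF u]]
  by (simp_all add: warped_metric_def push_ver[of Y, OF Y])

text \<open>Inner products of lifts are products of a function on the base and a function on the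
  fibre, so lifts need to be evaluated on such products.\<close>

lemma smooth_at_product:
  "smooth_at B (fst z) a \<Longrightarrow> smooth_at F (snd z) c \<Longrightarrow> smooth_at M z (\<lambda>z. a (fst z) * c (snd z))"
  using smooth_at_mult[OF product_smooth_atlas smooth_at_fst smooth_at_snd, of z a c] by (simp add: comp_def)

lemma hor_product:
  assumes X: "X (fst z) \<in> TB (fst z)" and a: "smooth_at B (fst z) a" and c: "smooth_at F (snd z) c"
  shows "hor X z (\<lambda>z. a (fst z) * c (snd z)) = X (fst z) a * c (snd z)"
  using tangent_vec_cmult[OF B X a, of "c (snd z)"]
  by (simp add: hor_apply[OF smooth_at_product[OF a c]] mult.commute)

lemma ver_product:
  assumes Y: "Y (snd z) \<in> TF (snd z)" and a: "smooth_at B (fst z) a" and c: "smooth_at F (snd z) c"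
  shows "ver Y z (\<lambda>z. a (fst z) * c (snd z)) = a (fst z) * Y (snd z) c"
  using tangent_vec_cmult[OF F Y c, of "a (fst z)"]
  by (simp add: ver_apply[OF smooth_at_product[OF a c]])

lemma f_at: "smooth_at B b f"
  by (rule smooth_atI[OF f open_UNIV UNIV_I])

context
  fixes W :: "'p set" and N :: "'q set"
  assumes W: "open W" and N: "open N"
begin

abbreviation (input) XB where "XB \<equiv> smooth_vfield_on B W"
abbreviation (input) XF where "XF \<equiv> smooth_vfield_on F N"

lemma oWN: "open (W \<times> N)" using open_Times[OF W N] .

lemma hor_sm: "XB X \<Longrightarrow> smooth_vfield_on M (W \<times> N) (hor X)"
  by (rule hor_smooth[OF W])

lemma ver_sm: "XF Y \<Longrightarrow> smooth_vfield_on M (W \<times> N) (ver Y)"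
  by (rule ver_smooth[OF N])

lemma XB_T: "XB X \<Longrightarrow> z \<in> W \<times> N \<Longrightarrow> X (fst z) \<in> TB (fst z)"
  by (auto intro: smooth_vfield_tangent)

lemma XF_T: "XF X \<Longrightarrow> z \<in> W \<times> N \<Longrightarrow> X (snd z) \<in> TF (snd z)"
  by (auto intro: smooth_vfield_tangent)

lemma hor_T: "XB X \<Longrightarrow> z \<in> W \<times> N \<Longrightarrow> hor X z \<in> TM z"
  by (rule hor_tangent[OF XB_T])

lemma ver_T: "XF X \<Longrightarrow> z \<in> W \<times> N \<Longrightarrow> ver X z \<in> TM z"
  by (rule ver_tangent[OF XF_T])

lemma D_T: "smooth_vfield_on M (W \<times> N) P \<Longrightarrow> smooth_vfield_on M (W \<times> N) Q \<Longrightarrow> z \<in> W \<times> N \<Longrightarrow> D P Q z \<in> TM z"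
  using total.D_smooth[OF oWN] smooth_vfield_tangent by blast

lemma bracket_T: "smooth_vfield_on M (W \<times> N) P \<Longrightarrow> smooth_vfield_on M (W \<times> N) Q \<Longrightarrow> z \<in> W \<times> N \<Longrightarrow>
    lie_bracket M P Q z \<in> TM z"
  using total.bracket_smooth[OF oWN] smooth_vfield_tangent by blast

section \<open>Brackets of lifts\<close>

lemma bracket_fst:
  assumes z: "z \<in> W \<times> N" and P: "smooth_vfield_on M (W \<times> N) P" and Q: "smooth_vfield_on M (W \<times> N) Q"
    and s: "XB \<alpha>" "XB \<beta>"
    and r: "\<And>z. z \<in> W \<times> N \<Longrightarrow> ph z (P z) = \<alpha> (fst z)" "\<And>z. z \<in> W \<times> N \<Longrightarrow> ph z (Q z) = \<beta> (fst z)"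
  shows "ph z (lie_bracket M P Q z) = lie_bracket B \<alpha> \<beta> (fst z)"
  by (rule bracket_related[OF product_smooth_atlas B smooth_map_fst oWN z W _ P Q s r]) (use z in auto)

lemma bracket_snd:
  assumes z: "z \<in> W \<times> N" and P: "smooth_vfield_on M (W \<times> N) P" and Q: "smooth_vfield_on M (W \<times> N) Q"
    and s: "XF \<alpha>" "XF \<beta>"
    and r: "\<And>z. z \<in> W \<times> N \<Longrightarrow> pv z (P z) = \<alpha> (snd z)" "\<And>z. z \<in> W \<times> N \<Longrightarrow> pv z (Q z) = \<beta> (snd z)"
  shows "pv z (lie_bracket M P Q z) = lie_bracket F \<alpha> \<beta> (snd z)"
  by (rule bracket_related[OF product_smooth_atlas F smooth_map_snd oWN z N _ P Q s r]) (use z in auto)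

text \<open>Each of the two lifts is related to the zero field on the other factor, so both
  projections of the bracket are brackets with zero.\<close>

lemma bracket_hor_ver:
  assumes X: "XB X" and V: "XF V" and z: "z \<in> W \<times> N"
  shows "lie_bracket M (hor X) (ver V) z = 0"
proof (rule tangent_zeroI[OF bracket_T[OF hor_sm[OF X] ver_sm[OF V] z]])
  have z': "fst z \<in> W" "snd z \<in> N" using z by auto
  have "ph z (lie_bracket M (hor X) (ver V) z) = lie_bracket B X (\<lambda>p. 0) (fst z)"
    by (rule bracket_fst[OF z hor_sm[OF X] ver_sm[OF V] X smooth_vfield_zero[OF B]])
      (simp_all add: push_hor XB_T[OF X] push_ver XF_T[OF V])
  then show "ph z (lie_bracket M (hor X) (ver V) z) = 0" by (simp add: lie_bracket_zero[OF B X z'(1)])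
  have "pv z (lie_bracket M (hor X) (ver V) z) = lie_bracket F (\<lambda>p. 0) V (snd z)"
    by (rule bracket_snd[OF z hor_sm[OF X] ver_sm[OF V] smooth_vfield_zero[OF F] V])
      (simp_all add: push_hor XB_T[OF X] push_ver XF_T[OF V])
  then show "pv z (lie_bracket M (hor X) (ver V) z) = 0" by (simp add: lie_bracket_zero[OF F V z'(2)])
qed

lemma bracket_ver_ver:
  assumes U: "XF U" and V: "XF V" and z: "z \<in> W \<times> N"
  shows "ph z (lie_bracket M (ver U) (ver V) z) = 0"
proof -
  have z': "fst z \<in> W" using z by auto
  have "ph z (lie_bracket M (ver U) (ver V) z) = lie_bracket B (\<lambda>p. 0) (\<lambda>p. 0) (fst z)"
    by (rule bracket_fst[OF z ver_sm[OF U] ver_sm[OF V] smooth_vfield_zero[OF B] smooth_vfield_zero[OF B]])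
      (simp_all add: push_ver XF_T[OF V] XF_T[OF U])
  then show ?thesis by (simp add: lie_bracket_zero[OF B smooth_vfield_zero[OF B] z'])
qed

lemma bracket_hor_hor:
  assumes X: "XB X" and Z: "XB Z" and z: "z \<in> W \<times> N"
  shows "pv z (lie_bracket M (hor X) (hor Z) z) = 0"
    "ph z (lie_bracket M (hor X) (hor Z) z) = lie_bracket B X Z (fst z)"
proof -
  have z': "snd z \<in> N" using z by auto
  have "pv z (lie_bracket M (hor X) (hor Z) z) = lie_bracket F (\<lambda>p. 0) (\<lambda>p. 0) (snd z)"
    by (rule bracket_snd[OF z hor_sm[OF X] hor_sm[OF Z] smooth_vfield_zero[OF F] smooth_vfield_zero[OF F]])
      (simp_all add: push_hor XB_T[OF X] XB_T[OF Z])
  then show "pv z (lie_bracket M (hor X) (hor Z) z) = 0"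
    by (simp add: lie_bracket_zero[OF F smooth_vfield_zero[OF F] z'])
  show "ph z (lie_bracket M (hor X) (hor Z) z) = lie_bracket B X Z (fst z)"
    by (rule bracket_fst[OF z hor_sm[OF X] hor_sm[OF Z] X Z])
      (simp_all add: push_hor XB_T[OF X] XB_T[OF Z])
qed

lemma D_hor_ver_commute:
  assumes X: "XB X" and V: "XF V" and z: "z \<in> W \<times> N"
  shows "D (ver V) (hor X) z = D (hor X) (ver V) z"
  using total.torsion_free[OF oWN z hor_sm[OF X] ver_sm[OF V]] bracket_hor_ver[OF X V z] by simp

section \<open>Covariant derivatives of lifts paired with lifts\<close>

lemma gM_hor_hor:
  "XB X \<Longrightarrow> XB Z \<Longrightarrow> z \<in> W \<times> N \<Longrightarrow> gM z (hor X z) (hor Z z) = gB (fst z) (X (fst z)) (Z (fst z))"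
  by (simp add: gM_hor(1) XB_T hor_T push_hor)

lemma gM_hor_ver:
  "XB X \<Longrightarrow> XF V \<Longrightarrow> z \<in> W \<times> N \<Longrightarrow> gM z (hor X z) (ver V z) = 0"
  "XB X \<Longrightarrow> XF V \<Longrightarrow> z \<in> W \<times> N \<Longrightarrow> gM z (ver V z) (hor X z) = 0"
  by (simp_all add: gM_hor XB_T ver_T push_ver XF_T base.g_zero)

lemma gM_ver_ver:
  "XF U \<Longrightarrow> XF V \<Longrightarrow> z \<in> W \<times> N \<Longrightarrow>
    gM z (ver U z) (ver V z) = (f (fst z))\<^sup>2 * gF (snd z) (U (snd z)) (V (snd z))"
  by (simp add: gM_ver(1) XF_T ver_T push_ver)

lemma const_derivative:
  assumes P: "smooth_vfield_on M (W \<times> N) P" and z: "z \<in> W \<times> N" and h: "\<And>z. z \<in> W \<times> N \<Longrightarrow> h z = c"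
  shows "P z h = 0"
proof -
  note T = smooth_vfield_tangent[OF P z]
  have "P z h = P z (\<lambda>z. c)" by (rule tangent_vec_cong[OF product_smooth_atlas T oWN z h])
  then show ?thesis by (simp add: tangent_vec_const[OF product_smooth_atlas T])
qed

lemma hor_derivative:
  assumes X: "XB X" and z: "z \<in> W \<times> N" and a: "smooth_at B (fst z) a" and c: "smooth_at F (snd z) c"
    and h: "\<And>z. z \<in> W \<times> N \<Longrightarrow> h z = a (fst z) * c (snd z)"
  shows "hor X z h = X (fst z) a * c (snd z)"
proof -
  have "hor X z h = hor X z (\<lambda>z. a (fst z) * c (snd z))"
    by (rule tangent_vec_cong[OF product_smooth_atlas hor_T[OF X z] oWN z h])
  then show ?thesis by (simp add: hor_product[of X z a c, OF XB_T[OF X z] a c])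
qed

lemma ver_derivative:
  assumes Y: "XF Y" and z: "z \<in> W \<times> N" and a: "smooth_at B (fst z) a"
    and h: "\<And>z. z \<in> W \<times> N \<Longrightarrow> h z = a (fst z)"
  shows "ver Y z h = 0"
proof -
  have "ver Y z h = ver Y z (\<lambda>z. a (fst z) * 1)"
    by (rule tangent_vec_cong[OF product_smooth_atlas ver_T[OF Y z] oWN z]) (simp add: h)
  then show ?thesis
    using ver_product[of Y z a "\<lambda>_. 1", OF XF_T[OF Y z] a smooth_at_const] tangent_vec_const[OF F XF_T[OF Y z], of 1]
    by simp
qed

lemma gB_at: "XB X \<Longrightarrow> XB Z \<Longrightarrow> z \<in> W \<times> N \<Longrightarrow> smooth_at B (fst z) (\<lambda>b. gB b (X b) (Z b))"
  by (rule smooth_atI[OF base.g_smooth[OF W] W]) auto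

lemma gF_at: "XF X \<Longrightarrow> XF Z \<Longrightarrow> z \<in> W \<times> N \<Longrightarrow> smooth_at F (snd z) (\<lambda>b. gF b (X b) (Z b))"
  by (rule smooth_atI[OF gF_smooth[OF N] N]) auto

text \<open>
  The pairings of \<open>\<nabla>\<^sub>X V\<close> with \<open>Z\<close> and of \<open>\<nabla>\<^sub>Z V\<close> with \<open>X\<close> agree, since \<open>[X, Z]\<close> is horizontal,
  and sum to zero, since \<open>V\<close> annihilates the product of \<open>X\<close> and \<open>Z\<close>.
\<close>

lemma D_hor_ver_hor:
  assumes X: "XB X" and V: "XF V" and Z: "XB Z" and z: "z \<in> W \<times> N"
  shows "gM z (D (hor X) (ver V) z) (hor Z z) = 0"
proof -
  note hX = hor_sm[OF X] and hZ = hor_sm[OF Z] and vV = ver_sm[OF V]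
  note mc = total.metric_compatible[OF oWN z]
  have c1: "gM z (D (hor X) (ver V) z) (hor Z z) + gM z (hor X z) (D (hor Z) (ver V) z) = 0"
    using mc[OF vV hX hZ] ver_derivative[OF V z gB_at[OF X Z z] gM_hor_hor[OF X Z]]
      D_hor_ver_commute[OF X V z] D_hor_ver_commute[OF Z V z] by simp
  have c2: "gM z (D (hor Z) (hor X) z) (ver V z) + gM z (hor X z) (D (hor Z) (ver V) z) = 0"
    using mc[OF hZ hX vV] const_derivative[OF hZ z gM_hor_ver(1)[OF X V]] by simp
  have c3: "gM z (D (hor X) (hor Z) z) (ver V z) + gM z (hor Z z) (D (hor X) (ver V) z) = 0"
    using mc[OF hX hZ vV] const_derivative[OF hX z gM_hor_ver(1)[OF Z V]] by simp
  have "pv z (D (hor X) (hor Z) z) - pv z (D (hor Z) (hor X) z) = 0"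
    using bracket_hor_hor(1)[OF X Z z] unfolding total.torsion_free[OF oWN z hX hZ] pushforward_linear by simp
  then have c4: "gM z (D (hor X) (hor Z) z) (ver V z) = gM z (D (hor Z) (hor X) z) (ver V z)"
    by (simp add: gM_ver(2)[of V z, OF XF_T[OF V z]] D_T[OF hX hZ z] D_T[OF hZ hX z])
  have "gM z (hor Z z) (D (hor X) (ver V) z) = gM z (D (hor X) (ver V) z) (hor Z z)"
    by (rule gM_sym[OF hor_T[OF Z z] D_T[OF hX vV z]])
  then show ?thesis using c1 c2 c3 c4 by linarith
qed

text \<open>The pairings of \<nabla>_X V with U and of \<nabla>_X U with V agree because [V, U] is
  vertical. Their sum is the derivative of f^2 gF(V, U) along X, which is 2 f (X f) gF(V,
  U).\<close>

lemma D_hor_ver_ver: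
  assumes X: "XB X" and V: "XF V" and U: "XF U" and z: "z \<in> W \<times> N"
  shows "gM z (D (hor X) (ver V) z) (ver U z) = f (fst z) * X (fst z) f * gF (snd z) (V (snd z)) (U (snd z))"
proof -
  note hX = hor_sm[OF X] and vU = ver_sm[OF U] and vV = ver_sm[OF V]
  note mc = total.metric_compatible[OF oWN z]
  have e1: "gM z (D (hor X) (ver V) z) (ver U z) + gM z (hor X z) (D (ver V) (ver U) z) = 0"
    using mc[OF vV hX vU] const_derivative[OF vV z gM_hor_ver(1)[OF X U]] D_hor_ver_commute[OF X V z] by simp
  have e2: "gM z (D (hor X) (ver U) z) (ver V z) + gM z (hor X z) (D (ver U) (ver V) z) = 0"
    using mc[OF vU hX vV] const_derivative[OF vU z gM_hor_ver(1)[OF X V]] D_hor_ver_commute[OF X U z] by simp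
  have "ph z (D (ver V) (ver U) z) - ph z (D (ver U) (ver V) z) = 0"
    using bracket_ver_ver[OF V U z] unfolding total.torsion_free[OF oWN z vV vU] pushforward_linear by simp
  then have e3: "gM z (hor X z) (D (ver V) (ver U) z) = gM z (hor X z) (D (ver U) (ver V) z)"
    by (simp add: gM_hor(1)[of X z, OF XB_T[OF X z]] D_T[OF vU vV z] D_T[OF vV vU z])
  have ff: "smooth_at B (fst z) (\<lambda>b. (f b)\<^sup>2)"
    unfolding power2_eq_square by (rule smooth_at_mult[OF B f_at f_at])
  have "X (fst z) (\<lambda>b. (f b)\<^sup>2) = 2 * f (fst z) * X (fst z) f"
    unfolding power2_eq_square tangent_vec_mult[OF B XB_T[OF X z] f_at f_at] by simp
  then have e4: "gM z (D (hor X) (ver V) z) (ver U z) + gM z (ver V z) (D (hor X) (ver U) z)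
      = 2 * f (fst z) * X (fst z) f * gF (snd z) (V (snd z)) (U (snd z))"
    using mc[OF hX vV vU] hor_derivative[OF X z ff gF_at[OF V U z] gM_ver_ver[OF V U]] by simp
  have "gM z (ver V z) (D (hor X) (ver U) z) = gM z (D (hor X) (ver U) z) (ver V z)"
    by (rule gM_sym[OF ver_T[OF V z] D_T[OF hX vU z]])
  then show ?thesis using e1 e2 e3 e4 by linarith
qed

text \<open>The Koszul formula with two equal fields, on the product and on the base: the
  derivatives of inner products and the brackets that enter it coincide.\<close>

lemma D_hor_hor_hor:
  assumes X: "XB X" and Z: "XB Z" and z: "z \<in> W \<times> N"
  shows "gM z (D (hor X) (hor X) z) (hor Z z) = gB (fst z) (DB X X (fst z)) (Z (fst z))"
proof -
  note hX = hor_sm[OF X] and hZ = hor_sm[OF Z]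
  note mc = total.metric_compatible[OF oWN z]
  have b: "fst z \<in> W" using z by auto
  note mcb = base.metric_compatible[OF W b]
  have BT: "DB P Q (fst z) \<in> TB (fst z)" if "XB P" "XB Q" for P Q
    by (rule smooth_vfield_tangent[OF base.D_smooth[OF W that] b])
  note XT = XB_T[OF X z]
  have XZ: "hor X z (\<lambda>z. gM z (hor X z) (hor Z z)) = X (fst z) (\<lambda>b. gB b (X b) (Z b))"
    using hor_derivative[OF X z gB_at[OF X Z z] smooth_at_const[of F _ 1], of "\<lambda>z. gM z (hor X z) (hor Z z)"]
      gM_hor_hor[OF X Z] by simp
  have ZX: "hor Z z (\<lambda>z. gM z (hor X z) (hor X z)) = Z (fst z) (\<lambda>b. gB b (X b) (X b))"
    using hor_derivative[OF Z z gB_at[OF X X z] smooth_at_const[of F _ 1], of "\<lambda>z. gM z (hor X z) (hor X z)"]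
      gM_hor_hor[OF X X] by simp
  have "ph z (D (hor X) (hor Z) z) - ph z (D (hor Z) (hor X) z) = DB X Z (fst z) - DB Z X (fst z)"
    using bracket_hor_hor(2)[OF X Z z]
    unfolding total.torsion_free[OF oWN z hX hZ] pushforward_linear base.torsion_free[OF W b X Z] .
  then have "gB (fst z) (X (fst z)) (ph z (D (hor X) (hor Z) z) - ph z (D (hor Z) (hor X) z))
      = gB (fst z) (X (fst z)) (DB X Z (fst z) - DB Z X (fst z))" by simp
  then have 1: "gM z (hor X z) (D (hor X) (hor Z) z) - gM z (hor X z) (D (hor Z) (hor X) z)
      = gB (fst z) (X (fst z)) (DB X Z (fst z)) - gB (fst z) (X (fst z)) (DB Z X (fst z))"
    by (simp add: gM_hor(1)[of X z, OF XT] D_T[OF hX hZ z] D_T[OF hZ hX z] base.g_diff(2)[OF XT] BT X Z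
        ph_T[OF D_T[OF hX hZ z]] ph_T[OF D_T[OF hZ hX z]])
  have 2: "gM z (D (hor Z) (hor X) z) (hor X z) = gM z (hor X z) (D (hor Z) (hor X) z)"
    by (rule gM_sym[OF D_T[OF hZ hX z] hor_T[OF X z]])
  have 3: "gB (fst z) (DB Z X (fst z)) (X (fst z)) = gB (fst z) (X (fst z)) (DB Z X (fst z))"
    by (rule base.g_sym[OF BT[OF Z X] XT])
  show ?thesis
    using mc[OF hX hX hZ] mc[OF hZ hX hX] mcb[OF X X Z] mcb[OF Z X X] XZ ZX 1 2 3 by linarith
qed

text \<open>The length of X depends on the base point only, so X is orthogonal to \<nabla>_U X =
  \<nabla>_X U; it remains to differentiate g(X, U) = 0 along X. Geometrically, the slices parallel
  to the base are totally geodesic.\<close>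

lemma D_hor_hor_ver:
  assumes X: "XB X" and U: "XF U" and z: "z \<in> W \<times> N"
  shows "gM z (D (hor X) (hor X) z) (ver U z) = 0"
proof -
  note hX = hor_sm[OF X] and vU = ver_sm[OF U]
  note mc = total.metric_compatible[OF oWN z]
  have 1: "gM z (D (hor X) (hor X) z) (ver U z) + gM z (hor X z) (D (hor X) (ver U) z) = 0"
    using mc[OF hX hX vU] const_derivative[OF hX z gM_hor_ver(1)[OF X U]] by simp
  have 2: "gM z (D (hor X) (ver U) z) (hor X z) + gM z (hor X z) (D (hor X) (ver U) z) = 0"
    using mc[OF vU hX hX] ver_derivative[OF U z gB_at[OF X X z] gM_hor_hor[OF X X]]
      D_hor_ver_commute[OF X U z] by simp
  have "gM z (D (hor X) (ver U) z) (hor X z) = gM z (hor X z) (D (hor X) (ver U) z)"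
    by (rule gM_sym[OF D_T[OF hX vU z] hor_T[OF X z]])
  then show ?thesis using 1 2 by linarith
qed

end

lemma D_hor_hor:
  assumes WN: "open W" "open N" and X: "smooth_vfield_on B W X" and z: "z \<in> W \<times> N"
  shows "D (hor X) (hor X) z = hor (DB X X) z"
proof -
  have z': "fst z \<in> W" "snd z \<in> N" using z by auto
  define u where "u = D (hor X) (hor X) z"
  have u: "u \<in> TM z" unfolding u_def by (rule D_T[OF WN hor_sm[OF WN X] hor_sm[OF WN X] z])
  have DX: "DB X X (fst z) \<in> TB (fst z)" by (rule smooth_vfield_tangent[OF base.D_smooth[OF WN(1) X X] z'(1)])
  have "ph z u = DB X X (fst z)"
  proof (rule gB_nondeg[OF ph_T[OF u] DX])
    \<comment> \<open>The pairing lemmas concern fields, so the test vector is extended to a local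
      field at the price of a smaller domain.\<close>
    fix w assume "w \<in> TB (fst z)"
    then obtain W1 Z where Z: "open W1" "fst z \<in> W1" "W1 \<subseteq> W" "smooth_vfield_on B W1 Z" "Z (fst z) = w"
      using exists_local_field[OF B WN(1) z'(1)] by metis
    have z1: "z \<in> W1 \<times> N" using Z(2) z' by (simp add: mem_Times_iff)
    note X1 = smooth_vfield_subset[OF X Z(3)]
    have w: "w \<in> TB (fst z)" using smooth_vfield_tangent[OF Z(4,2)] Z(5) by simp
    have "gM z u (hor Z z) = gB (fst z) (DB X X (fst z)) w"
      unfolding u_def using D_hor_hor_hor[OF Z(1) WN(2) X1 Z(4) z1] Z(5) by simp
    moreover have "gM z u (hor Z z) = gB (fst z) w (ph z u)"
      using gM_hor(2)[of Z z u] Z(5) w u by simp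
    ultimately show "gB (fst z) w (ph z u) = gB (fst z) w (DB X X (fst z))"
      using base.g_sym[OF DX w] by simp
  qed
  moreover have "pv z u = 0"
  proof (rule gF_nondeg[OF pv_T[OF u] TF_closed(3)])
    fix w assume "w \<in> TF (snd z)"
    then obtain N1 U where U: "open N1" "snd z \<in> N1" "N1 \<subseteq> N" "smooth_vfield_on F N1 U" "U (snd z) = w"
      using exists_local_field[OF F WN(2) z'(2)] by metis
    have z1: "z \<in> W \<times> N1" using U(2) z' by (simp add: mem_Times_iff)
    have w: "w \<in> TF (snd z)" using smooth_vfield_tangent[OF U(4,2)] U(5) by simp
    have "gM z u (ver U z) = 0" unfolding u_def by (rule D_hor_hor_ver[OF WN(1) U(1) X U(4) z1])
    then show "gF (snd z) w (pv z u) = gF (snd z) w 0"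
      using gM_ver(2)[of U z u] U(5) w u fpos[of "fst z"] gF_zero(1)[OF w] by simp
  qed
  ultimately have p: "ph z (u - hor (DB X X) z) = 0" "pv z (u - hor (DB X X) z) = 0"
    by (simp_all add: pushforward_linear push_hor[of "DB X X", OF DX])
  have "u - hor (DB X X) z \<in> TM z"
    by (rule subspace_diff[OF tangent_space_subspace[OF product_smooth_atlas] u hor_tangent[of "DB X X", OF DX]])
  from tangent_zeroI[OF this p] show ?thesis by (simp add: u_def)
qed

lemma D_hor_ver:
  assumes WN: "open W" "open N" and X: "smooth_vfield_on B W X" and V: "smooth_vfield_on F N V"
    and z: "z \<in> W \<times> N"
  shows "ph z (D (hor X) (ver V) z) = 0"
    "pv z (D (hor X) (ver V) z) = (X (fst z) f / f (fst z)) *\<^sub>R V (snd z)"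
proof -
  have z': "fst z \<in> W" "snd z \<in> N" using z by auto
  define u where "u = D (hor X) (ver V) z"
  have u: "u \<in> TM z" unfolding u_def by (rule D_T[OF WN hor_sm[OF WN X] ver_sm[OF WN V] z])
  have VT: "V (snd z) \<in> TF (snd z)" by (rule smooth_vfield_tangent[OF V z'(2)])
  have "ph z u = 0"
  proof (rule gB_nondeg[OF ph_T[OF u] base.T_closed(3)])
    fix w assume "w \<in> TB (fst z)"
    then obtain W1 Z where Z: "open W1" "fst z \<in> W1" "W1 \<subseteq> W" "smooth_vfield_on B W1 Z" "Z (fst z) = w"
      using exists_local_field[OF B WN(1) z'(1)] by metis
    have z1: "z \<in> W1 \<times> N" using Z(2) z' by (simp add: mem_Times_iff)
    have w: "w \<in> TB (fst z)" using smooth_vfield_tangent[OF Z(4,2)] Z(5) by simp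
    have "gM z u (hor Z z) = 0"
      unfolding u_def by (rule D_hor_ver_hor[OF Z(1) WN(2) smooth_vfield_subset[OF X Z(3)] V Z(4) z1])
    then show "gB (fst z) w (ph z u) = gB (fst z) w 0"
      using gM_hor(2)[of Z z u] Z(5) w u base.g_zero(2)[OF w] by simp
  qed
  moreover have "pv z u = (X (fst z) f / f (fst z)) *\<^sub>R V (snd z)"
  proof (rule gF_nondeg[OF pv_T[OF u] TF_closed(2)[OF VT]])
    fix w assume "w \<in> TF (snd z)"
    then obtain N1 U where U: "open N1" "snd z \<in> N1" "N1 \<subseteq> N" "smooth_vfield_on F N1 U" "U (snd z) = w"
      using exists_local_field[OF F WN(2) z'(2)] by metis
    have z1: "z \<in> W \<times> N1" using U(2) z' by (simp add: mem_Times_iff)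
    have w: "w \<in> TF (snd z)" using smooth_vfield_tangent[OF U(4,2)] U(5) by simp
    have "(f (fst z))\<^sup>2 * gF (snd z) w (pv z u) = f (fst z) * X (fst z) f * gF (snd z) (V (snd z)) w"
      using D_hor_ver_ver[OF WN(1) U(1) X smooth_vfield_subset[OF V U(3)] U(4) z1]
        gM_ver(2)[of U z u] U(5) w u by (simp add: u_def)
    then show "gF (snd z) w (pv z u) = gF (snd z) w ((X (fst z) f / f (fst z)) *\<^sub>R V (snd z))"
      using fpos[of "fst z"] by (simp add: gF_scale[OF w VT] gF_sym[OF w VT] field_simps power2_eq_square)
  qed
  ultimately show "ph z (D (hor X) (ver V) z) = 0"
    "pv z (D (hor X) (ver V) z) = (X (fst z) f / f (fst z)) *\<^sub>R V (snd z)"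
    by (simp_all add: u_def)
qed

text \<open>The field \<nabla>_V X = (X f / f) V is in general not a lift, so its derivative along X
  is obtained only in the pairing with V, as X g(\<nabla>_V X, V) - g(\<nabla>_V X, \<nabla>_X V).
  With lengths taken in the fibre this is (f X X f + (X f)^2) |V|^2 - (X f)^2 |V|^2, and the squares
  of X f cancel.\<close>

lemma mixed_curvature:
  assumes WN: "open W" "open N" and X: "smooth_vfield_on B W X" and V: "smooth_vfield_on F N V"
    and z: "z \<in> W \<times> N"
  shows "gM z (curvature M D (hor X) (ver V) (hor X) z) (ver V z)
    = f (fst z) * (X (fst z) (\<lambda>b. X b f) - DB X X (fst z) f) * gF (snd z) (V (snd z)) (V (snd z))"
proof -
  have z': "fst z \<in> W" "snd z \<in> N" using z by auto
  note O = oWN[OF WN] and hX = hor_sm[OF WN X] and vV = ver_sm[OF WN V]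
  note ds = total.D_smooth[OF O] and T = smooth_vfield_tangent
  have VT: "V (snd z) \<in> TF (snd z)" by (rule T[OF V z'(2)])
  define Y where "Y = DB X X"
  have Y: "smooth_vfield_on B W Y" unfolding Y_def by (rule base.D_smooth[OF WN(1) X X])
  define G where "G = (\<lambda>q. gF q (V q) (V q))"
  have G: "smooth_at F (snd z) G" unfolding G_def by (rule gF_at[OF WN V V z])
  \<comment> \<open>The bracket vanishes only on the product of \<open>W\<close> and
    \<open>N\<close>; writing it there as 0 times \<open>hor X\<close> makes the homogeneity of
    \<open>D\<close> applicable.\<close>
  have z0: "D (lie_bracket M (hor X) (ver V)) (hor X) z = 0"
  proof -
    have "D (lie_bracket M (hor X) (ver V)) (hor X) z = D (\<lambda>q. 0 *\<^sub>R hor X q) (hor X) z"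
      by (rule total.D_cong[OF O z total.bracket_smooth[OF O hX vV] hX])
        (simp_all add: bracket_hor_ver[OF WN X V])
    also have "\<dots> = 0" unfolding total.D_cscale_left[OF O z hX hX] by simp
    finally show ?thesis .
  qed
  \<comment> \<open>Since \<open>D (hor X) (hor X)\<close> is again a horizontal lift, the second
    term is covered by \<open>D_hor_ver_ver\<close>.\<close>
  have z1: "D (ver V) (D (hor X) (hor X)) z = D (hor Y) (ver V) z"
  proof -
    have "D (ver V) (D (hor X) (hor X)) z = D (ver V) (hor Y) z"
      by (rule total.D_cong[OF O z vV ds[OF hX hX]]) (simp_all add: D_hor_hor[OF WN X] Y_def)
    then show ?thesis by (simp add: D_hor_ver_commute[OF WN Y V z])
  qed
  have 1: "gM z (D (hor Y) (ver V) z) (ver V z) = f (fst z) * Y (fst z) f * G (snd z)"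
    unfolding G_def by (rule D_hor_ver_ver[OF WN Y V V z])
  have Xf: "smooth_at B (fst z) (\<lambda>b. X b f)"
    by (rule smooth_vfield_smooth_at[OF X WN(1) z'(1) f_at])
  have "hor X z (\<lambda>z. gM z (D (ver V) (hor X) z) (ver V z)) = X (fst z) (\<lambda>b. f b * X b f) * G (snd z)"
    by (rule hor_derivative[OF WN X z smooth_at_mult[OF B f_at Xf] G])
      (simp add: D_hor_ver_commute[OF WN X V] D_hor_ver_ver[OF WN X V V] G_def)
  also have "X (fst z) (\<lambda>b. f b * X b f) = f (fst z) * X (fst z) (\<lambda>b. X b f) + X (fst z) f * X (fst z) f"
    by (rule tangent_vec_mult[OF B T[OF X z'(1)] f_at Xf])
  finally have 2: "gM z (D (hor X) (D (ver V) (hor X)) z) (ver V z)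
      + gM z (D (hor X) (ver V) z) (D (hor X) (ver V) z)
      = (f (fst z) * X (fst z) (\<lambda>b. X b f) + (X (fst z) f)\<^sup>2) * G (snd z)"
    using total.metric_compatible[OF O z hX ds[OF vV hX] vV] D_hor_ver_commute[OF WN X V z]
    by (simp add: power2_eq_square)
  \<comment> \<open>The factor f^2 of the warped metric cancels the denominator of (X f /
    f)^2.\<close>
  have 3: "gM z (D (hor X) (ver V) z) (D (hor X) (ver V) z) = (X (fst z) f)\<^sup>2 * G (snd z)"
    unfolding warped_metric_def D_hor_ver[OF WN X V z]
    using fpos[of "fst z"] base.g_zero(1)[OF base.T_closed(3)] VT
    by (simp add: gF_scale TF_closed gF_sym[of "_ *\<^sub>R V (snd z)" "snd z" "V (snd z)"] G_def
        power2_eq_square field_simps)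
  have t: "D (hor X) (D (ver V) (hor X)) z \<in> TM z" "D (hor Y) (ver V) z \<in> TM z"
    by (rule T[OF ds[OF hX ds[OF vV hX]] z] T[OF ds[OF hor_sm[OF WN Y] vV] z])+
  have t': "D (hor X) (D (ver V) (hor X)) z - D (hor Y) (ver V) z \<in> TM z"
    by (rule subspace_diff[OF tangent_space_subspace[OF product_smooth_atlas] t])
  have "gM z (curvature M D (hor X) (ver V) (hor X) z) (ver V z)
      = gM z (D (hor X) (D (ver V) (hor X)) z) (ver V z) - gM z (D (hor Y) (ver V) z) (ver V z)"
    unfolding curvature_def z0 z1
    using VT t' t pv_T[OF t(1)] pv_T[OF t(2)]
    by (simp add: gM_ver(2) pushforward_linear gF_diff right_diff_distrib)
  then show ?thesis using 1 2 3 by (simp add: Y_def G_def algebra_simps)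
qed

end

section \<open>Totally geodesic submanifolds\<close>

text \<open>An ambient extension may have any \<xi>-component away from the submanifold. Removing it
  gives a field to which the Sasakian algebra applies and changes nothing where the field is already
  orthogonal to \<xi>; the value 0 off \<open>W\<close> is part of
  \<open>contact_fields\<close>.\<close>

lemma (in sasakian_manifold) contact_truncation:
  assumes W: "open W" and X: "X_on W X"
  obtains Y where "Y \<in> contact_fields W" "\<And>q. q \<in> W \<Longrightarrow> \<eta> q (X q) = 0 \<Longrightarrow> Y q = X q"
proof
  let ?Z = "\<lambda>q. X q - \<eta> q (X q) *\<^sub>R \<xi> q"
  let ?Y = "\<lambda>q. if q \<in> W then ?Z q else 0"
  have Z: "X_on W ?Z"
    by (intro smooth_vfield_diff[OF atlas X] smooth_vfield_scale[OF atlas eta_smooth[OF W X] xi_smooth])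
  have "X_on W ?Y" by (rule smooth_vfield_cong[OF atlas _ Z]) simp
  moreover have "\<eta> q (?Z q) = 0" if "q \<in> W" for q
  proof -
    have Xq: "X q \<in> T q" by (rule smooth_vfield_tangent[OF X that])
    have "\<eta> q (X q + (- \<eta> q (X q)) *\<^sub>R \<xi> q) = 0"
      by (simp only: eta_add[OF Xq T_closed(2)[OF xi_T]] eta_scale[OF xi_T] eta_xi)
    then show ?thesis by simp
  qed
  ultimately show "?Y \<in> contact_fields W" by (simp add: contact_fields_def)
  show "\<And>q. q \<in> W \<Longrightarrow> \<eta> q (X q) = 0 \<Longrightarrow> ?Y q = X q" by simp
qed

text \<open>A vanishing second fundamental form says that \<open>D' X' Y'\<close> extends
  \<open>D X Y\<close>. Extensions are therefore stable under covariant derivatives, and by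
  torsion-freeness under brackets, so second derivatives and the curvature can be read off directly,
  without a Gauss equation.\<close>

lemma totally_geodesic_curvature:
  assumes A: "levi_civita_manifold A g D" and B: "levi_civita_manifold B g' D'"
    and tg: "totally_geodesic A D B D' \<psi>" and W: "open W" "p \<in> W"
    and s: "smooth_vfield_on A W X" "smooth_vfield_on A W Y" "smooth_vfield_on A W Z"
    and e: "extends_field B \<psi> W X W' X'" "extends_field B \<psi> W Y W' Y'" "extends_field B \<psi> W Z W' Z'"
  shows "curvature B D' X' Y' Z' (\<psi> p) = pushforward B \<psi> p (curvature A D X Y Z p)"
proof -
  interpret A: levi_civita_manifold A g D by (rule A)
  interpret B: levi_civita_manifold B g' D' by (rule B)
  have W': "open W'" "\<psi> ` W \<subseteq> W'" using e(1) unfolding extends_field_def by auto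
  have sm: "smooth_vfield_on B W' X'" if "extends_field B \<psi> W X W' X'" for X X'
    using that unfolding extends_field_def by blast
  have val: "D' X' Y' (\<psi> q) = pushforward B \<psi> q (D X Y q)"
    if "smooth_vfield_on A W X" "smooth_vfield_on A W Y" "extends_field B \<psi> W X W' X'"
      "extends_field B \<psi> W Y W' Y'" "q \<in> W" for X Y X' Y' q
  proof -
    have "second_fundamental_form D B D' \<psi> X Y X' Y' q = 0"
      using tg that W(1) unfolding totally_geodesic_def by blast
    then show ?thesis by (simp add: second_fundamental_form_def)
  qed
  have eD: "extends_field B \<psi> W (D X Y) W' (D' X' Y')"
    if "smooth_vfield_on A W X" "smooth_vfield_on A W Y" "extends_field B \<psi> W X W' X'"
      "extends_field B \<psi> W Y W' Y'" for X Y X' Y'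
    using val[OF that] B.D_smooth[OF W'(1) sm[OF that(3)] sm[OF that(4)]] W'
    unfolding extends_field_def by blast
  have "lie_bracket B X' Y' (\<psi> q) = pushforward B \<psi> q (lie_bracket A X Y q)" if q: "q \<in> W" for q
  proof -
    have q': "\<psi> q \<in> W'" using q W'(2) by auto
    show ?thesis
      by (simp add: A.torsion_free[OF W(1) q s(1,2)] B.torsion_free[OF W'(1) q' sm[OF e(1)] sm[OF e(2)]]
          pushforward_linear val[OF s(1,2) e(1,2) q] val[OF s(2,1) e(2,1) q])
  qed
  then have eb: "extends_field B \<psi> W (lie_bracket A X Y) W' (lie_bracket B X' Y')"
    using B.bracket_smooth[OF W'(1) sm[OF e(1)] sm[OF e(2)]] W' unfolding extends_field_def by blast
  note ds = A.D_smooth[OF W(1)]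
  show ?thesis
    unfolding curvature_def pushforward_linear
      val[OF s(1) ds[OF s(2,3)] e(1) eD[OF s(2,3) e(2,3)] W(2)]
      val[OF s(2) ds[OF s(1,3)] e(2) eD[OF s(1,3) e(1,3)] W(2)]
      val[OF A.bracket_smooth[OF W(1) s(1,2)] s(3) eb e(3) W(2)] ..
qed

text \<open>The minus sign is due to the order of the slots: sectional curvature is R(X, V, V, X),
  while \<open>mixed_curvature\<close> supplies R(X, V, X, V).\<close>

lemma (in sasakian_manifold) totally_real_mixed_curvature:
  assumes sf: "sasakian_space_form A \<phi> \<xi> \<eta> g D c"
    and M: "levi_civita_manifold M gM DM" and \<psi>: "isometric_immersion M gM A g \<psi>"
    and tg: "totally_geodesic M DM A D \<psi>" and tr: "phi_totally_real M A g \<phi> \<psi>"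
    and xi: "\<And>z. \<xi> (\<psi> z) \<in> normal_tangent_space M A g \<psi> z"
    and W: "open W" "z \<in> W" and s: "smooth_vfield_on M W X" "smooth_vfield_on M W V"
    and o: "gM z (X z) (V z) = 0"
  shows "gM z (curvature M DM X V X z) (V z) = - ((c + 3) / 4 * (gM z (X z) (X z) * gM z (V z) (V z)))"
proof -
  interpret M: levi_civita_manifold M gM DM by (rule M)
  have smooth: "smooth_map M A \<psi>" and inj: "inj_on (pushforward A \<psi> z) (tangent_space M z)"
    and iso: "\<And>z u v. u \<in> tangent_space M z \<Longrightarrow> v \<in> tangent_space M z \<Longrightarrow>
      g (\<psi> z) (pushforward A \<psi> z u) (pushforward A \<psi> z v) = gM z u v"
    using \<psi> unfolding isometric_immersion_def by auto
  obtain W0 W' where W0: "open W0" "z \<in> W0" "W0 \<subseteq> W"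
    and ext: "\<And>X. smooth_vfield_on M W X \<Longrightarrow> \<exists>X'. extends_field A \<psi> W0 X W' X'"
    using immersion_extension[OF M.atlas atlas smooth inj W] by metis
  \<comment> \<open>As \<xi> is normal along the immersion, a pushed-forward field is orthogonal to
    it there, and truncation leaves these values unchanged.\<close>
  have lift: "\<exists>X'\<in>contact_fields W'. extends_field A \<psi> W0 X W' X'" if X: "smooth_vfield_on M W X" for X
  proof -
    obtain X1 where "extends_field A \<psi> W0 X W' X1" using ext[OF X] by blast
    then have X1: "open W'" "\<psi> ` W0 \<subseteq> W'" "X_on W' X1"
      "\<And>q. q \<in> W0 \<Longrightarrow> X1 (\<psi> q) = pushforward A \<psi> q (X q)"
      unfolding extends_field_def by auto
    obtain X2 where X2: "X2 \<in> contact_fields W'" "\<And>q. q \<in> W' \<Longrightarrow> \<eta> q (X1 q) = 0 \<Longrightarrow> X2 q = X1 q"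
      using contact_truncation[OF X1(1,3)] by metis
    have "X2 (\<psi> q) = pushforward A \<psi> q (X q)" if q: "q \<in> W0" for q
    proof -
      have q': "\<psi> q \<in> W'" using q X1(2) by auto
      have "X q \<in> tangent_space M q" using smooth_vfield_tangent[OF X] q W0(3) by blast
      then have "g (\<psi> q) (\<xi> (\<psi> q)) (X1 (\<psi> q)) = 0"
        using xi[of q] X1(4)[OF q] unfolding normal_tangent_space_def by simp
      then have "\<eta> (\<psi> q) (X1 (\<psi> q)) = 0"
        using eta_g g_sym[OF xi_T] smooth_vfield_tangent[OF X1(3) q'] by metis
      then show ?thesis using X2(2)[OF q'] X1(4)[OF q] by simp
    qed
    then have "extends_field A \<psi> W0 X W' X2"
      using X1(1,2) contact_fieldsD(1)[OF X2(1)] unfolding extends_field_def by blast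
    then show ?thesis using X2(1) by blast
  qed
  obtain X' where X': "X' \<in> contact_fields W'" "extends_field A \<psi> W0 X W' X'" using lift[OF s(1)] by blast
  obtain V' where V': "V' \<in> contact_fields W'" "extends_field A \<psi> W0 V W' V'" using lift[OF s(2)] by blast
  have W': "open W'" "\<psi> z \<in> W'" using X'(2) W0(2) unfolding extends_field_def by auto
  have at: "X' (\<psi> z) = pushforward A \<psi> z (X z)" "V' (\<psi> z) = pushforward A \<psi> z (V z)"
    using X'(2) V'(2) W0(2) unfolding extends_field_def by auto
  note s0 = smooth_vfield_subset[OF s(1) W0(3)] smooth_vfield_subset[OF s(2) W0(3)]
  have T: "X z \<in> tangent_space M z" "V z \<in> tangent_space M z"
    "curvature M DM X V X z \<in> tangent_space M z"
    using smooth_vfield_tangent[OF _ W0(2)] s0 M.curvature_smooth[OF W0(1) s0(1,2,1)] by blast+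
  have "Rm4 X' V' X' V' (\<psi> z) = gM z (curvature M DM X V X z) (V z)"
    unfolding Rm4_def at(2)
      totally_geodesic_curvature[OF M levi_civita_manifold_axioms tg W0(1,2) s0(1,2,1) X'(2) V'(2) X'(2)]
    by (rule iso[OF T(3,2)])
  moreover have "Rm4 X' V' X' V' (\<psi> z) = - Rm4 X' V' V' X' (\<psi> z)"
    by (rule Rm4_skew34[OF W']) (intro contact_fieldsD(1) X' V')+
  moreover have "Rm4 X' V' V' X' (\<psi> z)
      = (c + 3) / 4 * (g (\<psi> z) (X' (\<psi> z)) (X' (\<psi> z)) * g (\<psi> z) (V' (\<psi> z)) (V' (\<psi> z)))"
  proof (rule space_form_sectional[OF sf W' X'(1) V'(1)])
    show "g (\<psi> z) (X' (\<psi> z)) (V' (\<psi> z)) = 0" using iso[OF T(1,2)] o by (simp add: at)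
    have "\<phi> (\<psi> z) (V' (\<psi> z)) \<in> normal_tangent_space M A g \<psi> z"
      using tr T(2) unfolding phi_totally_real_def at(2) by blast
    then have "g (\<psi> z) (\<phi> (\<psi> z) (V' (\<psi> z))) (X' (\<psi> z)) = 0"
      using T(1) unfolding normal_tangent_space_def at(1) by blast
    then show "g (\<psi> z) (X' (\<psi> z)) (\<phi> (\<psi> z) (V' (\<psi> z))) = 0"
      using g_sym[OF contact_fieldsD(4)[OF X'(1)] phi_T[OF contact_fieldsD(4)[OF V'(1)]]] by simp
  qed
  ultimately show ?thesis using iso[OF T(1,1)] iso[OF T(2,2)] by (simp add: at)
qed

theorem corollary3p18:
  fixes B :: "('p::{t2_space, second_countable_topology}, 'b::euclidean_space) atlas"
    and gB :: "'p metric" and DB :: "'p connection"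
    and F :: "('q::{t2_space, second_countable_topology}, 'f::euclidean_space) atlas"
    and gF :: "'q metric"
    and f :: "'p \<Rightarrow> real"
    and M :: "('p \<times> 'q, 'b \<times> 'f) atlas"
    and g :: "('p \<times> 'q) metric" and D :: "('p \<times> 'q) connection"
    and M' :: "('r::{t2_space, second_countable_topology}, 'm::euclidean_space) atlas"
    and \<phi> :: "'r \<Rightarrow> 'r tvec \<Rightarrow> 'r tvec" and \<xi> :: "'r vfield"
    and \<eta> :: "'r \<Rightarrow> 'r tvec \<Rightarrow> real"
    and g' :: "'r metric" and D' :: "'r connection"
    and c :: real and \<psi> :: "'p \<times> 'q \<Rightarrow> 'r" and m\<^sub>1 :: nat
  assumes "smooth_atlas B" and "riemannian_metric B gB" and "levi_civita B gB DB"
    and "smooth_atlas F" and "riemannian_metric F gF"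
    and "smooth_fun_on B UNIV f" and "\<And>b. f b > 0"
    and "M = product_atlas B F" and "g = warped_metric B gB F gF f" and "levi_civita M g D"
    and "m\<^sub>1 = manifold_dim B"
    and "smooth_atlas M'" and "sasakian_space_form M' \<phi> \<xi> \<eta> g' D' c"
    and "isometric_immersion M g M' g' \<psi>"
    and "totally_geodesic M D M' D' \<psi>"
    and "phi_totally_real M M' g' \<phi> \<psi>"
    and "\<And>z. \<xi> (\<psi> z) \<in> normal_tangent_space M M' g' \<psi> z"
  shows "\<And>W v b. open W \<Longrightarrow> b \<in> W \<Longrightarrow> orthonormal_frame_on B gB W v \<Longrightarrow>
    real m\<^sub>1 * ((c + 3) / 4) \<le> laplacian B DB v f b / f b \<and>
    laplacian B DB v f b / f b \<le> real m\<^sub>1 * ((c + 3) / 4)"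
proof -
  fix W v b
  assume W: "open W" "b \<in> W" and fr: "orthonormal_frame_on B gB W v"
  interpret product_manifold B F using assms(1,4) by unfold_locales
  interpret warped_product B F gB DB gF f D
    by unfold_locales (use assms product_smooth_atlas in auto)
  have sas: "sasakian M' \<phi> \<xi> \<eta> g' D'" using assms(13) unfolding sasakian_space_form_def by blast
  then have "riemannian_metric M' g'" "levi_civita M' g' D'"
    unfolding sasakian_def almost_contact_metric_def by blast+
  then interpret amb: sasakian_manifold M' g' D' \<phi> \<xi> \<eta>
    using assms(12) sas by unfold_locales
  \<comment> \<open>The Laplacian lives on the base, so any point of the fibre will do.\<close>
  define q :: 'q where "q = undefined"
  obtain V y where V: "(V, y) \<in> F" "q \<in> V" by (rule chart_at[OF assms(4)])
  \<comment> \<open>Positive dimension of the fibre enters here: a basis vector of its model space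
    gives a vertical field that is nonzero at \<open>q\<close>.\<close>
  obtain e :: 'f where e: "e \<in> Basis" using nonempty_Basis by blast
  have "coord_vec F (V, y) q e \<noteq> coord_vec F (V, y) q 0"
    using coord_vec_inj[OF assms(4) V] nonzero_Basis[OF e] by blast
  then have w0: "coord_vec F (V, y) q e \<noteq> 0" by (simp add: linear_0[OF coord_vec_linear[OF assms(4) V]])
  obtain N Y where N: "open N" "q \<in> N" and Y: "smooth_vfield_on F N Y" "Y q = coord_vec F (V, y) q e"
    using exists_field[OF assms(4) coord_vec_tangent[OF V, of e]] by metis
  define G where "G = gF q (Y q) (Y q)"
  have G: "G > 0" unfolding G_def using gF_pos[OF smooth_vfield_tangent[OF Y(1) N(2)]] Y(2) w0 by simp
  have z: "(b, q) \<in> W \<times> N" using W N by simp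
  have fb: "f b > 0" by (rule assms(7))
  have summand: "DB (v i) (v i) b f - v i b (\<lambda>q. v i q f) = (c + 3) / 4 * f b" if i: "i < manifold_dim B" for i
  proof -
    have X: "smooth_vfield_on B W (v i)" and n: "gB b (v i b) (v i b) = 1"
      using fr i W(2) unfolding orthonormal_frame_on_def by auto
    have "f b * (v i b (\<lambda>b. v i b f) - DB (v i) (v i) b f) * G
        = - ((c + 3) / 4 * (gM (b, q) (hor (v i) (b, q)) (hor (v i) (b, q))
            * gM (b, q) (ver Y (b, q)) (ver Y (b, q))))"
      using mixed_curvature[OF W(1) N(1) X Y(1) z]
        amb.totally_real_mixed_curvature[where X = "hor (v i)" and V = "ver Y" and z = "(b, q)"
          and W = "W \<times> N", OF assms(13) total.levi_civita_manifold_axioms assms(14-17)[unfolded assms(8,9)]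
          open_Times[OF W(1) N(1)] z hor_smooth[OF W(1) X] ver_smooth[OF N(1) Y(1)]
          gM_hor_ver(1)[OF W(1) N(1) X Y(1) z]]
      by (simp add: G_def)
    also have "\<dots> = - ((c + 3) / 4 * ((f b)\<^sup>2 * G))"
      using gM_hor_hor[OF W(1) N(1) X X z] gM_ver_ver[OF W(1) N(1) Y(1) Y(1) z] n by (simp add: G_def)
    finally have eq: "f b * (v i b (\<lambda>b. v i b f) - DB (v i) (v i) b f) * G = - ((c + 3) / 4 * ((f b)\<^sup>2 * G))" .
    \<comment> \<open>The derivatives are abstracted to \<open>a\<close> and \<open>d\<close>, and
      the positive factor f b * G is cancelled.\<close>
    have "d - a = k * f b" if "f b * (a - d) * G = - (k * ((f b)\<^sup>2 * G))" for a d k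
    proof -
      have "(f b * G) * (d - a) = (f b * G) * (k * f b)"
        using that by (simp add: algebra_simps power2_eq_square)
      then show ?thesis using fb G by simp
    qed
    from this[OF eq] show ?thesis .
  qed
  have "laplacian B DB v f b = (\<Sum>i<manifold_dim B. (c + 3) / 4 * f b)"
    unfolding laplacian_def by (rule sum.cong) (simp_all add: summand)
  then have "laplacian B DB v f b / f b = real m\<^sub>1 * ((c + 3) / 4)"
    using fb by (simp add: assms(11))
  then show "real m\<^sub>1 * ((c + 3) / 4) \<le> laplacian B DB v f b / f b \<and>
    laplacian B DB v f b / f b \<le> real m\<^sub>1 * ((c + 3) / 4)" by simp
qed

end
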